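(* Let $n$ be sufficiently large and let $d\ge 3$ be a fixed integer ($d=O(1)$). Let $1<\alpha<d-1$ and $b>0$ be constants. Then there exist constants $\delta=\delta(\alpha)>0$ and $C=C(\alpha)>0$ such that the following holds. Let $G=(V,E)$ be a $d$-regular graph on $n$ vertices satisfying: (R1) for every $U\subseteq V$ with $|U|\le n/2$, $e_G(U,U^c)\ge b|U|$; (R2) for every $U\subseteq V$ with $|U|\le \log^C n$, $e_G(U)\le (1+\delta)|U|$. Set $p=\frac{\alpha}{d-1}$. Then with high probability $G[V_p]$ contains a unique giant component $L_1$ with $|V(L_1)|=(1+o_\delta(1))x\cdot n$, and all other components of $G[V_p]$ have at most $\frac{9\alpha}{\left(\frac{1-\delta}{1+\delta}\alpha-1\right)^2}\log n$ vertices.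
   Context: $V_p\subseteq V$ is the random set obtained by including each vertex independently with probability $p$, and $G[V_p]$ is the induced subgraph. $e_G(U)$ is the number of edges of $G$ with both endpoints in $U$; $e_G(U,U^c)$ the number of edges between $U$ and $U^c=V\setminus U$. "With high probability" means with probability tending to $1$ as $n\to\infty$; $o_\delta(1)$ denotes a term that tends to $0$ as $\delta\to 0$. Logarithms are natural. The quantity $x=x(p)$: let $q$ be the unique solution in $(0,1)$ of $q=(1-p+pq)^{d-1}$ and set $x=p-pq(1-p)-p^2q^2$. *)

theory Defs
  imports "HOL-Probability.Probability"
begin

text \<open>A finite simple graph is given by its vertex set and its set of edges, each edge being a
  two-element set of vertices.\<close>

definition simple_graph :: "'a set \<Rightarrow> 'a set set \<Rightarrow> bool" where
  "simple_graph V E \<longleftrightarrow> finite V \<and> E \<subseteq> {e. e \<subseteq> V \<and> card e = 2}"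

definition regular_graph :: "nat \<Rightarrow> 'a set \<Rightarrow> 'a set set \<Rightarrow> bool" where
  "regular_graph d V E \<longleftrightarrow> simple_graph V E \<and> (\<forall>v\<in>V. card {e \<in> E. v \<in> e} = d)"

definition induced_edges :: "'a set set \<Rightarrow> 'a set \<Rightarrow> 'a set set" where
  "induced_edges E U = {e \<in> E. e \<subseteq> U}"

definition edges_in :: "'a set set \<Rightarrow> 'a set \<Rightarrow> nat" where
  "edges_in E U = card (induced_edges E U)"

definition edges_between :: "'a set set \<Rightarrow> 'a set \<Rightarrow> 'a set \<Rightarrow> nat" where
  "edges_between E U W = card {e \<in> E. \<exists>u\<in>U. \<exists>w\<in>W. e = {u, w}}"

definition components :: "'a set \<Rightarrow> 'a set set \<Rightarrow> 'a set set" where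
  "components V E = V // {(u, v) \<in> V \<times> V. (u, v) \<in> {(x, y). {x, y} \<in> E}\<^sup>*}"

definition edge_expanding :: "real \<Rightarrow> 'a set \<Rightarrow> 'a set set \<Rightarrow> bool" where
  "edge_expanding b V E \<longleftrightarrow>
     (\<forall>U\<subseteq>V. real (card U) \<le> real (card V) / 2 \<longrightarrow>
        real (edges_between E U (V - U)) \<ge> b * real (card U))"

definition locally_sparse :: "real \<Rightarrow> real \<Rightarrow> 'a set \<Rightarrow> 'a set set \<Rightarrow> bool" where
  "locally_sparse \<delta> C V E \<longleftrightarrow>
     (\<forall>U\<subseteq>V. real (card U) \<le> ln (real (card V)) powr C \<longrightarrow>
        real (edges_in E U) \<le> (1 + \<delta>) * real (card U))"

definition random_subset :: "real \<Rightarrow> 'a set \<Rightarrow> 'a set pmf" where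
  "random_subset p V = map_pmf (\<lambda>f. {v \<in> V. f v}) (Pi_pmf V False (\<lambda>_. bernoulli_pmf p))"

text \<open>For \<open>1 / (d - 1) < p < 1\<close> and \<open>d \<ge> 3\<close> the fixed-point equation below has exactly one solution in
  the open unit interval (\<open>q = 1\<close> is always a further solution). It is the extinction probability of the
  Galton-Watson tree with offspring distribution \<open>Bin(d - 1, p)\<close>.\<close>

definition extinction :: "nat \<Rightarrow> real \<Rightarrow> real" where
  "extinction d p = (THE q. 0 < q \<and> q < 1 \<and> q = (1 - p + p * q) ^ (d - 1))"

definition giant_density :: "nat \<Rightarrow> real \<Rightarrow> real" where
  "giant_density d p = (let q = extinction d p in p - p * q * (1 - p) - p\<^sup>2 * q\<^sup>2)"

text \<open>For \<open>n = card V\<close>, this is the event that \<open>G[U]\<close> has exactly one component with at least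
  \<open>c * n\<close> vertices (the giant), that its size is \<open>(1 \<plusminus> \<epsilon>) x n\<close>, and that every other component has at
  most \<open>K ln n\<close> vertices. The constant \<open>c > 0\<close> makes ``giant'' mean ``of linear size''.\<close>

definition unique_giant ::
    "real \<Rightarrow> real \<Rightarrow> real \<Rightarrow> real \<Rightarrow> 'a set \<Rightarrow> 'a set set \<Rightarrow> 'a set \<Rightarrow> bool" where
  "unique_giant c x \<epsilon> K V E U \<longleftrightarrow>
     (\<exists>L. {L' \<in> components U (induced_edges E U). real (card L') \<ge> c * real (card V)} = {L} \<and>
          \<bar>real (card L) - x * real (card V)\<bar> \<le> \<epsilon> * (x * real (card V)) \<and>
          (\<forall>L' \<in> components U (induced_edges E U). L' \<noteq> L \<longrightarrow>
             real (card L') \<le> K * ln (real (card V))))"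

end

theory Submission
  imports Defs
begin

text \<open>
  The cluster of a vertex set \<open>S\<close> equals \<open>T\<close> with probability \<open>p^|T - S| (1 - p)^|\<partial>T|\<close>, and for every
  density these weights sum to \<open>1\<close>. By local sparsity \<open>|\<partial>T| \<ge> (\<beta> - 1) |T|\<close> for sets of polylogarithmic
  size, where \<open>\<beta> = (d - 1 - \<delta>) / (1 + \<delta>)\<close> satisfies \<open>\<beta> p > 1\<close>, so a comparison with the density \<open>1 / \<beta>\<close>
  shows that a cluster of size between \<open>k\<close> and \<open>log^N n\<close> has probability exponentially small in \<open>k\<close>,
  and that the exploration from a ball with \<open>log^2 n\<close> vertices reaches a cluster of size \<open>log^N n\<close> with
  overwhelming probability. Hence every vertex has a large cluster within distance \<open>O(log log n)\<close>.
  Write \<open>V_p\<close> as the union of two independent sets of densities \<open>p1\<close> slightly below \<open>p\<close> and \<open>p2\<close>. By edge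
  expansion any two groups of large clusters of the first set are joined by many disjoint paths of
  length \<open>O(log log n)\<close>, and a union bound over all groups shows that the second set merges them all.

  For the size of the giant, the number of vertices in large clusters has bounded differences, hence
  small variance. Its expectation is found locally: most vertices have a tree-like neighbourhood, and on
  trees the weights at \<open>p\<close> are proportional to those at the dual subcritical density \<open>r\<close> with
  \<open>r (1 - r)^(d - 2) = p (1 - p)^(d - 2)\<close>.
\<close>

subsection \<open>Random subsets with independent membership\<close>

text \<open>The constant \<open>C\<close> may depend on \<alpha> only, not on \<open>d\<close> or
  \<open>b\<close>, and this shapes the merging argument. A group of \<open>j\<close> large clusters
  is joined to the rest by at least \<open>b * j * M\<close> divided by a power of
  \<open>l = ln n\<close> many disjoint paths, each contained in the second set with probability at
  least \<open>p2 ^ (2 * R + 4)\<close>. To beat the number of groups, \<open>M\<close> must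
  outweigh both losses, so their exponents must be controlled. Balls grow at least by the square
  root of \<open>D = d - 1\<close> per step, so \<open>R\<close> can be about
  \<open>4 * ln l / ln D\<close>, and \<open>p2\<close> is at least a power of \<open>1 / D\<close>
  whose exponent depends on \<alpha> only. Every loss is then a power of \<open>l\<close> with
  exponent fixed by \<alpha>, times a constant that one more factor \<open>l\<close> absorbs. Two
  sparsity parameters occur: the cap \<delta>0 fixes \<beta>, the split into two rounds and the
  threshold \<open>c\<close>, whereas the actual \<delta> governs the bound on the other components
  and the error of the density. That error is a trade-off: a larger cutoff \<open>h\<close> for
  small clusters shrinks the truncation error but multiplies the share of vertices that see a short
  cycle, which is of order \<delta> for fixed \<open>h\<close>.\<close>

definition subset_weight :: "('a \<Rightarrow> real) \<Rightarrow> 'a set \<Rightarrow> 'a set \<Rightarrow> real" where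
  "subset_weight \<pi> V U = (\<Prod>v\<in>V. if v \<in> U then \<pi> v else 1 - \<pi> v)"

text \<open>The density may vary from vertex to vertex because the sets between the two rounds of
  sprinkling have density \<open>p\<close> on some vertices and \<open>p1\<close> on the
  others.\<close>

definition subset_exp :: "('a \<Rightarrow> real) \<Rightarrow> 'a set \<Rightarrow> ('a set \<Rightarrow> real) \<Rightarrow> real" where
  "subset_exp \<pi> V f = (\<Sum>U\<in>Pow V. subset_weight \<pi> V U * f U)"

definition subset_prob :: "('a \<Rightarrow> real) \<Rightarrow> 'a set \<Rightarrow> ('a set \<Rightarrow> bool) \<Rightarrow> real" where
  "subset_prob \<pi> V P = subset_exp \<pi> V (\<lambda>U. of_bool (P U))"

lemma subset_exp_empty [simp]: "subset_exp \<pi> {} f = f {}"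
  by (simp add: subset_exp_def subset_weight_def)

text \<open>Conditioning on the membership of \<open>v\<close>; this is the recursion behind the
  inductions on \<open>V\<close> below.\<close>

lemma subset_exp_insert:
  assumes "finite V" "v \<notin> V"
  shows "subset_exp \<pi> (insert v V) f =
    \<pi> v * subset_exp \<pi> V (\<lambda>U. f (insert v U)) + (1 - \<pi> v) * subset_exp \<pi> V f"
proof -
  have inj: "inj_on (insert v) (Pow V)"
    using assms by (auto simp: inj_on_def)
  have disj: "Pow V \<inter> insert v ` Pow V = {}"
    using assms by auto
  have w1: "subset_weight \<pi> (insert v V) (insert v U) = \<pi> v * subset_weight \<pi> V U" if "U \<subseteq> V" for U
  proof -
    have "(\<Prod>w\<in>V. if w \<in> insert v U then \<pi> w else 1 - \<pi> w) = (\<Prod>w\<in>V. if w \<in> U then \<pi> w else 1 - \<pi> w)"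
      by (rule prod.cong) (use assms in auto)
    then show ?thesis
      using assms unfolding subset_weight_def by simp
  qed
  have w0: "subset_weight \<pi> (insert v V) U = (1 - \<pi> v) * subset_weight \<pi> V U" if "U \<subseteq> V" for U
    using assms that unfolding subset_weight_def by auto
  have "subset_exp \<pi> (insert v V) f =
      (\<Sum>U\<in>Pow V. subset_weight \<pi> (insert v V) U * f U)
      + (\<Sum>U\<in>insert v ` Pow V. subset_weight \<pi> (insert v V) U * f U)"
    unfolding subset_exp_def Pow_insert using assms disj by (intro sum.union_disjoint) auto
  also have "(\<Sum>U\<in>insert v ` Pow V. subset_weight \<pi> (insert v V) U * f U) =
      (\<Sum>U\<in>Pow V. subset_weight \<pi> (insert v V) (insert v U) * f (insert v U))"
    by (subst sum.reindex[OF inj]) simp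
  also have "\<dots> = \<pi> v * subset_exp \<pi> V (\<lambda>U. f (insert v U))"
    unfolding subset_exp_def sum_distrib_left by (rule sum.cong) (auto simp: w1)
  also have "(\<Sum>U\<in>Pow V. subset_weight \<pi> (insert v V) U * f U) = (1 - \<pi> v) * subset_exp \<pi> V f"
    unfolding subset_exp_def sum_distrib_left by (rule sum.cong) (auto simp: w0)
  finally show ?thesis by simp
qed

lemma subset_exp_add: "subset_exp \<pi> V (\<lambda>U. f U + g U) = subset_exp \<pi> V f + subset_exp \<pi> V g"
  by (simp add: subset_exp_def algebra_simps sum.distrib)

lemma subset_exp_cmult: "subset_exp \<pi> V (\<lambda>U. k * f U) = k * subset_exp \<pi> V f"
  by (simp add: subset_exp_def sum_distrib_left mult.left_commute)

lemma subset_exp_multc: "subset_exp \<pi> V (\<lambda>U. f U * k) = subset_exp \<pi> V f * k"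
  by (simp add: subset_exp_def sum_distrib_right mult.assoc)

lemma subset_exp_sum: "subset_exp \<pi> V (\<lambda>U. \<Sum>i\<in>I. f i U) = (\<Sum>i\<in>I. subset_exp \<pi> V (f i))"
  unfolding subset_exp_def sum_distrib_left by (rule sum.swap)

lemma subset_exp_cong:
  "(\<And>U. U \<subseteq> V \<Longrightarrow> f U = g U) \<Longrightarrow> subset_exp \<pi> V f = subset_exp \<pi> V g"
  unfolding subset_exp_def by (rule sum.cong) auto

lemma subset_prob_cong:
  "(\<And>U. U \<subseteq> V \<Longrightarrow> P U = Q U) \<Longrightarrow> subset_prob \<pi> V P = subset_prob \<pi> V Q"
  unfolding subset_prob_def by (rule subset_exp_cong) auto

lemma subset_exp_const [simp]: "finite V \<Longrightarrow> subset_exp \<pi> V (\<lambda>_. k) = k"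
proof (induction V rule: finite_induct)
  case (insert v V)
  then show ?case by (simp add: subset_exp_insert algebra_simps)
qed simp

definition prob_weights :: "('a \<Rightarrow> real) \<Rightarrow> 'a set \<Rightarrow> bool" where
  "prob_weights \<pi> V \<longleftrightarrow> (\<forall>v\<in>V. 0 \<le> \<pi> v \<and> \<pi> v \<le> 1)"

lemma subset_weight_nonneg: "prob_weights \<pi> V \<Longrightarrow> 0 \<le> subset_weight \<pi> V U"
  unfolding subset_weight_def prob_weights_def by (intro prod_nonneg) auto

lemma subset_exp_mono:
  assumes "prob_weights \<pi> V" "\<And>U. U \<subseteq> V \<Longrightarrow> f U \<le> g U"
  shows "subset_exp \<pi> V f \<le> subset_exp \<pi> V g"
  unfolding subset_exp_def
  using assms by (intro sum_mono mult_left_mono subset_weight_nonneg) auto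

lemma subset_exp_le_const:
  assumes "finite V" "prob_weights \<pi> V" "\<And>U. U \<subseteq> V \<Longrightarrow> f U \<le> k"
  shows "subset_exp \<pi> V f \<le> k"
  using subset_exp_mono[OF assms(2), of f "\<lambda>_. k"] assms by simp

lemma subset_prob_mono:
  assumes "prob_weights \<pi> V" "\<And>U. U \<subseteq> V \<Longrightarrow> P U \<Longrightarrow> Q U"
  shows "subset_prob \<pi> V P \<le> subset_prob \<pi> V Q"
  unfolding subset_prob_def by (rule subset_exp_mono) (use assms in auto)

lemma subset_prob_nonneg: "prob_weights \<pi> V \<Longrightarrow> 0 \<le> subset_prob \<pi> V P"
  unfolding subset_prob_def subset_exp_def by (intro sum_nonneg) (auto simp: subset_weight_nonneg)

lemma subset_prob_le_1: "finite V \<Longrightarrow> prob_weights \<pi> V \<Longrightarrow> subset_prob \<pi> V P \<le> 1"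
  unfolding subset_prob_def by (rule subset_exp_le_const) auto

lemma subset_prob_not:
  assumes "finite V"
  shows "subset_prob \<pi> V (\<lambda>U. \<not> P U) = 1 - subset_prob \<pi> V P"
proof -
  have "subset_prob \<pi> V (\<lambda>U. \<not> P U) + subset_prob \<pi> V P = subset_exp \<pi> V (\<lambda>_. 1)"
    unfolding subset_prob_def subset_exp_add[symmetric] by (rule subset_exp_cong) auto
  then show ?thesis using assms by simp
qed

lemma subset_prob_disj:
  assumes "prob_weights \<pi> V"
  shows "subset_prob \<pi> V (\<lambda>U. P U \<or> Q U) \<le> subset_prob \<pi> V P + subset_prob \<pi> V Q"
  unfolding subset_prob_def subset_exp_add[symmetric] by (rule subset_exp_mono) (use assms in auto)

lemma subset_prob_Ex:
  assumes "prob_weights \<pi> V" "finite I"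
  shows "subset_prob \<pi> V (\<lambda>U. \<exists>i\<in>I. P i U) \<le> (\<Sum>i\<in>I. subset_prob \<pi> V (P i))"
  unfolding subset_prob_def subset_exp_sum[symmetric]
proof (rule subset_exp_mono[OF assms(1)])
  fix U
  show "of_bool (\<exists>i\<in>I. P i U) \<le> (\<Sum>i\<in>I. of_bool (P i U) :: real)"
  proof (cases "\<exists>i\<in>I. P i U")
    case True
    then obtain i where "i \<in> I" "P i U" by blast
    then have "(1::real) = of_bool (P i U)" by simp
    also have "\<dots> \<le> (\<Sum>i\<in>I. of_bool (P i U) :: real)"
      using assms \<open>i \<in> I\<close> by (intro member_le_sum) auto
    finally show ?thesis using True by simp
  qed (simp add: sum_nonneg)
qed

lemma subset_prob_partition:
  assumes "finite J" "\<And>U. U \<subseteq> V \<Longrightarrow> P U \<Longrightarrow> \<Phi> U \<in> J"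
  shows "subset_prob \<pi> V P = (\<Sum>T\<in>J. subset_prob \<pi> V (\<lambda>U. \<Phi> U = T \<and> P U))"
  unfolding subset_prob_def subset_exp_sum[symmetric]
proof (rule subset_exp_cong)
  fix U assume U: "U \<subseteq> V"
  show "of_bool (P U) = (\<Sum>T\<in>J. of_bool (\<Phi> U = T \<and> P U) :: real)"
  proof (cases "P U")
    case True
    have "(\<Sum>T\<in>J. of_bool (\<Phi> U = T \<and> P U) :: real) = (\<Sum>T\<in>J. if \<Phi> U = T then 1 else 0)"
      by (rule sum.cong) (auto simp: True)
    then show ?thesis using assms True U by (simp add: sum.delta)
  qed simp
qed

section \<open>Product structure: independence, cylinder events and couplings\<close>

lemma subset_exp_Un:
  assumes "finite A" "finite B" "A \<inter> B = {}"
  shows "subset_exp \<pi> (A \<union> B) f = subset_exp \<pi> A (\<lambda>X. subset_exp \<pi> B (\<lambda>Y. f (X \<union> Y)))"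
  using assms
proof (induction A arbitrary: f rule: finite_induct)
  case (insert v A)
  then have v: "v \<notin> A \<union> B" "finite (A \<union> B)" by auto
  have "subset_exp \<pi> (insert v A \<union> B) f = subset_exp \<pi> (insert v (A \<union> B)) f" by simp
  also have "\<dots> = subset_exp \<pi> (insert v A) (\<lambda>X. subset_exp \<pi> B (\<lambda>Y. f (X \<union> Y)))"
    using insert v by (simp add: subset_exp_insert)
  finally show ?case .
qed simp

text \<open>Fubini over \<open>A\<close> and \<open>V - A\<close>, since \<open>f\<close> sees only
  the part inside \<open>A\<close> and \<open>g\<close> only the part outside.\<close>

lemma subset_exp_indep:
  assumes "finite V" "A \<subseteq> V"
    and "\<And>U. U \<subseteq> V \<Longrightarrow> f U = f (U \<inter> A)" "\<And>U. U \<subseteq> V \<Longrightarrow> g U = g (U - A)"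
  shows "subset_exp \<pi> V (\<lambda>U. f U * g U) = subset_exp \<pi> V f * subset_exp \<pi> V g"
proof -
  have fin: "finite A" "finite (V - A)"
    using assms finite_subset by auto
  have V: "V = A \<union> (V - A)" using assms by auto
  have fX: "f (X \<union> Y) = f X" if "X \<subseteq> A" "Y \<subseteq> V - A" for X Y
  proof -
    have "(X \<union> Y) \<inter> A = X \<inter> A" using that by auto
    moreover have "X \<union> Y \<subseteq> V" "X \<subseteq> V" using that assms by auto
    ultimately show ?thesis using assms(3) by metis
  qed
  have gY: "g (X \<union> Y) = g Y" if "X \<subseteq> A" "Y \<subseteq> V - A" for X Y
  proof -
    have "(X \<union> Y) - A = Y - A" using that by auto
    moreover have "X \<union> Y \<subseteq> V" "Y \<subseteq> V" using that assms by auto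
    ultimately show ?thesis using assms(4) by metis
  qed
  have split: "subset_exp \<pi> V h = subset_exp \<pi> A (\<lambda>X. subset_exp \<pi> (V - A) (\<lambda>Y. h (X \<union> Y)))" for h
    by (subst V, rule subset_exp_Un) (use fin in auto)
  have 1: "subset_exp \<pi> V f = subset_exp \<pi> A f"
    unfolding split[of f]
    by (rule subset_exp_cong, subst subset_exp_cong[of _ _ "\<lambda>_. f _"]) (use fin fX in auto)
  have 2: "subset_exp \<pi> V g = subset_exp \<pi> (V - A) g"
  proof -
    have "subset_exp \<pi> V g = subset_exp \<pi> A (\<lambda>X. subset_exp \<pi> (V - A) g)"
      unfolding split[of g]
      by (intro subset_exp_cong) (use gY in auto)
    then show ?thesis using fin by simp
  qed
  have "subset_exp \<pi> V (\<lambda>U. f U * g U) = subset_exp \<pi> A (\<lambda>X. subset_exp \<pi> (V - A) (\<lambda>Y. f X * g Y))"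
    unfolding split[of "\<lambda>U. f U * g U"]
    by (intro subset_exp_cong) (use fX gY in auto)
  also have "\<dots> = subset_exp \<pi> A f * subset_exp \<pi> (V - A) g"
    by (simp add: subset_exp_cmult subset_exp_multc)
  finally show ?thesis using 1 2 by simp
qed

lemma subset_prob_cylinder:
  assumes "finite V" "A \<subseteq> V" "B \<subseteq> V" "A \<inter> B = {}"
  shows "subset_prob \<pi> V (\<lambda>U. A \<subseteq> U \<and> B \<inter> U = {}) = (\<Prod>v\<in>A. \<pi> v) * (\<Prod>v\<in>B. 1 - \<pi> v)"
  using assms
proof (induction V arbitrary: A B rule: finite_induct)
  case empty
  then show ?case by (simp add: subset_prob_def)
next
  case (insert v V)
  have fin: "finite A" "finite B"
    using insert finite_subset by (metis finite_insert)+
  have IH: "subset_prob \<pi> V (\<lambda>U. A - {v} \<subseteq> U \<and> (B - {v}) \<inter> U = {}) =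
      (\<Prod>w\<in>A - {v}. \<pi> w) * (\<Prod>w\<in>B - {v}. 1 - \<pi> w)"
    by (rule insert.IH) (use insert.prems in auto)
  have eqs: "A \<subseteq> insert v U \<longleftrightarrow> A - {v} \<subseteq> U"
      "B \<inter> insert v U = {} \<longleftrightarrow> v \<notin> B \<and> (B - {v}) \<inter> U = {}"
      "U \<subseteq> V \<Longrightarrow> A \<subseteq> U \<longleftrightarrow> v \<notin> A \<and> A - {v} \<subseteq> U"
      "U \<subseteq> V \<Longrightarrow> B \<inter> U = {} \<longleftrightarrow> (B - {v}) \<inter> U = {}" for A B U
    using insert.hyps by auto
  have e1: "subset_exp \<pi> V (\<lambda>U. of_bool (A \<subseteq> insert v U \<and> B \<inter> insert v U = {})) =
      of_bool (v \<notin> B) * subset_prob \<pi> V (\<lambda>U. A - {v} \<subseteq> U \<and> (B - {v}) \<inter> U = {})"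
    unfolding subset_prob_def subset_exp_cmult[symmetric] eqs(1,2)
    by (rule subset_exp_cong) auto
  have e2: "subset_exp \<pi> V (\<lambda>U. of_bool (A \<subseteq> U \<and> B \<inter> U = {})) =
      of_bool (v \<notin> A) * subset_prob \<pi> V (\<lambda>U. A - {v} \<subseteq> U \<and> (B - {v}) \<inter> U = {})"
    unfolding subset_prob_def subset_exp_cmult[symmetric]
  proof (rule subset_exp_cong)
    fix U assume U: "U \<subseteq> V"
    show "of_bool (A \<subseteq> U \<and> B \<inter> U = {}) =
        of_bool (v \<notin> A) * (of_bool (A - {v} \<subseteq> U \<and> (B - {v}) \<inter> U = {}) :: real)"
      unfolding eqs(3)[OF U, of A] eqs(4)[OF U, of B] by (cases "v \<in> A") auto
  qed
  have pa: "(\<Prod>w\<in>A. \<pi> w) = (if v \<in> A then \<pi> v else 1) * (\<Prod>w\<in>A - {v}. \<pi> w)"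
    using fin by (auto simp: prod.remove)
  have pb: "(\<Prod>w\<in>B. 1 - \<pi> w) = (if v \<in> B then 1 - \<pi> v else 1) * (\<Prod>w\<in>B - {v}. 1 - \<pi> w)"
    using fin by (auto simp: prod.remove)
  show ?case
    unfolding subset_prob_def[of \<pi> "insert v V"] subset_exp_insert[OF insert.hyps] e1 e2 IH pa pb
    using insert.prems by (auto simp: algebra_simps)
qed

text \<open>A vertex avoids the union of two independent sets iff it avoids both, so the avoidance
  probabilities multiply.\<close>

lemma subset_exp_coupling:
  assumes "finite V" "\<And>v. v \<in> V \<Longrightarrow> 1 - \<pi> v = (1 - \<pi>1 v) * (1 - \<pi>2 v)"
  shows "subset_exp \<pi>1 V (\<lambda>X. subset_exp \<pi>2 V (\<lambda>Y. f (X \<union> Y))) = subset_exp \<pi> V f"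
  using assms
proof (induction V arbitrary: f rule: finite_induct)
  case (insert v V)
  let ?F1 = "subset_exp \<pi> V (\<lambda>U. f (insert v U))"
  let ?F0 = "subset_exp \<pi> V f"
  have IH: "subset_exp \<pi>1 V (\<lambda>X. subset_exp \<pi>2 V (\<lambda>Y. f (X \<union> Y))) = subset_exp \<pi> V f" for f
    using insert by auto
  have eq: "1 - \<pi> v = (1 - \<pi>1 v) * (1 - \<pi>2 v)" using insert by auto
  have pv: "\<pi> v = 1 - (1 - \<pi>1 v) * (1 - \<pi>2 v)" using eq by simp
  have I1: "subset_exp \<pi>1 V (\<lambda>X. subset_exp \<pi>2 V (\<lambda>Y. f (insert v (X \<union> Y)))) = ?F1"
    using IH[of "\<lambda>U. f (insert v U)"] by simp
  have "subset_exp \<pi>1 (insert v V) (\<lambda>X. subset_exp \<pi>2 (insert v V) (\<lambda>Y. f (X \<union> Y)))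
      = \<pi>1 v * (\<pi>2 v * ?F1 + (1 - \<pi>2 v) * ?F1) + (1 - \<pi>1 v) * (\<pi>2 v * ?F1 + (1 - \<pi>2 v) * ?F0)"
    using insert.hyps
    by (simp add: subset_exp_insert subset_exp_add subset_exp_cmult I1 IH) (simp add: algebra_simps)
  also have "\<dots> = \<pi> v * ?F1 + (1 - \<pi> v) * ?F0"
    unfolding pv by (simp add: algebra_simps)
  finally show ?case using insert.hyps by (simp add: subset_exp_insert)
qed simp

text \<open>Deleting the vertices outside \<open>A\<close> amounts to density zero there. Together
  with the coupling this yields the law of a partially sprinkled set.\<close>

lemma subset_exp_restrict:
  assumes "finite V"
  shows "subset_exp \<pi> V (\<lambda>U. f (U \<inter> A)) = subset_exp (\<lambda>v. if v \<in> A then \<pi> v else 0) V f"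
  using assms
proof (induction V arbitrary: f rule: finite_induct)
  case (insert v V)
  show ?case
  proof (cases "v \<in> A")
    case True
    then show ?thesis
      using insert.hyps insert.IH[of "\<lambda>U. f (insert v U)"] insert.IH[of f]
      by (simp add: subset_exp_insert)
  next
    case False
    then show ?thesis using insert by (simp add: subset_exp_insert algebra_simps)
  qed
qed simp

text \<open>Conditioning on the membership of \<open>v\<close> writes the variance as the average of
  two conditional variances plus \<open>\<pi> v * (1 - \<pi> v)\<close> times the squared difference
  of the conditional means. That difference is at most \<open>k\<close>, so each vertex contributes
  at most the square of \<open>k\<close>.\<close>

lemma subset_exp_variance:
  assumes "finite V" "prob_weights \<pi> V"
    and "\<And>v U. v \<in> V \<Longrightarrow> U \<subseteq> V \<Longrightarrow> \<bar>f (insert v U) - f U\<bar> \<le> k"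
  shows "subset_exp \<pi> V (\<lambda>U. (f U)\<^sup>2) - (subset_exp \<pi> V f)\<^sup>2 \<le> real (card V) * k\<^sup>2"
  using assms
proof (induction V arbitrary: f rule: finite_induct)
  case (insert v V)
  define a where "a = subset_exp \<pi> V (\<lambda>U. f (insert v U))"
  define b where "b = subset_exp \<pi> V f"
  have pw: "prob_weights \<pi> V" and pv: "0 \<le> \<pi> v" "\<pi> v \<le> 1"
    using insert.prems by (auto simp: prob_weights_def)
  have k0: "0 \<le> k" using insert.prems(2)[of v "{}"] by auto
  have 1: "subset_exp \<pi> V (\<lambda>U. (f (insert v U))\<^sup>2) \<le> a\<^sup>2 + real (card V) * k\<^sup>2"
  proof -
    have "\<bar>f (insert v (insert w U)) - f (insert v U)\<bar> \<le> k" if "w \<in> V" "U \<subseteq> V" for w U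
      using insert.prems(2)[of w "insert v U"] that by (auto simp: insert_commute)
    then show ?thesis using insert.IH[of "\<lambda>U. f (insert v U)", OF pw] unfolding a_def by force
  qed
  have 0: "subset_exp \<pi> V (\<lambda>U. (f U)\<^sup>2) \<le> b\<^sup>2 + real (card V) * k\<^sup>2"
  proof -
    have "\<bar>f (insert w U) - f U\<bar> \<le> k" if "w \<in> V" "U \<subseteq> V" for w U
      using insert.prems(2)[of w U] that by auto
    then show ?thesis using insert.IH[of f, OF pw] unfolding b_def by force
  qed
  have step: "f (insert v U) \<le> f U + k" "f U \<le> f (insert v U) + k" if "U \<subseteq> V" for U
    using insert.prems(2)[OF insertI1 subset_insertI2[OF that]] by auto
  have ab: "a \<le> b + k" "b \<le> a + k"
  proof -
    have "a \<le> subset_exp \<pi> V (\<lambda>U. f U + k)"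
      unfolding a_def by (rule subset_exp_mono[OF pw])
        (rule step)
    then show "a \<le> b + k" using insert.hyps by (simp add: subset_exp_add b_def)
    have "b \<le> subset_exp \<pi> V (\<lambda>U. f (insert v U) + k)"
      unfolding b_def by (rule subset_exp_mono[OF pw])
        (rule step)
    then show "b \<le> a + k" using insert.hyps by (simp add: subset_exp_add a_def)
  qed
  have "\<bar>a - b\<bar> \<le> \<bar>k\<bar>" using ab k0 by simp
  then have sq: "(a - b)\<^sup>2 \<le> k\<^sup>2" by (simp only: abs_le_square_iff)
  have pp: "\<pi> v * (1 - \<pi> v) * (a - b)\<^sup>2 \<le> 1 * k\<^sup>2"
  proof (rule mult_mono[OF _ sq])
    show "\<pi> v * (1 - \<pi> v) \<le> 1" using pv by (simp add: mult_le_one)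
  qed (use pv in auto)
  have "subset_exp \<pi> (insert v V) (\<lambda>U. (f U)\<^sup>2) - (subset_exp \<pi> (insert v V) f)\<^sup>2
      = \<pi> v * subset_exp \<pi> V (\<lambda>U. (f (insert v U))\<^sup>2) + (1 - \<pi> v) * subset_exp \<pi> V (\<lambda>U. (f U)\<^sup>2)
        - (\<pi> v * a + (1 - \<pi> v) * b)\<^sup>2"
    using insert.hyps by (simp add: subset_exp_insert a_def b_def)
  also have "\<dots> \<le> \<pi> v * (a\<^sup>2 + real (card V) * k\<^sup>2) + (1 - \<pi> v) * (b\<^sup>2 + real (card V) * k\<^sup>2)
        - (\<pi> v * a + (1 - \<pi> v) * b)\<^sup>2"
    using 0 1 pv by (intro diff_right_mono add_mono mult_left_mono) auto
  also have "\<dots> = real (card V) * k\<^sup>2 + \<pi> v * (1 - \<pi> v) * (a - b)\<^sup>2"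
    by (simp add: power2_eq_square algebra_simps)
  also have "\<dots> \<le> real (card (insert v V)) * k\<^sup>2"
    using pp insert.hyps by (simp add: algebra_simps)
  finally show ?case .
qed simp

text \<open>Chebyshev's inequality with the variance bound from bounded differences.\<close>

lemma subset_prob_deviation:
  assumes "finite V" "prob_weights \<pi> V" "0 < t"
    and "\<And>v U. v \<in> V \<Longrightarrow> U \<subseteq> V \<Longrightarrow> \<bar>f (insert v U) - f U\<bar> \<le> k"
  shows "subset_prob \<pi> V (\<lambda>U. t < \<bar>f U - subset_exp \<pi> V f\<bar>) \<le> real (card V) * k\<^sup>2 / t\<^sup>2"
proof -
  define m where "m = subset_exp \<pi> V f"
  have "subset_prob \<pi> V (\<lambda>U. t < \<bar>f U - m\<bar>) \<le> subset_exp \<pi> V (\<lambda>U. (1 / t\<^sup>2) * (f U - m)\<^sup>2)"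
    unfolding subset_prob_def
  proof (rule subset_exp_mono[OF assms(2)])
    fix U
    have "t\<^sup>2 \<le> (f U - m)\<^sup>2" if "t < \<bar>f U - m\<bar>"
      using that assms(3) by (simp add: abs_le_square_iff[symmetric])
    then show "of_bool (t < \<bar>f U - m\<bar>) \<le> 1 / t\<^sup>2 * (f U - m)\<^sup>2"
      using assms(3) by (auto simp: field_simps)
  qed
  also have "\<dots> = (1 / t\<^sup>2) * subset_exp \<pi> V (\<lambda>U. (f U)\<^sup>2 + ((- 2 * m) * f U + m\<^sup>2))"
    unfolding subset_exp_cmult by (simp add: power2_eq_square algebra_simps)
  also have "\<dots> = (1 / t\<^sup>2) * (subset_exp \<pi> V (\<lambda>U. (f U)\<^sup>2) - m\<^sup>2)"
    unfolding subset_exp_add subset_exp_cmult using assms(1)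
    by (simp add: m_def[symmetric] power2_eq_square)
  also have "\<dots> \<le> (1 / t\<^sup>2) * (real (card V) * k\<^sup>2)"
    unfolding m_def by (intro mult_left_mono subset_exp_variance assms) auto
  finally show ?thesis by (simp add: m_def)
qed

text \<open>Disjoint sets are contained in \<open>U\<close> independently, and a set of at most
  \<open>L\<close> vertices is contained with probability at least \<open>p ^ L\<close>.\<close>

lemma subset_prob_no_member:
  assumes "finite V" "0 \<le> p" "p \<le> 1" "finite \<Q>" "disjoint \<Q>"
    and "\<And>Q. Q \<in> \<Q> \<Longrightarrow> Q \<subseteq> V \<and> card Q \<le> L"
  shows "subset_prob (\<lambda>_. p) V (\<lambda>U. \<forall>Q\<in>\<Q>. \<not> Q \<subseteq> U) \<le> (1 - p ^ L) ^ card \<Q>"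
  using assms(4-6)
proof (induction \<Q> rule: finite_induct)
  case empty
  then show ?case using assms(1) by (simp add: subset_prob_def)
next
  case (insert Q \<Q>)
  have pw: "prob_weights (\<lambda>_. p) V" using assms by (simp add: prob_weights_def)
  have dis: "Q \<inter> Q' = {}" if "Q' \<in> \<Q>" for Q'
    using insert.prems(1) insert.hyps that by (auto simp: disjoint_def)
  have Q: "Q \<subseteq> V" "card Q \<le> L" using insert.prems by auto
  have "subset_prob (\<lambda>_. p) V (\<lambda>U. \<forall>Q\<in>insert Q \<Q>. \<not> Q \<subseteq> U) =
    subset_exp (\<lambda>_. p) V (\<lambda>U. of_bool (\<not> Q \<subseteq> U) * of_bool (\<forall>Q\<in>\<Q>. \<not> Q \<subseteq> U))"
    unfolding subset_prob_def by (rule subset_exp_cong) auto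
  also have "\<dots> = subset_prob (\<lambda>_. p) V (\<lambda>U. \<not> Q \<subseteq> U) * subset_prob (\<lambda>_. p) V (\<lambda>U. \<forall>Q\<in>\<Q>. \<not> Q \<subseteq> U)"
    unfolding subset_prob_def
  proof (rule subset_exp_indep[OF assms(1) Q(1)])
    fix U
    have "Q' \<subseteq> U \<longleftrightarrow> Q' \<subseteq> U - Q" if "Q' \<in> \<Q>" for Q' using dis[OF that] by auto
    then show "of_bool (\<forall>Q\<in>\<Q>. \<not> Q \<subseteq> U) = (of_bool (\<forall>Q'\<in>\<Q>. \<not> Q' \<subseteq> U - Q) :: real)" by simp
  qed auto
  also have "subset_prob (\<lambda>_. p) V (\<lambda>U. \<not> Q \<subseteq> U) = 1 - p ^ card Q"
    using subset_prob_cylinder[OF assms(1) Q(1), of "{}"] assms(1) by (simp add: subset_prob_not)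
  also have "(1 - p ^ card Q) * subset_prob (\<lambda>_. p) V (\<lambda>U. \<forall>Q\<in>\<Q>. \<not> Q \<subseteq> U)
      \<le> (1 - p ^ L) * (1 - p ^ L) ^ card \<Q>"
  proof (rule mult_mono)
    show "1 - p ^ card Q \<le> 1 - p ^ L" using power_decreasing[OF Q(2)] assms by simp
    show "subset_prob (\<lambda>_. p) V (\<lambda>U. \<forall>Q\<in>\<Q>. \<not> Q \<subseteq> U) \<le> (1 - p ^ L) ^ card \<Q>"
      using insert by (auto simp: disjoint_def)
    show "0 \<le> 1 - p ^ L" using assms by (simp add: power_le_one)
  qed (rule subset_prob_nonneg[OF pw])
  finally show ?case using insert.hyps by simp
qed

section \<open>From finite sums to the probability mass function
  \<open>random_subset\<close>\<close>

lemma prob_bind_bernoulli: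
  assumes "0 \<le> p" "p \<le> 1"
  shows "measure_pmf.prob (bind_pmf (bernoulli_pmf p) f) A =
    p * measure_pmf.prob (f True) A + (1 - p) * measure_pmf.prob (f False) A"
proof -
  have "ennreal (measure_pmf.prob (bind_pmf (bernoulli_pmf p) f) A) =
      ennreal (measure_pmf.prob (f True) A) * ennreal p
      + ennreal (measure_pmf.prob (f False) A) * ennreal (1 - p)"
    using assms by (simp add: measure_pmf.emeasure_eq_measure[symmetric])
  also have "\<dots> = ennreal (p * measure_pmf.prob (f True) A + (1 - p) * measure_pmf.prob (f False) A)"
    using assms by (simp add: ennreal_mult[symmetric] ennreal_plus[symmetric] mult.commute del: ennreal_plus)
  finally show ?thesis
    by (rule ennreal_inj[THEN iffD1, rotated 2]) (use assms in auto)
qed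

lemma prob_random_subset:
  assumes "finite V" "0 \<le> p" "p \<le> 1"
  shows "measure_pmf.prob (random_subset p V) {U. P U} = subset_prob (\<lambda>_. p) V P"
  using assms(1)
proof (induction V arbitrary: P rule: finite_induct)
  case empty
  then show ?case by (simp add: random_subset_def subset_prob_def indicator_def)
next
  case (insert v V)
  let ?M = "Pi_pmf V False (\<lambda>_. bernoulli_pmf p)"
  have 1: "random_subset p (insert v V) =
    bind_pmf (bernoulli_pmf p) (\<lambda>b. map_pmf (\<lambda>U. if b then insert v U else U) (random_subset p V))"
  proof -
    have *: "(\<lambda>(b, f). {w \<in> insert v V. (f(v := b)) w}) =
        (\<lambda>(b, f). (if b then insert v {w \<in> V. f w} else {w \<in> V. f w}))"
      using insert.hyps by (auto simp: fun_eq_iff)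
    have "random_subset p (insert v V) =
       map_pmf (\<lambda>(b, f). {w \<in> insert v V. (f(v := b)) w}) (pair_pmf (bernoulli_pmf p) ?M)"
      unfolding random_subset_def using insert.hyps
      by (simp add: Pi_pmf_insert pmf.map_comp o_def case_prod_unfold)
    also have "\<dots> = map_pmf (\<lambda>(b, f). (if b then insert v {w \<in> V. f w} else {w \<in> V. f w}))
        (pair_pmf (bernoulli_pmf p) ?M)"
      unfolding * ..
    finally show ?thesis
      by (simp add: pair_pmf_def map_bind_pmf random_subset_def pmf.map_comp o_def
          map_pmf_def[symmetric])
  qed
  have IH: "measure_pmf.prob (map_pmf (\<lambda>U. if b then insert v U else U) (random_subset p V)) {U. P U} =
      (if b then subset_prob (\<lambda>_. p) V (\<lambda>U. P (insert v U)) else subset_prob (\<lambda>_. p) V P)" for b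
    unfolding measure_map_pmf vimage_def
    by (cases b) (simp_all only: if_True if_False mem_Collect_eq insert.IH)
  have "measure_pmf.prob (random_subset p (insert v V)) {U. P U} =
      p * subset_prob (\<lambda>_. p) V (\<lambda>U. P (insert v U)) + (1 - p) * subset_prob (\<lambda>_. p) V P"
    unfolding 1 prob_bind_bernoulli[OF assms(2,3)] IH by simp
  then show ?case
    using insert.hyps by (simp add: subset_prob_def subset_exp_insert)
qed

subsection \<open>Clusters and boundaries\<close>

text \<open>Only the vertices entered must lie in \<open>U\<close>, not the sources. The cluster of
  \<open>v\<close> is therefore independent of the event that \<open>v\<close> itself is
  chosen.\<close>

definition cluster :: "'a set set \<Rightarrow> 'a set \<Rightarrow> 'a set \<Rightarrow> 'a set" where
  "cluster E S U = {w. \<exists>s\<in>S. (s, w) \<in> {(x, y). {x, y} \<in> E \<and> y \<in> U}\<^sup>*}"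

definition outer_boundary :: "'a set set \<Rightarrow> 'a set \<Rightarrow> 'a set" where
  "outer_boundary E T = {w. w \<notin> T \<and> (\<exists>t\<in>T. {t, w} \<in> E)}"

lemma cluster_source: "S \<subseteq> cluster E S U"
  by (auto simp: cluster_def)

lemma cluster_step: "w \<in> cluster E S U \<Longrightarrow> {w, z} \<in> E \<Longrightarrow> z \<in> U \<Longrightarrow> z \<in> cluster E S U"
  unfolding cluster_def by (blast intro: rtrancl_into_rtrancl)

text \<open>The induction principle for clusters; upper bounds on clusters are obtained by
  exhibiting a closed set.\<close>

lemma cluster_least:
  assumes "S \<subseteq> X" "\<And>w z. w \<in> X \<Longrightarrow> {w, z} \<in> E \<Longrightarrow> z \<in> U \<Longrightarrow> z \<in> X"
  shows "cluster E S U \<subseteq> X"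
proof
  fix w assume "w \<in> cluster E S U"
  then obtain s where s: "s \<in> S" "(s, w) \<in> {(x, y). {x, y} \<in> E \<and> y \<in> U}\<^sup>*"
    by (auto simp: cluster_def)
  from s(2) show "w \<in> X"
    by (induction rule: rtrancl_induct) (use s assms in auto)
qed

lemma cluster_subset: "cluster E S U \<subseteq> S \<union> U"
  by (rule cluster_least) auto

lemma cluster_mono: "S \<subseteq> S' \<Longrightarrow> U \<subseteq> U' \<Longrightarrow> cluster E S U \<subseteq> cluster E S' U'"
proof (rule cluster_least)
  assume "S \<subseteq> S'"
  then show "S \<subseteq> cluster E S' U'" using cluster_source by (rule subset_trans)
next
  fix w z assume "U \<subseteq> U'" "w \<in> cluster E S' U'" "{w, z} \<in> E" "z \<in> U"
  then show "z \<in> cluster E S' U'" using cluster_step[of w E S' U' z] by auto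
qed

lemma cluster_trans: "w \<in> cluster E S U \<Longrightarrow> cluster E {w} U \<subseteq> cluster E S U"
  by (rule cluster_least) (auto intro: cluster_step)

text \<open>Walks can be reversed, but the reversed walk ends by entering \<open>v\<close>, which is
  why \<open>v\<close> must lie in \<open>U\<close>.\<close>

lemma cluster_sym:
  assumes "v \<in> U" "w \<in> cluster E {v} U"
  shows "v \<in> cluster E {w} U"
proof -
  have "cluster E {v} U \<subseteq> {w \<in> U. v \<in> cluster E {w} U}"
  proof (rule cluster_least)
    show "{v} \<subseteq> {w \<in> U. v \<in> cluster E {w} U}"
      using assms cluster_source[of "{v}" E U] by auto
    fix w z assume w: "w \<in> {w \<in> U. v \<in> cluster E {w} U}" and z: "{w, z} \<in> E" "z \<in> U"
    have "w \<in> cluster E {z} U"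
      using cluster_step[of z E "{z}" U w] cluster_source[of "{z}" E U] w z
      by (auto simp: insert_commute)
    then show "z \<in> {w \<in> U. v \<in> cluster E {w} U}"
      using cluster_trans[of w E "{z}" U] w z by auto
  qed
  then show ?thesis using assms by auto
qed

lemma cluster_eq:
  assumes "v \<in> U" "w \<in> cluster E {v} U"
  shows "cluster E {w} U = cluster E {v} U"
  using cluster_trans[OF assms(2)] cluster_trans[OF cluster_sym[OF assms]] by auto

lemma cluster_diff_source: "cluster E S (U - S) = cluster E S U"
proof
  show "cluster E S U \<subseteq> cluster E S (U - S)"
  proof (rule cluster_least)
    fix w z assume "w \<in> cluster E S (U - S)" "{w, z} \<in> E" "z \<in> U"
    then show "z \<in> cluster E S (U - S)"
      using subsetD[OF cluster_source[of S E "U - S"], of z] cluster_step[of w E S "U - S" z]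
      by (cases "z \<in> S") auto
  qed (rule cluster_source)
qed (rule cluster_mono, auto)

text \<open>Exploration only uses vertices that end up in the cluster. Hence the possible values
  \<open>T\<close> of a cluster are exactly the solutions of \<open>cluster E S (T - S) = T\<close>,
  and this equation indexes the sums over clusters below.\<close>

lemma cluster_cluster: "cluster E S (cluster E S U - S) = cluster E S U"
proof
  have "cluster E S U - S \<subseteq> U" using cluster_subset[of E S U] by auto
  then show 1: "cluster E S (cluster E S U - S) \<subseteq> cluster E S U" by (intro cluster_mono) auto
  show "cluster E S U \<subseteq> cluster E S (cluster E S U - S)"
  proof (rule cluster_least)
    fix w z assume *: "w \<in> cluster E S (cluster E S U - S)" "{w, z} \<in> E" "z \<in> U"
    then have "z \<in> cluster E S U" using cluster_step[of w E S U z] 1 by auto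
    then show "z \<in> cluster E S (cluster E S U - S)"
      using subsetD[OF cluster_source[of S E "cluster E S U - S"], of z] cluster_step[OF *(1,2)]
      by (cases "z \<in> S") auto
  qed (rule cluster_source)
qed

text \<open>This turns the event that exploration stops at \<open>T\<close> into a cylinder event,
  whose probability is a product.\<close>

lemma cluster_eq_iff:
  assumes "cluster E S (T - S) = T"
  shows "cluster E S U = T \<longleftrightarrow> T - S \<subseteq> U \<and> outer_boundary E T \<inter> U = {}"
proof
  assume T: "cluster E S U = T"
  have "w \<in> T" if "w \<in> outer_boundary E T" "w \<in> U" for w
    using that cluster_step[of _ E S U w] unfolding T outer_boundary_def by blast
  then show "T - S \<subseteq> U \<and> outer_boundary E T \<inter> U = {}"
    using cluster_subset[of E S U] T by (auto simp: outer_boundary_def)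
next
  assume *: "T - S \<subseteq> U \<and> outer_boundary E T \<inter> U = {}"
  have "T \<subseteq> cluster E S U"
    using cluster_mono[of S S "T - S" U E] * assms by auto
  moreover have "cluster E S U \<subseteq> T"
  proof (rule cluster_least)
    show "S \<subseteq> T" using cluster_source[of S E "T - S"] assms by auto
  qed (use * in \<open>auto simp: outer_boundary_def\<close>)
  ultimately show "cluster E S U = T" by auto
qed

text \<open>After its last visit to \<open>S\<close> a walk enters a chosen boundary vertex and then
  stays in the cluster of that vertex.\<close>

lemma cluster_decomp:
  "cluster E S U = S \<union> (\<Union>w\<in>outer_boundary E S \<inter> U. cluster E {w} U)"
proof
  show "cluster E S U \<subseteq> S \<union> (\<Union>w\<in>outer_boundary E S \<inter> U. cluster E {w} U)"
  proof (rule cluster_least)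
    fix w z
    assume w: "w \<in> S \<union> (\<Union>w\<in>outer_boundary E S \<inter> U. cluster E {w} U)" and z: "{w, z} \<in> E" "z \<in> U"
    show "z \<in> S \<union> (\<Union>w\<in>outer_boundary E S \<inter> U. cluster E {w} U)"
    proof (cases "w \<in> S")
      case True
      then have "z \<in> S \<or> z \<in> outer_boundary E S \<inter> U"
        using z by (auto simp: outer_boundary_def)
      then show ?thesis using cluster_source[of "{z}" E U] by auto
    next
      case False
      then obtain u where u: "u \<in> outer_boundary E S \<inter> U" "w \<in> cluster E {u} U" using w by blast
      then have "z \<in> cluster E {u} U" using z by (auto intro: cluster_step[of w E "{u}" U z])
      then show ?thesis using u by blast
    qed
  qed auto
  show "S \<union> (\<Union>w\<in>outer_boundary E S \<inter> U. cluster E {w} U) \<subseteq> cluster E S U"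
  proof -
    have "cluster E {w} U \<subseteq> cluster E S U" if "w \<in> outer_boundary E S \<inter> U" for w
    proof (rule cluster_trans)
      show "w \<in> cluster E S U"
      proof -
        obtain t where "t \<in> S" "{t, w} \<in> E" "w \<in> U"
          using \<open>w \<in> outer_boundary E S \<inter> U\<close> by (auto simp: outer_boundary_def)
        then show ?thesis using cluster_source[of S E U] cluster_step[of t E S U w] by auto
      qed
    qed
    then show ?thesis using cluster_source[of S E U] by blast
  qed
qed

lemma component_eq_cluster:
  assumes "v \<in> U"
  shows "{(x, y) \<in> U \<times> U. (x, y) \<in> {(x, y). {x, y} \<in> induced_edges E U}\<^sup>*} `` {v} = cluster E {v} U"
    (is "?R `` {v} = _")
proof
  let ?S = "{(x, y). {x, y} \<in> induced_edges E U}"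
  show "?R `` {v} \<subseteq> cluster E {v} U"
  proof
    fix w assume "w \<in> ?R `` {v}"
    then have "(v, w) \<in> ?S\<^sup>*" by auto
    then show "w \<in> cluster E {v} U"
    proof (induction rule: rtrancl_induct)
      case base
      then show ?case using cluster_source[of "{v}" E U] by auto
    next
      case (step y z)
      then show ?case by (auto simp: induced_edges_def intro: cluster_step)
    qed
  qed
  have "cluster E {v} U \<subseteq> {w \<in> U. (v, w) \<in> ?S\<^sup>*}"
  proof (rule cluster_least)
    fix w z assume "w \<in> {w \<in> U. (v, w) \<in> ?S\<^sup>*}" "{w, z} \<in> E" "z \<in> U"
    moreover from this have "(w, z) \<in> ?S" by (auto simp: induced_edges_def)
    ultimately show "z \<in> {w \<in> U. (v, w) \<in> ?S\<^sup>*}" by (auto intro: rtrancl_into_rtrancl)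
  qed (use assms in auto)
  then show "cluster E {v} U \<subseteq> ?R `` {v}" using assms by auto
qed

lemma components_eq_clusters: "components U (induced_edges E U) = (\<lambda>v. cluster E {v} U) ` U"
  unfolding components_def quotient_def using component_eq_cluster[of _ U E] by auto

section \<open>Edge counting: degrees, cuts and vertex boundaries\<close>

definition cut_size :: "'a set set \<Rightarrow> 'a set \<Rightarrow> nat" where
  "cut_size E T = card {e \<in> E. card (e \<inter> T) = 1}"

lemma sum_of_bool_eq_card: "finite A \<Longrightarrow> (\<Sum>x\<in>A. of_bool (P x) :: nat) = card {x \<in> A. P x}"
proof -
  assume "finite A"
  then have "(\<Sum>x\<in>A. of_bool (P x) :: nat) = (\<Sum>x\<in>{x \<in> A. P x}. 1)"
    by (intro sum.mono_neutral_cong_right) auto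
  then show ?thesis by simp
qed

locale finite_regular_graph =
  fixes d :: nat and V :: "'a set" and E :: "'a set set"
  assumes regular: "regular_graph d V E"
begin

lemma finite_V: "finite V"
  using regular by (auto simp: regular_graph_def simple_graph_def)

lemma edgeD: "e \<in> E \<Longrightarrow> e \<subseteq> V \<and> card e = 2"
  using regular by (auto simp: regular_graph_def simple_graph_def)

lemma finite_E: "finite E"
proof (rule finite_subset)
  show "E \<subseteq> Pow V" using edgeD by blast
  show "finite (Pow V)" using finite_V by simp
qed

lemma edge_pairD: "{x, y} \<in> E \<Longrightarrow> x \<in> V \<and> y \<in> V \<and> x \<noteq> y"
  using edgeD[of "{x, y}"] by (metis card_2_iff doubleton_eq_iff insert_subset)

lemma outer_boundary_subset: "outer_boundary E T \<subseteq> V"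
  unfolding outer_boundary_def by (blast dest: edge_pairD)

lemma finite_outer_boundary: "finite (outer_boundary E T)"
  by (rule finite_subset[OF outer_boundary_subset finite_V])

lemma cluster_subset_V: "S \<subseteq> V \<Longrightarrow> cluster E S U \<subseteq> V"
  by (rule cluster_least) (auto dest: edge_pairD)

lemma finite_cluster: "S \<subseteq> V \<Longrightarrow> finite (cluster E S U)"
  by (rule finite_subset[OF cluster_subset_V finite_V])

lemma cluster_prob_eq_sum:
  assumes "S \<subseteq> V"
  shows "subset_prob \<pi> V (\<lambda>U. P (cluster E S U)) =
    (\<Sum>T\<in>{T \<in> Pow V. cluster E S (T - S) = T \<and> P T}.
       (\<Prod>v\<in>T - S. \<pi> v) * (\<Prod>v\<in>outer_boundary E T. 1 - \<pi> v))"
proof -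
  let ?J = "{T \<in> Pow V. cluster E S (T - S) = T \<and> P T}"
  have "subset_prob \<pi> V (\<lambda>U. P (cluster E S U)) =
      (\<Sum>T\<in>?J. subset_prob \<pi> V (\<lambda>U. cluster E S U = T \<and> P (cluster E S U)))"
    by (rule subset_prob_partition)
      (use finite_V cluster_subset_V[OF assms] cluster_cluster[of E S] in auto)
  also have "\<dots> = (\<Sum>T\<in>?J. (\<Prod>v\<in>T - S. \<pi> v) * (\<Prod>v\<in>outer_boundary E T. 1 - \<pi> v))"
  proof (rule sum.cong)
    fix T assume T: "T \<in> ?J"
    have "subset_prob \<pi> V (\<lambda>U. cluster E S U = T \<and> P (cluster E S U)) =
        subset_prob \<pi> V (\<lambda>U. T - S \<subseteq> U \<and> outer_boundary E T \<inter> U = {})"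
    proof (rule subset_prob_cong)
      fix U
      have "cluster E S U = T \<and> P (cluster E S U) \<longleftrightarrow> cluster E S U = T" using T by auto
      also have "\<dots> \<longleftrightarrow> T - S \<subseteq> U \<and> outer_boundary E T \<inter> U = {}"
        by (rule cluster_eq_iff) (use T in auto)
      finally show "(cluster E S U = T \<and> P (cluster E S U)) = (T - S \<subseteq> U \<and> outer_boundary E T \<inter> U = {})" .
    qed
    also have "\<dots> = (\<Prod>v\<in>T - S. \<pi> v) * (\<Prod>v\<in>outer_boundary E T. 1 - \<pi> v)"
      using T by (intro subset_prob_cylinder finite_V outer_boundary_subset)
        (auto simp: outer_boundary_def)
    finally show "subset_prob \<pi> V (\<lambda>U. cluster E S U = T \<and> P (cluster E S U)) =
        (\<Prod>v\<in>T - S. \<pi> v) * (\<Prod>v\<in>outer_boundary E T. 1 - \<pi> v)" .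
  qed simp
  finally show ?thesis .
qed

text \<open>Change of density: a bound on the ratio of weights for every single possible cluster
  carries over to the probabilities, term by term.\<close>

lemma cluster_prob_compare:
  assumes "S \<subseteq> V"
    and "\<And>T. S \<subseteq> T \<Longrightarrow> T \<subseteq> V \<Longrightarrow> cluster E S (T - S) = T \<Longrightarrow> P T \<Longrightarrow>
      (\<Prod>v\<in>T - S. \<pi> v) * (\<Prod>v\<in>outer_boundary E T. 1 - \<pi> v)
      \<le> B * ((\<Prod>v\<in>T - S. \<pi>' v) * (\<Prod>v\<in>outer_boundary E T. 1 - \<pi>' v))"
  shows "subset_prob \<pi> V (\<lambda>U. P (cluster E S U)) \<le> B * subset_prob \<pi>' V (\<lambda>U. P (cluster E S U))"
  unfolding cluster_prob_eq_sum[OF assms(1)] sum_distrib_left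
proof (rule sum_mono)
  fix T assume T: "T \<in> {T \<in> Pow V. cluster E S (T - S) = T \<and> P T}"
  then have "S \<subseteq> T" using cluster_source[of S E "T - S"] by auto
  then show "(\<Prod>v\<in>T - S. \<pi> v) * (\<Prod>v\<in>outer_boundary E T. 1 - \<pi> v)
      \<le> B * ((\<Prod>v\<in>T - S. \<pi>' v) * (\<Prod>v\<in>outer_boundary E T. 1 - \<pi>' v))"
    using assms(2) T by auto
qed

lemma edges_between_eq_cut:
  assumes "T \<subseteq> V"
  shows "edges_between E T (V - T) = cut_size E T"
proof -
  have "{e \<in> E. \<exists>u\<in>T. \<exists>w\<in>V - T. e = {u, w}} = {e \<in> E. card (e \<inter> T) = 1}"
  proof (intro Collect_cong conj_cong refl)
    fix e assume e: "e \<in> E"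
    show "(\<exists>u\<in>T. \<exists>w\<in>V - T. e = {u, w}) \<longleftrightarrow> card (e \<inter> T) = 1"
    proof
      assume "\<exists>u\<in>T. \<exists>w\<in>V - T. e = {u, w}"
      then obtain u w where "u \<in> T" "w \<in> V - T" "e = {u, w}" by blast
      then have "e \<inter> T = {u}" by auto
      then show "card (e \<inter> T) = 1" by simp
    next
      assume "card (e \<inter> T) = 1"
      then obtain u where u: "e \<inter> T = {u}" by (auto simp: card_1_singleton_iff)
      obtain x y where xy: "e = {x, y}" "x \<noteq> y"
        using edgeD[OF e] by (auto simp: card_2_iff)
      then show "\<exists>u\<in>T. \<exists>w\<in>V - T. e = {u, w}"
        using u edgeD[OF e] by (cases "x \<in> T") (auto simp: insert_commute)
    qed
  qed
  then show ?thesis by (simp add: edges_between_def cut_size_def)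
qed

text \<open>Double counting of incidences: an inner edge meets \<open>T\<close> twice, a cut edge
  once.\<close>

lemma degree_sum:
  assumes "T \<subseteq> V"
  shows "d * card T = 2 * edges_in E T + cut_size E T"
proof -
  have fT: "finite T" using assms finite_V finite_subset by blast
  have "d * card T = (\<Sum>v\<in>T. card {e \<in> E. v \<in> e})"
    using regular assms by (simp add: regular_graph_def subset_iff)
  also have "\<dots> = (\<Sum>v\<in>T. \<Sum>e\<in>E. of_bool (v \<in> e))"
    by (simp add: sum_of_bool_eq_card finite_E del: sum_of_bool_eq)
  also have "\<dots> = (\<Sum>e\<in>E. \<Sum>v\<in>T. of_bool (v \<in> e))"
    by (rule sum.swap)
  also have "\<dots> = (\<Sum>e\<in>E. card (e \<inter> T))"
    using fT by (intro sum.cong) (auto simp: sum_of_bool_eq_card Int_def conj_commute simp del: sum_of_bool_eq)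
  also have "\<dots> = (\<Sum>e\<in>E. 2 * of_bool (e \<subseteq> T) + of_bool (card (e \<inter> T) = 1))"
  proof (rule sum.cong)
    fix e assume e: "e \<in> E"
    obtain x y where xy: "e = {x, y}" "x \<noteq> y" using edgeD[OF e] by (auto simp: card_2_iff)
    show "card (e \<inter> T) = 2 * of_bool (e \<subseteq> T) + of_bool (card (e \<inter> T) = 1)"
      using xy by (cases "x \<in> T"; cases "y \<in> T") (auto simp: Int_insert_left)
  qed simp
  also have "\<dots> = 2 * edges_in E T + cut_size E T"
    by (simp add: sum.distrib sum_distrib_left[symmetric] sum_of_bool_eq_card finite_E
        edges_in_def induced_edges_def cut_size_def del: sum_of_bool_eq)
  finally show ?thesis .
qed

text \<open>Choosing for each boundary vertex an edge to \<open>T\<close> is injective, since the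
  end of that edge outside \<open>T\<close> is the boundary vertex itself.\<close>

lemma card_boundary_le_cut: "card (outer_boundary E T) \<le> cut_size E T"
proof -
  define f where "f w = (SOME e. e \<in> E \<and> w \<in> e \<and> e \<inter> T \<noteq> {})" for w
  have f: "f w \<in> E \<and> w \<in> f w \<and> f w \<inter> T \<noteq> {}" if "w \<in> outer_boundary E T" for w
    unfolding f_def
  proof (rule someI_ex)
    obtain t where "t \<in> T" "{t, w} \<in> E" using \<open>w \<in> outer_boundary E T\<close> by (auto simp: outer_boundary_def)
    then show "\<exists>e. e \<in> E \<and> w \<in> e \<and> e \<inter> T \<noteq> {}" by (intro exI[of _ "{t, w}"]) auto
  qed
  have f2: "\<exists>t\<in>T. f w = {t, w}" if "w \<in> outer_boundary E T" for w
  proof -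
    obtain x y where xy: "f w = {x, y}" "x \<noteq> y" using edgeD[of "f w"] f[OF \<open>w \<in> outer_boundary E T\<close>] by (auto simp: card_2_iff)
    then show ?thesis using f[OF that] that by (auto simp: outer_boundary_def insert_commute)
  qed
  show ?thesis
    unfolding cut_size_def
  proof (rule card_inj_on_le)
    show "inj_on f (outer_boundary E T)"
    proof (rule inj_onI)
      fix v w assume *: "v \<in> outer_boundary E T" "w \<in> outer_boundary E T" "f v = f w"
      then obtain t t' where "t \<in> T" "t' \<in> T" "{t, v} = {t', w}" using f2 by metis
      then show "v = w" using * by (auto simp: outer_boundary_def doubleton_eq_iff)
    qed
    show "f ` outer_boundary E T \<subseteq> {e \<in> E. card (e \<inter> T) = 1}"
    proof
      fix e assume "e \<in> f ` outer_boundary E T"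
      then obtain w where w: "w \<in> outer_boundary E T" "e = f w" by blast
      then obtain t where "t \<in> T" "e = {t, w}" using f2 by blast
      then have "e \<inter> T = {t}" using w by (auto simp: outer_boundary_def)
      then show "e \<in> {e \<in> E. card (e \<inter> T) = 1}" using w f by auto
    qed
    show "finite {e \<in> E. card (e \<inter> T) = 1}" using finite_E by simp
  qed
qed

lemma card_boundary_le: "T \<subseteq> V \<Longrightarrow> card (outer_boundary E T) \<le> d * card T"
  using card_boundary_le_cut[of T] degree_sum[of T] by linarith

lemma edges_in_insert:
  assumes "z \<notin> T"
  shows "edges_in E (insert z T) = edges_in E T + card {t \<in> T. {t, z} \<in> E}"
proof -
  have "induced_edges E (insert z T) = induced_edges E T \<union> (\<lambda>t. {t, z}) ` {t \<in> T. {t, z} \<in> E}"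
  proof
    show "induced_edges E (insert z T) \<subseteq> induced_edges E T \<union> (\<lambda>t. {t, z}) ` {t \<in> T. {t, z} \<in> E}"
    proof
      fix e assume e: "e \<in> induced_edges E (insert z T)"
      then have eE: "e \<in> E" "e \<subseteq> insert z T" by (auto simp: induced_edges_def)
      obtain x y where xy: "e = {x, y}" "x \<noteq> y" using edgeD[OF eE(1)] by (auto simp: card_2_iff)
      show "e \<in> induced_edges E T \<union> (\<lambda>t. {t, z}) ` {t \<in> T. {t, z} \<in> E}"
        using eE xy by (cases "x = z"; cases "y = z") (auto simp: induced_edges_def insert_commute)
    qed
  qed (auto simp: induced_edges_def)
  moreover have "induced_edges E T \<inter> (\<lambda>t. {t, z}) ` {t \<in> T. {t, z} \<in> E} = {}"
    using assms by (auto simp: induced_edges_def)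
  moreover have "card ((\<lambda>t. {t, z}) ` {t \<in> T. {t, z} \<in> E}) = card {t \<in> T. {t, z} \<in> E}"
    by (rule card_image) (auto simp: inj_on_def doubleton_eq_iff)
  moreover have "finite {t \<in> T. {t, z} \<in> E}"
    by (rule finite_subset[OF _ finite_V]) (auto dest: edge_pairD)
  ultimately show ?thesis
    unfolding edges_in_def using finite_E by (simp add: card_Un_disjoint induced_edges_def)
qed

lemma edges_in_boundary_ge:
  assumes "T \<subseteq> V"
  shows "edges_in E T + cut_size E T \<le> edges_in E (T \<union> outer_boundary E T)"
proof -
  have disj: "induced_edges E T \<inter> {e \<in> E. card (e \<inter> T) = 1} = {}"
  proof -
    have "card (e \<inter> T) = 2" if "e \<in> induced_edges E T" for e
      using that edgeD[of e] by (simp add: induced_edges_def Int_absorb2)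
    then show ?thesis by auto
  qed
  have "edges_in E T + cut_size E T = card (induced_edges E T \<union> {e \<in> E. card (e \<inter> T) = 1})"
    unfolding edges_in_def cut_size_def using finite_E disj
    by (intro card_Un_disjoint[symmetric]) (auto simp: induced_edges_def)
  also have "\<dots> \<le> edges_in E (T \<union> outer_boundary E T)"
    unfolding edges_in_def
  proof (rule card_mono)
    show "induced_edges E T \<union> {e \<in> E. card (e \<inter> T) = 1} \<subseteq> induced_edges E (T \<union> outer_boundary E T)"
    proof
      fix e assume e: "e \<in> induced_edges E T \<union> {e \<in> E. card (e \<inter> T) = 1}"
      then have eE: "e \<in> E" by (auto simp: induced_edges_def)
      obtain x y where xy: "e = {x, y}" "x \<noteq> y" using edgeD[OF eE] by (auto simp: card_2_iff)
      have "e \<inter> T \<noteq> {}"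
      proof
        assume 0: "e \<inter> T = {}"
        then have "card (e \<inter> T) \<noteq> 1" by simp
        then have "e \<subseteq> T" using e by (auto simp: induced_edges_def)
        then show False using 0 xy by auto
      qed
      then have "x \<in> T \<or> y \<in> T" using xy by auto
      then show "e \<in> induced_edges E (T \<union> outer_boundary E T)"
      proof -
        have yx: "{y, x} \<in> E" "{x, y} \<in> E" using eE xy by (auto simp: insert_commute)
        have "x \<in> T \<union> outer_boundary E T" "y \<in> T \<union> outer_boundary E T"
          using yx \<open>x \<in> T \<or> y \<in> T\<close> unfolding outer_boundary_def by blast+
        then show ?thesis using eE xy by (simp add: induced_edges_def)
      qed
    qed
    show "finite (induced_edges E (T \<union> outer_boundary E T))"
      using finite_E by (simp add: induced_edges_def)
  qed
  finally show ?thesis .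
qed

text \<open>Apply local sparsity both to \<open>T\<close> and to \<open>T\<close> together with its boundary, the latter set
  containing all the \<open>d |T| - e(T)\<close> edges that meet \<open>T\<close>.\<close>

lemma boundary_ge_of_sparse:
  assumes "T \<subseteq> V" "0 \<le> \<delta>"
    and sparse: "\<And>U. U \<subseteq> V \<Longrightarrow> card U \<le> (d + 1) * card T \<Longrightarrow> real (edges_in E U) \<le> (1 + \<delta>) * real (card U)"
  shows "((real d - 1 - \<delta>) / (1 + \<delta>) - 1) * real (card T) \<le> real (card (outer_boundary E T))"
proof -
  have fT: "finite T" using assms finite_V finite_subset by blast
  let ?N = "T \<union> outer_boundary E T"
  have N: "card ?N = card T + card (outer_boundary E T)"
    using fT finite_outer_boundary by (intro card_Un_disjoint) (auto simp: outer_boundary_def)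
  have eT: "real (edges_in E T) \<le> (1 + \<delta>) * real (card T)"
    using assms by (intro sparse) auto
  have "real (edges_in E ?N) \<le> (1 + \<delta>) * real (card ?N)"
    using assms N card_boundary_le[OF assms(1)] outer_boundary_subset by (intro sparse) auto
  moreover have "real (edges_in E T) + real (cut_size E T) \<le> real (edges_in E ?N)"
    using edges_in_boundary_ge[OF assms(1)] by linarith
  moreover have "real d * real (card T) = 2 * real (edges_in E T) + real (cut_size E T)"
    using arg_cong[OF degree_sum[OF assms(1)], of real] by simp
  ultimately have "(real d - 1 - \<delta>) * real (card T) \<le> (1 + \<delta>) * real (card ?N)"
    using eT by (simp add: algebra_simps)
  then have "(real d - 1 - \<delta>) / (1 + \<delta>) * real (card T) \<le> real (card ?N)"
    using assms(2) by (simp add: field_simps)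
  then show ?thesis using N by (simp add: algebra_simps)
qed

lemma connected_edge_leaving:
  assumes "v \<in> A" "A \<subseteq> T" "cluster E {v} (T - {v}) = T" "A \<noteq> T"
  shows "\<exists>a\<in>A. \<exists>z\<in>T - A. {a, z} \<in> E"
proof (rule ccontr)
  assume "\<not> ?thesis"
  then have "cluster E {v} (T - {v}) \<subseteq> A"
    using assms(1) by (intro cluster_least) auto
  then show False using assms by auto
qed

text \<open>The edge count of a spanning tree, obtained without building one: a maximal set around
  \<open>v\<close> that satisfies the bound must be \<open>T\<close>, because an edge leaving it
  would allow one more vertex.\<close>

lemma edges_in_connected_ge:
  assumes "T \<subseteq> V" "cluster E {v} (T - {v}) = T"
  shows "card T \<le> edges_in E T + 1"
proof -
  have fT: "finite T" using assms finite_V finite_subset by blast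
  have vT: "v \<in> T" using cluster_source[of "{v}" E "T - {v}"] assms by auto
  define \<A> where "\<A> = {A. v \<in> A \<and> A \<subseteq> T \<and> card A \<le> edges_in E A + 1}"
  have "finite \<A>" by (rule finite_subset[of _ "Pow T"]) (use fT in \<open>auto simp: \<A>_def\<close>)
  moreover have "{v} \<in> \<A>" using vT by (simp add: \<A>_def)
  ultimately have "\<exists>A\<in>\<A>. \<forall>B\<in>\<A>. A \<subseteq> B \<longrightarrow> A = B" by (intro finite_has_maximal) auto
  then obtain A where A: "A \<in> \<A>" and max: "\<And>B. B \<in> \<A> \<Longrightarrow> A \<subseteq> B \<Longrightarrow> A = B" by blast
  have "A = T"
  proof (rule ccontr)
    assume "A \<noteq> T"
    then obtain a z where az: "a \<in> A" "z \<in> T - A" "{a, z} \<in> E"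
      using connected_edge_leaving[of v A T] A assms by (auto simp: \<A>_def)
    have fA: "finite A" using A fT finite_subset by (auto simp: \<A>_def)
    have "{t \<in> A. {t, z} \<in> E} \<noteq> {}" using az by auto
    then have "1 \<le> card {t \<in> A. {t, z} \<in> E}"
      using fA by (simp add: Suc_le_eq card_gt_0_iff)
    then have "insert z A \<in> \<A>"
      using A az fA edges_in_insert[of z A] by (auto simp: \<A>_def)
    then show False using max[of "insert z A"] az by auto
  qed
  then show ?thesis using A by (simp add: \<A>_def)
qed

text \<open>A connected set has at least \<open>card T - 1\<close> inner edges, each of which uses
  up two of the \<open>d * card T\<close> incidences. Tree-like neighbourhoods give
  equality.\<close>

lemma card_boundary_connected_le:
  assumes "T \<subseteq> V" "cluster E {v} (T - {v}) = T"
  shows "card (outer_boundary E T) + 2 * card T \<le> d * card T + 2"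
  using card_boundary_le_cut[of T] degree_sum[OF assms(1)] edges_in_connected_ge[OF assms] by linarith

end

subsection \<open>Balls and the probability of small clusters\<close>

definition graph_ball :: "'a set set \<Rightarrow> nat \<Rightarrow> 'a \<Rightarrow> 'a set" where
  "graph_ball E j v = {w. \<exists>i\<le>j. (v, w) \<in> {(x, y). {x, y} \<in> E} ^^ i}"

lemma graph_ball_0: "graph_ball E 0 v = {v}"
  by (auto simp: graph_ball_def)

lemma graph_ball_self: "v \<in> graph_ball E j v"
  by (auto simp: graph_ball_def intro!: exI[of _ 0])

lemma graph_ball_mono: "i \<le> j \<Longrightarrow> graph_ball E i v \<subseteq> graph_ball E j v"
  unfolding graph_ball_def using le_trans by blast

lemma graph_ball_trans:
  assumes "w \<in> graph_ball E i v" "z \<in> graph_ball E j w"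
  shows "z \<in> graph_ball E (i + j) v"
proof -
  obtain a b where "a \<le> i" "(v, w) \<in> {(x, y). {x, y} \<in> E} ^^ a"
      "b \<le> j" "(w, z) \<in> {(x, y). {x, y} \<in> E} ^^ b"
    using assms by (auto simp: graph_ball_def)
  then have "a + b \<le> i + j" "(v, z) \<in> {(x, y). {x, y} \<in> E} ^^ (a + b)"
    by (auto simp: relpow_add)
  then show ?thesis unfolding graph_ball_def by blast
qed

lemma relpow_edges_sym:
  "(v, w) \<in> {(x, y). {x, y} \<in> E} ^^ i \<Longrightarrow> (w, v) \<in> {(x, y). {x, y} \<in> E} ^^ i"
proof (induction i arbitrary: w)
  case (Suc i)
  then obtain u where u: "(v, u) \<in> {(x, y). {x, y} \<in> E} ^^ i" "{u, w} \<in> E" by auto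
  then have "(w, u) \<in> {(x, y). {x, y} \<in> E}" by (simp add: insert_commute)
  then show ?case using Suc.IH[OF u(1)] by (rule relpow_Suc_I2)
qed simp

lemma graph_ball_sym: "w \<in> graph_ball E j v \<Longrightarrow> v \<in> graph_ball E j w"
  unfolding graph_ball_def using relpow_edges_sym by fast

lemma graph_ball_Suc: "graph_ball E (Suc j) v = graph_ball E j v \<union> outer_boundary E (graph_ball E j v)"
proof
  show "graph_ball E (Suc j) v \<subseteq> graph_ball E j v \<union> outer_boundary E (graph_ball E j v)"
  proof
    fix w assume "w \<in> graph_ball E (Suc j) v"
    then obtain i where i: "i \<le> Suc j" "(v, w) \<in> {(x, y). {x, y} \<in> E} ^^ i"
      by (auto simp: graph_ball_def)
    show "w \<in> graph_ball E j v \<union> outer_boundary E (graph_ball E j v)"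
    proof (cases "i \<le> j")
      case True
      then show ?thesis using i by (auto simp: graph_ball_def)
    next
      case False
      then have "i = Suc j" using i by simp
      then obtain u where "(v, u) \<in> {(x, y). {x, y} \<in> E} ^^ j" "{u, w} \<in> E" using i by auto
      then have "u \<in> graph_ball E j v" "{u, w} \<in> E" by (auto simp: graph_ball_def)
      then show ?thesis by (auto simp: outer_boundary_def)
    qed
  qed
  show "graph_ball E j v \<union> outer_boundary E (graph_ball E j v) \<subseteq> graph_ball E (Suc j) v"
  proof
    fix w assume w: "w \<in> graph_ball E j v \<union> outer_boundary E (graph_ball E j v)"
    show "w \<in> graph_ball E (Suc j) v"
    proof (cases "w \<in> graph_ball E j v")
      case True
      then show ?thesis using graph_ball_mono[of j "Suc j" E v] by auto
    next
      case False
      then obtain u where u: "u \<in> graph_ball E j v" "{u, w} \<in> E"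
        using w by (auto simp: outer_boundary_def)
      have "(u, w) \<in> {(x, y). {x, y} \<in> E} ^^ 1" using u by simp
      then have "w \<in> graph_ball E 1 u" unfolding graph_ball_def by blast
      then show ?thesis using graph_ball_trans[OF u(1), of w 1] by simp
    qed
  qed
qed

text \<open>The set \<open>Q\<close> carries a walk of at most \<open>j\<close> steps. Its size
  matters because the second random set has to contain all of it.\<close>

lemma graph_ball_path:
  assumes "w \<in> graph_ball E j v"
  shows "\<exists>Q. v \<in> Q \<and> w \<in> Q \<and> Q \<subseteq> graph_ball E j v \<and> finite Q \<and> card Q \<le> j + 1 \<and> w \<in> cluster E {v} Q"
  using assms
proof (induction j arbitrary: w)
  case 0
  then show ?case
    by (intro exI[of _ "{v}"]) (use cluster_source[of "{v}" E "{v}"] in \<open>auto simp: graph_ball_0\<close>)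
next
  case (Suc j)
  show ?case
  proof (cases "w \<in> graph_ball E j v")
    case True
    then obtain Q where "v \<in> Q \<and> w \<in> Q \<and> Q \<subseteq> graph_ball E j v \<and> finite Q \<and> card Q \<le> j + 1 \<and> w \<in> cluster E {v} Q"
      using Suc.IH by blast
    then show ?thesis using graph_ball_mono[of j "Suc j" E v] by (intro exI[of _ Q]) auto
  next
    case False
    then obtain u where u: "u \<in> graph_ball E j v" "{u, w} \<in> E"
      using Suc.prems by (auto simp: graph_ball_Suc outer_boundary_def)
    obtain Q where Q: "v \<in> Q" "u \<in> Q" "Q \<subseteq> graph_ball E j v" "finite Q" "card Q \<le> j + 1" "u \<in> cluster E {v} Q"
      using Suc.IH[OF u(1)] by blast
    have "u \<in> cluster E {v} (insert w Q)" using Q(6) cluster_mono[of "{v}" "{v}" Q "insert w Q" E] by auto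
    then have "w \<in> cluster E {v} (insert w Q)" using cluster_step[of u E "{v}" "insert w Q" w] u by simp
    moreover have "card (insert w Q) \<le> Suc j + 1" using Q by (auto simp: card_insert_if)
    ultimately show ?thesis
      using Q Suc.prems graph_ball_mono[of j "Suc j" E v] by (intro exI[of _ "insert w Q"]) auto
  qed
qed

context finite_regular_graph
begin

lemma graph_ball_subset: "v \<in> V \<Longrightarrow> graph_ball E j v \<subseteq> V"
  by (induction j) (auto simp: graph_ball_0 graph_ball_Suc dest: subsetD[OF outer_boundary_subset])

lemma finite_graph_ball: "v \<in> V \<Longrightarrow> finite (graph_ball E j v)"
  by (rule finite_subset[OF graph_ball_subset finite_V])

lemma card_graph_ball_le:
  assumes "v \<in> V"
  shows "card (graph_ball E j v) \<le> (d + 1) ^ j"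
proof (induction j)
  case (Suc j)
  have "card (graph_ball E (Suc j) v) \<le> card (graph_ball E j v) + card (outer_boundary E (graph_ball E j v))"
    unfolding graph_ball_Suc by (rule card_Un_le)
  also have "\<dots> \<le> (d + 1) * card (graph_ball E j v)"
    using card_boundary_le[OF graph_ball_subset[OF assms]] by simp
  also have "\<dots> \<le> (d + 1) * (d + 1) ^ j"
    by (rule mult_left_mono[OF Suc]) simp
  finally show ?case by simp
qed (simp add: graph_ball_0)

lemma card_graph_ball_Suc:
  assumes "v \<in> V"
  shows "card (graph_ball E (Suc j) v) = card (graph_ball E j v) + card (outer_boundary E (graph_ball E j v))"
  unfolding graph_ball_Suc using finite_graph_ball[OF assms] finite_outer_boundary
  by (intro card_Un_disjoint) (auto simp: outer_boundary_def)

text \<open>Each step multiplies the ball by at least \<beta> as long as its size stays below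
  \<open>s\<close>.\<close>

lemma graph_ball_growth:
  assumes "v \<in> V" "1 \<le> \<beta>"
    and growth: "\<And>T. T \<subseteq> V \<Longrightarrow> real (card T) < s \<Longrightarrow> (\<beta> - 1) * real (card T) \<le> real (card (outer_boundary E T))"
  shows "s \<le> real (card (graph_ball E j v)) \<or> \<beta> ^ j \<le> real (card (graph_ball E j v))"
proof (induction j)
  case (Suc j)
  show ?case
  proof (cases "s \<le> real (card (graph_ball E j v))")
    case True
    then show ?thesis using card_graph_ball_Suc[OF assms(1), of j] by simp
  next
    case False
    then have 1: "\<beta> ^ j \<le> real (card (graph_ball E j v))" using Suc by simp
    have "(\<beta> - 1) * real (card (graph_ball E j v)) \<le> real (card (outer_boundary E (graph_ball E j v)))"
      using False by (intro growth graph_ball_subset[OF assms(1)]) auto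
    then have "\<beta> * real (card (graph_ball E j v)) \<le> real (card (graph_ball E (Suc j) v))"
      using card_graph_ball_Suc[OF assms(1), of j] by (simp add: algebra_simps)
    moreover have "\<beta> * \<beta> ^ j \<le> \<beta> * real (card (graph_ball E j v))"
      using 1 assms(2) by (intro mult_left_mono) auto
    ultimately show ?thesis by simp
  qed
qed (simp add: graph_ball_0)

text \<open>Comparison with the critical density \<open>1 / \<beta>\<close>: a set \<open>T\<close> that can be the cluster of \<open>S\<close> has
  boundary at least \<open>(\<beta> - 1) |T|\<close>, which bounds the ratio of its weights at the two densities. This
  replaces the exploration process and the Chernoff bound.\<close>

lemma small_cluster_prob:
  assumes "S \<subseteq> V" "1 < \<beta>" "1 / \<beta> \<le> p1" "p1 \<le> p2" "p2 \<le> 1" "0 \<le> B"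
    and \<pi>: "\<And>v. v \<in> V \<Longrightarrow> p1 \<le> \<pi> v \<and> \<pi> v \<le> p2"
    and growth: "\<And>T. T \<subseteq> V \<Longrightarrow> real (card T) < M \<Longrightarrow> (\<beta> - 1) * real (card T) \<le> real (card (outer_boundary E T))"
    and B: "\<And>T. S \<subseteq> T \<Longrightarrow> T \<subseteq> V \<Longrightarrow> real (card T) < M \<Longrightarrow> P T \<Longrightarrow>
      (\<beta> * p2) ^ card (T - S) * exp (- ((\<beta> * p1 - 1) * real (card T))) \<le> B"
  shows "subset_prob \<pi> V (\<lambda>U. real (card (cluster E S U)) < M \<and> P (cluster E S U)) \<le> B"
proof -
  let ?Q = "\<lambda>T. real (card T) < M \<and> P T"
  have p1: "0 \<le> p1" using assms(2,3) by (smt (verit) divide_nonneg_nonneg)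
  have "subset_prob \<pi> V (\<lambda>U. ?Q (cluster E S U)) \<le> B * subset_prob (\<lambda>_. 1 / \<beta>) V (\<lambda>U. ?Q (cluster E S U))"
  proof (rule cluster_prob_compare[OF assms(1)])
    fix T assume T: "S \<subseteq> T" "T \<subseteq> V" "cluster E S (T - S) = T" "real (card T) < M \<and> P T"
    define k where "k = card (T - S)"
    define m where "m = card (outer_boundary E T)"
    have m: "(\<beta> - 1) * real (card T) \<le> real m" using growth T by (auto simp: m_def)
    have "(\<Prod>v\<in>T - S. \<pi> v) \<le> (\<Prod>v\<in>T - S. p2)"
      using T \<pi> p1 by (intro prod_mono) force
    also have "\<dots> = (\<beta> * p2) ^ k * (1 / \<beta>) ^ k"
      using assms(2) by (simp add: k_def power_mult_distrib power_one_over)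
    finally have A: "(\<Prod>v\<in>T - S. \<pi> v) \<le> (\<beta> * p2) ^ k * (1 / \<beta>) ^ k" .
    have "(\<Prod>v\<in>outer_boundary E T. 1 - \<pi> v) \<le> (\<Prod>v\<in>outer_boundary E T. 1 - p1)"
      using \<pi> outer_boundary_subset assms(5) by (intro prod_mono) force
    also have "\<dots> = (1 - p1) ^ m" by (simp add: m_def)
    \<comment> \<open>Relative to the critical factor \<open>1 - 1 / \<beta>\<close>, a boundary
      vertex contributes at most \<open>1 - (\<beta> * p1 - 1) / (\<beta> - 1)\<close>; the
      denominator will cancel against the boundary bound
      \<open>(\<beta> - 1) * card T\<close>.\<close>
    also have "\<dots> \<le> (exp (- ((\<beta> * p1 - 1) / (\<beta> - 1))) * (1 - 1 / \<beta>)) ^ m"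
    proof (rule power_mono)
      have "1 - p1 = (1 + (- ((\<beta> * p1 - 1) / (\<beta> - 1)))) * (1 - 1 / \<beta>)"
        using assms(2) by (simp add: field_simps)
      also have "\<dots> \<le> exp (- ((\<beta> * p1 - 1) / (\<beta> - 1))) * (1 - 1 / \<beta>)"
        using assms(2) by (intro mult_right_mono exp_ge_add_one_self) auto
      finally show "1 - p1 \<le> exp (- ((\<beta> * p1 - 1) / (\<beta> - 1))) * (1 - 1 / \<beta>)" .
    qed (use assms in auto)
    also have "\<dots> = exp (- ((\<beta> * p1 - 1) / (\<beta> - 1) * real m)) * (1 - 1 / \<beta>) ^ m"
      by (simp add: power_mult_distrib exp_of_nat_mult[symmetric] mult.commute)
    also have "\<dots> \<le> exp (- ((\<beta> * p1 - 1) * real (card T))) * (1 - 1 / \<beta>) ^ m"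
    proof (rule mult_right_mono)
      have "0 \<le> (\<beta> * p1 - 1) / (\<beta> - 1)"
        using assms(2,3) by (intro divide_nonneg_nonneg) (auto simp: field_simps)
      then have "(\<beta> * p1 - 1) / (\<beta> - 1) * ((\<beta> - 1) * real (card T)) \<le> (\<beta> * p1 - 1) / (\<beta> - 1) * real m"
        using m by (intro mult_left_mono)
      then show "exp (- ((\<beta> * p1 - 1) / (\<beta> - 1) * real m)) \<le> exp (- ((\<beta> * p1 - 1) * real (card T)))"
        using assms(2) by simp
    qed (use assms(2) in auto)
    finally have C: "(\<Prod>v\<in>outer_boundary E T. 1 - \<pi> v) \<le>
        exp (- ((\<beta> * p1 - 1) * real (card T))) * (1 - 1 / \<beta>) ^ m" .
    have "(\<Prod>v\<in>T - S. \<pi> v) * (\<Prod>v\<in>outer_boundary E T. 1 - \<pi> v) \<le>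
        ((\<beta> * p2) ^ k * (1 / \<beta>) ^ k) * (exp (- ((\<beta> * p1 - 1) * real (card T))) * (1 - 1 / \<beta>) ^ m)"
    proof (rule mult_mono[OF A C])
      show "0 \<le> (\<Prod>v\<in>outer_boundary E T. 1 - \<pi> v)"
        using \<pi> outer_boundary_subset assms(5) by (intro prod_nonneg) force
    qed (use assms(2,4) p1 in auto)
    also have "\<dots> = ((\<beta> * p2) ^ k * exp (- ((\<beta> * p1 - 1) * real (card T)))) * ((1 / \<beta>) ^ k * (1 - 1 / \<beta>) ^ m)"
      by simp
    also have "\<dots> \<le> B * ((1 / \<beta>) ^ k * (1 - 1 / \<beta>) ^ m)"
      using B[of T] T assms(2) by (intro mult_right_mono) (auto simp: k_def)
    finally show "(\<Prod>v\<in>T - S. \<pi> v) * (\<Prod>v\<in>outer_boundary E T. 1 - \<pi> v)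
      \<le> B * ((\<Prod>v\<in>T - S. 1 / \<beta>) * (\<Prod>v\<in>outer_boundary E T. 1 - 1 / \<beta>))"
      by (simp add: k_def m_def)
  qed
  also have "\<dots> \<le> B * 1"
    using assms(2,6) finite_V by (intro mult_left_mono subset_prob_le_1) (auto simp: prob_weights_def)
  finally show ?thesis by simp
qed

text \<open>Bounding \<open>\<beta> * p\<close> by \<open>exp (\<beta> * p - 1)\<close> for each
  vertex outside the source cancels the decay coming from those vertices. What remains is the decay
  from \<open>S\<close>, so a large source rarely stops before size \<open>M\<close>.\<close>

lemma blocked_source_prob:
  assumes "S \<subseteq> V" "1 < \<beta>" "1 / \<beta> \<le> p" "p \<le> 1"
    and growth: "\<And>T. T \<subseteq> V \<Longrightarrow> real (card T) < M \<Longrightarrow> (\<beta> - 1) * real (card T) \<le> real (card (outer_boundary E T))"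
  shows "subset_prob (\<lambda>_. p) V (\<lambda>U. real (card (cluster E S U)) < M) \<le> exp (- ((\<beta> * p - 1) * real (card S)))"
proof -
  have "subset_prob (\<lambda>_. p) V (\<lambda>U. real (card (cluster E S U)) < M \<and> True) \<le> exp (- ((\<beta> * p - 1) * real (card S)))"
  proof (rule small_cluster_prob[OF assms(1-3) order_refl assms(4)])
    fix T assume T: "S \<subseteq> T" "T \<subseteq> V"
    have "finite T" using T finite_V finite_subset by blast
    then have cT: "card T = card (T - S) + card S"
      using T by (metis card_Diff_subset card_mono finite_subset le_add_diff_inverse2)
    have "0 \<le> \<beta> * p" using assms(2,3) by (simp add: field_simps)
    then have "(\<beta> * p) ^ card (T - S) \<le> exp (\<beta> * p - 1) ^ card (T - S)"
      using exp_ge_add_one_self[of "\<beta> * p - 1"] by (intro power_mono) auto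
    also have "\<dots> = exp ((\<beta> * p - 1) * real (card (T - S)))"
      by (simp add: exp_of_nat_mult[symmetric] mult.commute)
    finally have "(\<beta> * p) ^ card (T - S) * exp (- ((\<beta> * p - 1) * real (card T))) \<le>
      exp ((\<beta> * p - 1) * real (card (T - S))) * exp (- ((\<beta> * p - 1) * real (card T)))"
      by (intro mult_right_mono) auto
    also have "\<dots> = exp (- ((\<beta> * p - 1) * real (card S)))"
      unfolding exp_add[symmetric] cT by (simp add: algebra_simps)
    finally show "(\<beta> * p) ^ card (T - S) * exp (- ((\<beta> * p - 1) * real (card T))) \<le> exp (- ((\<beta> * p - 1) * real (card S)))" .
  qed (use growth in auto)
  then show ?thesis by simp
qed

text \<open>The rate \<open>\<beta> * p1 - 1 - ln (\<beta> * p2)\<close> is the net decay per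
  vertex; a range of densities is allowed for the sake of partially sprinkled sets. The source pays
  no density factor, whence the division by \<open>\<beta> * p2\<close>, and for
  \<open>k = 0\<close> this division alone bounds the probability of a cluster below
  \<open>M\<close>.\<close>

lemma midsize_cluster_prob:
  assumes "v \<in> V" "1 < \<beta>" "1 / \<beta> \<le> p1" "p1 \<le> p2" "p2 \<le> 1"
    and \<pi>: "\<And>v. v \<in> V \<Longrightarrow> p1 \<le> \<pi> v \<and> \<pi> v \<le> p2"
    and \<mu>: "0 \<le> \<beta> * p1 - 1 - ln (\<beta> * p2)"
    and growth: "\<And>T. T \<subseteq> V \<Longrightarrow> real (card T) < M \<Longrightarrow> (\<beta> - 1) * real (card T) \<le> real (card (outer_boundary E T))"
  shows "subset_prob \<pi> V (\<lambda>U. k \<le> real (card (cluster E {v} U)) \<and> real (card (cluster E {v} U)) < M)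
    \<le> exp (- ((\<beta> * p1 - 1 - ln (\<beta> * p2)) * k)) / (\<beta> * p2)"
proof -
  have a1: "1 \<le> \<beta> * p1" using assms(2,3) by (simp add: field_simps)
  also have "\<beta> * p1 \<le> \<beta> * p2" using assms(2,4) by simp
  finally have a: "1 \<le> \<beta> * p2" .
  have ne: "\<beta> \<noteq> 0" "p2 \<noteq> 0" using a by (auto intro!: notI)
  let ?\<mu> = "\<beta> * p1 - 1 - ln (\<beta> * p2)"
  have "subset_prob \<pi> V (\<lambda>U. real (card (cluster E {v} U)) < M \<and> k \<le> real (card (cluster E {v} U)))
    \<le> exp (- (?\<mu> * k)) / (\<beta> * p2)"
  proof (rule small_cluster_prob[OF _ assms(2-5)])
    fix T assume T: "{v} \<subseteq> T" "T \<subseteq> V" "real (card T) < M" "k \<le> real (card T)"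
    have fT: "finite T" using T finite_V finite_subset by blast
    then have "card T = Suc (card (T - {v}))" using T by (metis card_Suc_Diff1 insert_subset)
    then have "(\<beta> * p2) ^ card (T - {v}) = (\<beta> * p2) ^ card T / (\<beta> * p2)" using ne by simp
    also have "(\<beta> * p2) ^ card T = exp (ln (\<beta> * p2) * real (card T))"
    proof -
      have "0 < \<beta> * p2" using a by linarith
      then have "exp (real (card T) * ln (\<beta> * p2)) = (\<beta> * p2) ^ card T"
        by (simp only: exp_of_nat_mult exp_ln)
      then show ?thesis by (simp add: mult.commute)
    qed
    finally have "(\<beta> * p2) ^ card (T - {v}) * exp (- ((\<beta> * p1 - 1) * real (card T))) =
        exp (- (?\<mu> * real (card T))) / (\<beta> * p2)"
      by (simp add: exp_add[symmetric] algebra_simps)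
    also have "\<dots> \<le> exp (- (?\<mu> * k)) / (\<beta> * p2)"
      using T(4) \<mu> a by (intro divide_right_mono) (auto intro: mult_left_mono)
    finally show "(\<beta> * p2) ^ card (T - {v}) * exp (- ((\<beta> * p1 - 1) * real (card T))) \<le>
        exp (- (?\<mu> * k)) / (\<beta> * p2)" .
  qed (use assms a in auto)
  then show ?thesis by (simp add: conj_commute)
qed

lemma card_cluster_le_sum:
  assumes "S \<subseteq> V" "0 \<le> M" "\<And>w. w \<in> outer_boundary E S \<inter> U \<Longrightarrow> real (card (cluster E {w} U)) \<le> M"
  shows "real (card (cluster E S U)) \<le> real (card S) + real (d * card S) * M"
proof -
  let ?B = "outer_boundary E S \<inter> U"
  have fB: "finite ?B" using finite_outer_boundary by simp
  have "card (cluster E S U) \<le> card S + card (\<Union>w\<in>?B. cluster E {w} U)"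
    unfolding cluster_decomp[of E S U] by (rule card_Un_le)
  also have "\<dots> \<le> card S + (\<Sum>w\<in>?B. card (cluster E {w} U))"
    using card_UN_le[OF fB] by simp
  finally have "real (card (cluster E S U)) \<le> real (card S) + (\<Sum>w\<in>?B. real (card (cluster E {w} U)))"
    by (simp flip: of_nat_sum of_nat_add)
  also have "(\<Sum>w\<in>?B. real (card (cluster E {w} U))) \<le> real (card ?B) * M"
    using assms(3) by (rule sum_bounded_above)
  also have "\<dots> \<le> real (d * card S) * M"
  proof (rule mult_right_mono[OF _ assms(2)])
    have "card ?B \<le> card (outer_boundary E S)" by (rule card_mono) (use finite_outer_boundary in auto)
    also have "\<dots> \<le> d * card S" by (rule card_boundary_le[OF assms(1)])
    finally show "real (card ?B) \<le> real (d * card S)" by (rule of_nat_mono)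
  qed
  finally show ?thesis by simp
qed

text \<open>If no chosen vertex near \<open>v\<close> had a large cluster, the first-step
  decomposition would keep the cluster of a ball around \<open>v\<close> below \<open>M2\<close>.
  This is unlikely because the ball has at least \<open>s\<close> vertices.\<close>

lemma near_large_cluster_prob:
  assumes "v \<in> V" "1 < \<beta>" "1 / \<beta> \<le> p" "p \<le> 1" "0 \<le> M" "0 \<le> s" "s \<le> \<beta> ^ R"
    and M2: "(real d + 1) * (s + 1) * (1 + real d * M) + 1 \<le> M2"
    and growth: "\<And>T. T \<subseteq> V \<Longrightarrow> real (card T) < M2 \<Longrightarrow> (\<beta> - 1) * real (card T) \<le> real (card (outer_boundary E T))"
  shows "subset_prob (\<lambda>_. p) V (\<lambda>U. \<forall>w\<in>graph_ball E (R + 1) v \<inter> U. real (card (cluster E {w} U)) < M)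
    \<le> exp (- ((\<beta> * p - 1) * s))"
proof -
  have sM2: "s \<le> M2"
  proof -
    have "1 * (s + 1) * 1 \<le> (real d + 1) * (s + 1) * (1 + real d * M)"
      using assms by (intro mult_mono) auto
    then show ?thesis using M2 by simp
  qed
  have ex: "s \<le> real (card (graph_ball E R v))"
    using graph_ball_growth[OF assms(1), of \<beta> s R] growth sM2 assms(2,7) by force
  \<comment> \<open>Minimality of the radius also bounds the ball from above, as \<open>M2\<close>
    requires; the \<open>+ 1\<close> in \<open>s + 1\<close> covers radius zero.\<close>
  define r where "r = (LEAST j. s \<le> real (card (graph_ball E j v)))"
  have r: "s \<le> real (card (graph_ball E r v))" "r \<le> R"
    unfolding r_def using ex by (auto intro: LeastI Least_le)
  define S where "S = graph_ball E r v"
  have SV: "S \<subseteq> V" unfolding S_def by (rule graph_ball_subset[OF assms(1)])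
  have cS: "real (card S) \<le> (real d + 1) * (s + 1)"
  proof (cases r)
    case 0
    then have "card S = 1" by (simp add: S_def graph_ball_0)
    moreover have "1 * 1 \<le> (real d + 1) * (s + 1)" using assms by (intro mult_mono) auto
    ultimately show ?thesis by simp
  next
    case (Suc j)
    then have j: "real (card (graph_ball E j v)) < s"
      using not_less_Least[of j "\<lambda>j. s \<le> real (card (graph_ball E j v))"] by (simp add: r_def)
    have "card S \<le> (d + 1) * card (graph_ball E j v)"
      using card_graph_ball_Suc[OF assms(1), of j] card_boundary_le[OF graph_ball_subset[OF assms(1)], of j]
      by (simp add: S_def Suc)
    then have "real (card S) \<le> real ((d + 1) * card (graph_ball E j v))" by (rule of_nat_mono)
    also have "\<dots> = (real d + 1) * real (card (graph_ball E j v))" by (simp add: algebra_simps)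
    also have "\<dots> \<le> (real d + 1) * (s + 1)" using j by (intro mult_left_mono) auto
    finally show ?thesis .
  qed
  have "subset_prob (\<lambda>_. p) V (\<lambda>U. \<forall>w\<in>graph_ball E (R + 1) v \<inter> U. real (card (cluster E {w} U)) < M)
    \<le> subset_prob (\<lambda>_. p) V (\<lambda>U. real (card (cluster E S U)) < M2)"
  proof (rule subset_prob_mono)
    fix U assume *: "\<forall>w\<in>graph_ball E (R + 1) v \<inter> U. real (card (cluster E {w} U)) < M"
    have "outer_boundary E S \<subseteq> graph_ball E (R + 1) v"
      using graph_ball_Suc[of E r v] graph_ball_mono[of "Suc r" "R + 1" E v] r(2) by (auto simp: S_def)
    then have "real (card (cluster E S U)) \<le> real (card S) + real (d * card S) * M"
      using * by (intro card_cluster_le_sum[OF SV assms(5)]) force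
    also have "\<dots> = real (card S) * (1 + real d * M)" by (simp add: algebra_simps)
    also have "\<dots> \<le> (real d + 1) * (s + 1) * (1 + real d * M)"
      using cS assms(5) by (intro mult_right_mono) auto
    finally show "real (card (cluster E S U)) < M2" using M2 by linarith
  qed (use assms in \<open>auto simp: prob_weights_def intro: order_trans[of _ "1 / \<beta>"]\<close>)
  also have "\<dots> \<le> exp (- ((\<beta> * p - 1) * real (card S)))"
    by (rule blocked_source_prob[OF SV assms(2-4) growth])
  also have "\<dots> \<le> exp (- ((\<beta> * p - 1) * s))"
  proof -
    have "0 \<le> \<beta> * p - 1" using assms(2,3) by (simp add: field_simps)
    then show ?thesis using r(1) by (auto simp: S_def intro: mult_left_mono)
  qed
  finally show ?thesis .
qed

end

subsection \<open>Merging large clusters\<close>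

lemma sum_Pow_power_card:
  fixes y :: real
  assumes "finite A"
  shows "(\<Sum>X\<in>Pow A. y ^ card X) = (1 + y) ^ card A"
  using prod_add[OF assms, of "\<lambda>_. y" "\<lambda>_. 1"] by (simp add: add.commute)

context finite_regular_graph
begin

lemma cluster_insert_unreached:
  assumes "z \<notin> cluster E {v} (insert z U)"
  shows "cluster E {v} (insert z U) = cluster E {v} U"
proof
  have "cluster E {v} (insert z U) \<subseteq> cluster E {v} U \<inter> cluster E {v} (insert z U)"
  proof (rule cluster_least)
    show "{v} \<subseteq> cluster E {v} U \<inter> cluster E {v} (insert z U)" by (simp add: cluster_source[THEN subsetD])
    fix w x assume w: "w \<in> cluster E {v} U \<inter> cluster E {v} (insert z U)" "{w, x} \<in> E" "x \<in> insert z U"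
    then have x: "x \<in> cluster E {v} (insert z U)" by (blast intro: cluster_step)
    then have "x \<in> U" using assms w by auto
    then show "x \<in> cluster E {v} U \<inter> cluster E {v} (insert z U)"
      using w x by (blast intro: cluster_step)
  qed
  then show "cluster E {v} (insert z U) \<subseteq> cluster E {v} U" by simp
qed (rule cluster_mono, auto)

lemma cluster_insert_self: "cluster E {z} (insert z U) = cluster E {z} U"
  using cluster_diff_source[of E "{z}" "insert z U"] cluster_diff_source[of E "{z}" U]
  by (simp add: insert_Diff_if)

text \<open>If the cluster contains the new vertex \<open>z\<close>, the gap forces it to have at
  least \<open>M\<close> vertices. At most \<open>d\<close> old clusters meet at \<open>z\<close>,
  and \<open>1 + d * k < M\<close>, so one of them has size at least \<open>k\<close>.\<close>

lemma large_cluster_insert: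
  assumes "z \<in> V" "v \<in> insert z U" "k \<le> real (card (cluster E {v} (insert z U)))" "0 \<le> k" "1 + real d * k < M"
    and mid: "\<not> (k \<le> real (card (cluster E {z} (insert z U))) \<and> real (card (cluster E {z} (insert z U))) < M)"
  shows "\<exists>w\<in>U \<inter> cluster E {v} (insert z U). k \<le> real (card (cluster E {w} U))"
proof (cases "z \<in> cluster E {v} (insert z U)")
  case False
  then have vU: "v \<in> U" "v \<noteq> z" using assms(2) cluster_source[of "{v}" E "insert z U"] by auto
  have "cluster E {v} (insert z U) = cluster E {v} U" by (rule cluster_insert_unreached[OF False])
  then show ?thesis using assms(3) vU cluster_source[of "{v}" E U] by (intro bexI[of _ v]) auto
next
  case True
  have eq1: "cluster E {v} (insert z U) = cluster E {z} (insert z U)"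
    using cluster_eq[OF assms(2) True] by simp
  note eq2 = cluster_insert_self[of z U]
  have big: "M \<le> real (card (cluster E {z} U))"
    using mid assms(3) eq1 eq2 by auto
  show ?thesis
  proof (rule ccontr)
    assume neg: "\<not> ?thesis"
    have "real (card (cluster E {z} U)) \<le> real (card {z}) + real (d * card {z}) * k"
    proof (rule card_cluster_le_sum)
      fix w assume w: "w \<in> outer_boundary E {z} \<inter> U"
      then have "w \<in> cluster E {z} U"
        using cluster_step[of z E "{z}" U w] cluster_source[of "{z}" E U] by (auto simp: outer_boundary_def)
      then show "real (card (cluster E {w} U)) \<le> k" using neg w eq1 eq2 by force
    qed (use assms in auto)
    then show False using big assms(5) by simp
  qed
qed

text \<open>The insertions are undone one at a time, always keeping a cluster of size at least
  \<open>k\<close> inside the current one; at the start the gap lifts \<open>k\<close> to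
  \<open>M\<close>.\<close>

lemma large_cluster_descends:
  assumes "0 \<le> k" "1 + real d * k < M"
    and step: "\<And>i. i < n \<Longrightarrow> U (Suc i) = U i \<or> (\<exists>z\<in>V. U (Suc i) = insert z (U i))"
    and mid: "\<And>i v. i \<le> n \<Longrightarrow> v \<in> U i \<Longrightarrow>
      \<not> (k \<le> real (card (cluster E {v} (U i))) \<and> real (card (cluster E {v} (U i))) < M)"
    and "v \<in> U n" "k \<le> real (card (cluster E {v} (U n)))"
  shows "\<exists>w\<in>U 0 \<inter> cluster E {v} (U n). M \<le> real (card (cluster E {w} (U 0)))"
  using assms(3-)
proof (induction n arbitrary: v)
  case 0
  have "M \<le> real (card (cluster E {v} (U 0)))" using 0(2)[of 0 v] 0(3,4) by simp
  moreover have "v \<in> U 0 \<inter> cluster E {v} (U 0)" using 0(3) cluster_source[of "{v}" E "U 0"] by simp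
  ultimately show ?case by blast
next
  case (Suc n)
  have "\<exists>w\<in>U n \<inter> cluster E {v} (U (Suc n)). k \<le> real (card (cluster E {w} (U n)))"
  proof (cases "U (Suc n) = U n")
    case True
    have "v \<in> U n \<inter> cluster E {v} (U (Suc n))"
      using True Suc.prems(3) cluster_source[of "{v}" E "U n"] by simp
    then show ?thesis using True Suc.prems(4) by auto
  next
    case False
    then obtain z where z: "z \<in> V" "U (Suc n) = insert z (U n)" using Suc.prems(1)[of n] by auto
    have "\<not> (k \<le> real (card (cluster E {z} (U (Suc n)))) \<and> real (card (cluster E {z} (U (Suc n)))) < M)"
      using Suc.prems(2)[of "Suc n" z] z by auto
    then show ?thesis
      using large_cluster_insert[OF z(1), of v "U n" k M] assms Suc.prems(3,4) unfolding z(2) by auto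
  qed
  then obtain w where w: "w \<in> U n" "w \<in> cluster E {v} (U (Suc n))" "k \<le> real (card (cluster E {w} (U n)))"
    by auto
  obtain x where x: "x \<in> U 0" "x \<in> cluster E {w} (U n)" "M \<le> real (card (cluster E {x} (U 0)))"
  proof -
    have "\<exists>x\<in>U 0 \<inter> cluster E {w} (U n). M \<le> real (card (cluster E {x} (U 0)))"
    proof (rule Suc.IH[OF _ _ w(1,3)])
      show "U (Suc i) = U i \<or> (\<exists>z\<in>V. U (Suc i) = insert z (U i))" if "i < n" for i
        using Suc.prems(1)[of i] that by simp
      show "\<not> (k \<le> real (card (cluster E {v} (U i))) \<and> real (card (cluster E {v} (U i))) < M)"
        if "i \<le> n" "v \<in> U i" for i v
        using Suc.prems(2)[of i v] that by simp
    qed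
    then show ?thesis using that by blast
  qed
  have "U n \<subseteq> U (Suc n)" using Suc.prems(1)[of n] by auto
  then have "x \<in> cluster E {w} (U (Suc n))" using x(2) cluster_mono[of "{w}" "{w}" "U n" "U (Suc n)" E] by auto
  then have "x \<in> cluster E {v} (U (Suc n))" using cluster_trans[OF w(2)] by auto
  then show ?case using x by auto
qed

lemma cut_size_compl:
  assumes "X \<subseteq> V"
  shows "cut_size E (V - X) = cut_size E X"
proof -
  have "card (e \<inter> (V - X)) = 1 \<longleftrightarrow> card (e \<inter> X) = 1" if "e \<in> E" for e
  proof -
    have e: "e \<subseteq> V" "card e = 2" using edgeD[OF that] by auto
    have fe: "finite e" using e(2) card.infinite by fastforce
    have "card e = card (e \<inter> X) + card (e \<inter> (V - X))"
    proof (subst card_Un_disjoint[symmetric])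
      show "card e = card (e \<inter> X \<union> e \<inter> (V - X))" using e(1) by (intro arg_cong[of _ _ card]) auto
    qed (use fe in auto)
    then show ?thesis using e(2) by auto
  qed
  then show ?thesis unfolding cut_size_def by (metis (no_types, lifting))
qed

lemma card_edges_meeting_le:
  assumes "T \<subseteq> V"
  shows "card {e \<in> E. e \<inter> T \<noteq> {}} \<le> d * card T"
proof -
  have fT: "finite T" using assms finite_V finite_subset by blast
  have "{e \<in> E. e \<inter> T \<noteq> {}} = (\<Union>v\<in>T. {e \<in> E. v \<in> e})" by auto
  then have "card {e \<in> E. e \<inter> T \<noteq> {}} \<le> (\<Sum>v\<in>T. card {e \<in> E. v \<in> e})"
    using card_UN_le[OF fT] by simp
  also have "\<dots> = d * card T" using regular assms by (simp add: regular_graph_def subset_iff)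
  finally show ?thesis .
qed

definition connects :: "'a set \<Rightarrow> 'a set \<Rightarrow> 'a set \<Rightarrow> bool" where
  "connects A B Q \<longleftrightarrow> (\<exists>a\<in>A. \<exists>b\<in>B. b \<in> cluster E {a} Q)"

text \<open>Two short paths are glued by the edge. Confinement to the two balls later limits how
  many crossing edges a single vertex can block, and the member \<open>u\<close> keeps
  \<open>Q\<close> nonempty.\<close>

lemma connecting_path:
  assumes "{u, w} \<in> E" "a \<in> A" "a \<in> graph_ball E R u" "b \<in> B" "b \<in> graph_ball E R w"
  shows "\<exists>Q. u \<in> Q \<and> Q \<subseteq> graph_ball E R u \<union> graph_ball E R w \<and> finite Q \<and> card Q \<le> 2 * R + 2 \<and> connects A B Q"
proof -
  obtain Q1 where Q1: "u \<in> Q1" "a \<in> Q1" "Q1 \<subseteq> graph_ball E R u" "finite Q1" "card Q1 \<le> R + 1" "a \<in> cluster E {u} Q1"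
    using graph_ball_path[OF assms(3)] by blast
  obtain Q2 where Q2: "w \<in> Q2" "b \<in> Q2" "Q2 \<subseteq> graph_ball E R w" "finite Q2" "card Q2 \<le> R + 1" "b \<in> cluster E {w} Q2"
    using graph_ball_path[OF assms(5)] by blast
  let ?Q = "Q1 \<union> Q2"
  have a: "a \<in> cluster E {u} ?Q" using Q1(6) cluster_mono[of "{u}" "{u}" Q1 ?Q E] by auto
  have b: "b \<in> cluster E {w} ?Q" using Q2(6) cluster_mono[of "{w}" "{w}" Q2 ?Q E] by auto
  have w: "w \<in> cluster E {u} ?Q"
    using cluster_step[of u E "{u}" ?Q w] cluster_source[of "{u}" E ?Q] assms(1) Q2(1) by auto
  have "b \<in> cluster E {u} ?Q" using cluster_trans[OF w] b by auto
  moreover have "cluster E {a} ?Q = cluster E {u} ?Q"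
    by (rule cluster_eq) (use Q1 a in auto)
  ultimately have "connects A B ?Q" using assms unfolding connects_def by auto
  moreover have "card ?Q \<le> 2 * R + 2" using card_Un_le[of Q1 Q2] Q1 Q2 by linarith
  ultimately show ?thesis using Q1 Q2 by (intro exI[of _ ?Q]) auto
qed

text \<open>Separate the vertices closer to \<open>A\<close> from the others. By edge expansion many edges cross, and
  each of them extends to a short path from \<open>A\<close> to \<open>B\<close>; take a maximal disjoint family of such paths.\<close>

lemma disjoint_connecting_paths:
  assumes "edge_expanding b V E" "0 \<le> b" "A \<subseteq> V" "B \<subseteq> V" "A \<inter> B = {}"
    and near: "\<And>v. v \<in> V \<Longrightarrow> graph_ball E R v \<inter> (A \<union> B) \<noteq> {}"
  shows "\<exists>\<Q>. finite \<Q> \<and> disjoint \<Q> \<and> (\<forall>Q\<in>\<Q>. Q \<subseteq> V \<and> card Q \<le> 2 * R + 2 \<and> connects A B Q) \<and>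
    b * min (real (card A)) (real (card B)) \<le> real (card \<Q>) * real ((2 * R + 2) * (d * (d + 1) ^ R))"
proof -
  \<comment> \<open>Ties in distance go to \<open>A\<close>. A vertex outside \<open>X\<close> meets
    \<open>B\<close> strictly before \<open>A\<close>, so both sides find their target within
    distance \<open>R\<close>.\<close>
  define X where "X = {v \<in> V. \<exists>j\<le>R. graph_ball E j v \<inter> A \<noteq> {} \<and> (\<forall>i<j. graph_ball E i v \<inter> B = {})}"
  have XV: "X \<subseteq> V" by (auto simp: X_def)
  have AX: "A \<subseteq> X"
    using assms(3) by (auto simp: X_def graph_ball_0 intro!: exI[of _ 0])
  have BX: "B \<subseteq> V - X"
  proof
    fix v assume v: "v \<in> B"
    have "v \<notin> X"
    proof
      assume "v \<in> X"
      then obtain j where j: "graph_ball E j v \<inter> A \<noteq> {}" "\<forall>i<j. graph_ball E i v \<inter> B = {}" by (auto simp: X_def)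
      show False
      proof (cases j)
        case 0
        then show False using j v assms(5) by (auto simp: graph_ball_0)
      next
        case (Suc i)
        then have "graph_ball E 0 v \<inter> B = {}" using j by blast
        then show False using v by (simp add: graph_ball_0)
      qed
    qed
    then show "v \<in> V - X" using v assms(4) by auto
  qed
  have nearA: "\<exists>a\<in>A. a \<in> graph_ball E R v" if "v \<in> X" for v
    using that graph_ball_mono[of _ R E v] unfolding X_def by blast
  have nearB: "\<exists>b\<in>B. b \<in> graph_ball E R v" if v: "v \<in> V - X" for v
  proof -
    define j where "j = (LEAST j. graph_ball E j v \<inter> (A \<union> B) \<noteq> {})"
    have nv: "graph_ball E R v \<inter> (A \<union> B) \<noteq> {}" using near v by auto
    have j: "graph_ball E j v \<inter> (A \<union> B) \<noteq> {}" "j \<le> R"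
      unfolding j_def by (rule LeastI[of "\<lambda>j. graph_ball E j v \<inter> (A \<union> B) \<noteq> {}", OF nv])
        (rule Least_le[of "\<lambda>j. graph_ball E j v \<inter> (A \<union> B) \<noteq> {}", OF nv])
    have less: "graph_ball E i v \<inter> (A \<union> B) = {}" if "i < j" for i
      using not_less_Least[of i "\<lambda>j. graph_ball E j v \<inter> (A \<union> B) \<noteq> {}"] that unfolding j_def by blast
    have "graph_ball E j v \<inter> A = {}"
    proof (rule ccontr)
      assume "graph_ball E j v \<inter> A \<noteq> {}"
      moreover have "\<forall>i<j. graph_ball E i v \<inter> B = {}" using less by blast
      ultimately have "v \<in> X" using v j(2) unfolding X_def by blast
      then show False using v by simp
    qed
    then obtain b where "b \<in> B" "b \<in> graph_ball E j v" using j(1) by auto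
    then show ?thesis using graph_ball_mono[OF j(2), of E v] by auto
  qed
  define F where "F = {e \<in> E. card (e \<inter> X) = 1}"
  have finF: "finite F" using finite_E by (simp add: F_def)
  \<comment> \<open>Expansion is applied to the smaller of \<open>X\<close> and its complement;
    these contain \<open>A\<close> and \<open>B\<close>, hence the minimum.\<close>
  have cardF: "b * min (real (card A)) (real (card B)) \<le> real (card F)"
  proof (cases "real (card X) \<le> real (card V) / 2")
    case True
    have "card A \<le> card X" using AX XV finite_V by (meson card_mono finite_subset)
    then have "b * min (real (card A)) (real (card B)) \<le> b * real (card X)"
      using assms(2) by (intro mult_left_mono) auto
    also have "\<dots> \<le> real (edges_between E X (V - X))"
      using assms(1) XV True by (auto simp: edge_expanding_def)
    finally show ?thesis using edges_between_eq_cut[OF XV] by (simp add: cut_size_def F_def)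
  next
    case False
    have "card (V - X) = card V - card X" using XV finite_V by (meson card_Diff_subset finite_subset)
    moreover have "card X \<le> card V" using XV finite_V by (simp add: card_mono)
    ultimately have half: "real (card (V - X)) \<le> real (card V) / 2" using False by simp
    have "card B \<le> card (V - X)" using BX finite_V by (intro card_mono) auto
    then have "b * min (real (card A)) (real (card B)) \<le> b * real (card (V - X))"
      using assms(2) by (intro mult_left_mono) auto
    also have "\<dots> \<le> real (edges_between E (V - X) (V - (V - X)))"
      using assms(1) half by (auto simp: edge_expanding_def)
    finally show ?thesis
      using edges_between_eq_cut[of "V - X"] cut_size_compl[OF XV] by (simp add: cut_size_def F_def)
  qed
  have "\<exists>Q. e \<inter> Q \<noteq> {} \<and> Q \<subseteq> \<Union> (graph_ball E R ` e) \<and> finite Q \<and> card Q \<le> 2 * R + 2 \<and> connects A B Q"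
    if e: "e \<in> F" for e
  proof -
    have eE: "e \<in> E" and e1: "card (e \<inter> X) = 1" using e by (auto simp: F_def)
    obtain u where u: "e \<inter> X = {u}" using e1 by (auto simp: card_1_singleton_iff)
    obtain x y where xy: "e = {x, y}" "x \<noteq> y" using edgeD[OF eE] by (auto simp: card_2_iff)
    obtain w where w: "e = {u, w}" "w \<in> V - X"
    proof (cases "u = x")
      case True
      have "y \<in> V - X" using u xy edgeD[OF eE] True by auto
      then show ?thesis using that[of y] xy True by simp
    next
      case False
      then have "u = y" using u xy by auto
      moreover have "x \<in> V - X" using u xy edgeD[OF eE] False by auto
      ultimately show ?thesis using that[of x] xy by (simp add: insert_commute)
    qed
    have "u \<in> X" using u by auto
    then obtain a where a: "a \<in> A" "a \<in> graph_ball E R u" using nearA by blast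
    obtain b where b: "b \<in> B" "b \<in> graph_ball E R w" using nearB[OF w(2)] by blast
    have "{u, w} \<in> E" using eE w by simp
    from connecting_path[OF this a b] show ?thesis using w(1) by auto
  qed
  then obtain q where q: "\<And>e. e \<in> F \<Longrightarrow> e \<inter> q e \<noteq> {} \<and> q e \<subseteq> \<Union> (graph_ball E R ` e) \<and> finite (q e)
      \<and> card (q e) \<le> 2 * R + 2 \<and> connects A B (q e)"
    by metis
  define \<D> where "\<D> = {\<Q>. \<Q> \<subseteq> q ` F \<and> disjoint \<Q>}"
  have "finite \<D>" by (rule finite_subset[of _ "Pow (q ` F)"]) (use finF in \<open>auto simp: \<D>_def\<close>)
  moreover have "{} \<in> \<D>" by (simp add: \<D>_def)
  ultimately have "\<exists>\<Q>\<in>\<D>. \<forall>\<R>\<in>\<D>. \<Q> \<subseteq> \<R> \<longrightarrow> \<Q> = \<R>" by (intro finite_has_maximal) auto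
  then obtain \<Q> where \<Q>: "\<Q> \<subseteq> q ` F" "disjoint \<Q>" and max: "\<And>\<R>. \<R> \<in> \<D> \<Longrightarrow> \<Q> \<subseteq> \<R> \<Longrightarrow> \<Q> = \<R>"
    by (auto simp: \<D>_def)
  have fin\<Q>: "finite \<Q>" using \<Q>(1) finF finite_subset by blast
  have ballV: "\<Union> (graph_ball E R ` e) \<subseteq> V" if "e \<in> F" for e
    using that edgeD[of e] graph_ball_subset by (auto simp: F_def)
  have Q_props: "Q \<subseteq> V \<and> card Q \<le> 2 * R + 2 \<and> connects A B Q" if "Q \<in> \<Q>" for Q
  proof -
    obtain e where "e \<in> F" "Q = q e" using \<open>Q \<in> \<Q>\<close> \<Q>(1) by auto
    then show ?thesis using q[of e] ballV[of e] subset_trans[of "q e" "\<Union> (graph_ball E R ` e)" V] by blast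
  qed
  have meets: "\<exists>Q\<in>\<Q>. q e \<inter> Q \<noteq> {}" if e: "e \<in> F" for e
  proof (rule ccontr)
    assume neg: "\<not> ?thesis"
    then have "insert (q e) \<Q> \<in> \<D>"
      using \<Q> e by (auto simp: \<D>_def disjoint_def pairwise_insert disjnt_def Int_commute)
    then have "q e \<in> \<Q>" using max[of "insert (q e) \<Q>"] by auto
    then show False using neg q[OF e] by auto
  qed
  \<comment> \<open>By maximality the path of each crossing edge meets a selected path at some
    \<open>z\<close>, and then the edge has an end within distance \<open>R\<close> of
    \<open>z\<close>. So each \<open>z\<close> accounts for at most \<open>d * (d + 1) ^ R\<close>
    crossing edges.\<close>
  have "F \<subseteq> (\<Union>z\<in>\<Union>\<Q>. {e \<in> E. e \<inter> graph_ball E R z \<noteq> {}})"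
  proof
    fix e assume e: "e \<in> F"
    then obtain Q z where z: "Q \<in> \<Q>" "z \<in> Q" "z \<in> q e" using meets by blast
    then obtain u where "u \<in> e" "z \<in> graph_ball E R u" using q[OF e] by blast
    then have "u \<in> e \<inter> graph_ball E R z" using graph_ball_sym by auto
    then show "e \<in> (\<Union>z\<in>\<Union>\<Q>. {e \<in> E. e \<inter> graph_ball E R z \<noteq> {}})"
      using e z by (auto simp: F_def)
  qed
  have UQ: "finite (\<Union>\<Q>)" using fin\<Q> Q_props finite_V by (meson finite_Union finite_subset)
  have "card F \<le> card (\<Union>z\<in>\<Union>\<Q>. {e \<in> E. e \<inter> graph_ball E R z \<noteq> {}})"
  proof (rule card_mono)
    show "finite (\<Union>z\<in>\<Union>\<Q>. {e \<in> E. e \<inter> graph_ball E R z \<noteq> {}})"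
      by (rule finite_subset[OF _ finite_E]) blast
  qed fact
  also have "\<dots> \<le> (\<Sum>z\<in>\<Union>\<Q>. card {e \<in> E. e \<inter> graph_ball E R z \<noteq> {}})"
    by (rule card_UN_le[OF UQ])
  also have "\<dots> \<le> (\<Sum>z\<in>\<Union>\<Q>. d * (d + 1) ^ R)"
  proof (rule sum_mono)
    fix z assume "z \<in> \<Union>\<Q>"
    then have z: "z \<in> V" using Q_props by auto
    have "card {e \<in> E. e \<inter> graph_ball E R z \<noteq> {}} \<le> d * card (graph_ball E R z)"
      by (rule card_edges_meeting_le[OF graph_ball_subset[OF z]])
    also have "\<dots> \<le> d * (d + 1) ^ R" by (rule mult_left_mono[OF card_graph_ball_le[OF z]]) simp
    finally show "card {e \<in> E. e \<inter> graph_ball E R z \<noteq> {}} \<le> d * (d + 1) ^ R" .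
  qed
  also have "\<dots> = card (\<Union>\<Q>) * (d * (d + 1) ^ R)" by simp
  also have "\<dots> \<le> (card \<Q> * (2 * R + 2)) * (d * (d + 1) ^ R)"
  proof (rule mult_right_mono)
    have "card (\<Union>\<Q>) \<le> (\<Sum>Q\<in>\<Q>. card Q)"
      using card_UN_le[OF fin\<Q>, of "\<lambda>Q. Q"] by simp
    also have "\<dots> \<le> card \<Q> * (2 * R + 2)"
      using sum_bounded_above[of \<Q> card "2 * R + 2"] Q_props by (simp only: of_nat_id)
    finally show "card (\<Union>\<Q>) \<le> card \<Q> * (2 * R + 2)" .
  qed simp
  finally have "card F \<le> card \<Q> * ((2 * R + 2) * (d * (d + 1) ^ R))" by (simp only: mult.assoc)
  then have "real (card F) \<le> real (card \<Q> * ((2 * R + 2) * (d * (d + 1) ^ R)))" by (rule of_nat_mono)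
  then have "b * min (real (card A)) (real (card B)) \<le> real (card \<Q>) * real ((2 * R + 2) * (d * (d + 1) ^ R))"
    using cardF unfolding of_nat_mult[of "card \<Q>"] by linarith
  then show ?thesis using fin\<Q> \<Q>(2) Q_props by (intro exI[of _ \<Q>] conjI ballI) auto
qed

text \<open>If two large clusters of \<open>X\<close> stay apart, some bipartition of these clusters
  has no connection, so all disjoint paths between its sides fail. A group of \<open>j\<close>
  clusters has at least \<open>M * j\<close> vertices, which makes this exponentially unlikely in
  the size of the smaller group; the binomial theorem sums over all groups.\<close>

lemma unmerged_prob:
  assumes "edge_expanding b V E" "0 \<le> b" "X \<subseteq> V" "0 \<le> p" "p \<le> 1" "0 \<le> \<theta>" "0 \<le> M" "0 < d"
    and W: "W = {v \<in> X. M \<le> real (card (cluster E {v} X))}"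
    and near: "\<And>v. v \<in> V \<Longrightarrow> graph_ball E R v \<inter> W \<noteq> {}"
    and \<theta>: "\<theta> * real ((2 * R + 2) * (d * (d + 1) ^ R)) \<le> b * p ^ (2 * R + 2)"
  shows "subset_prob (\<lambda>_. p) V (\<lambda>Y. \<exists>v\<in>W. \<exists>w\<in>W. w \<notin> cluster E {v} (X \<union> Y))
    \<le> 2 * ((1 + exp (- \<theta> * M)) ^ card V - 1)"
proof -
  let ?y = "exp (- \<theta> * M)"
  let ?K = "real ((2 * R + 2) * (d * (d + 1) ^ R))"
  define \<W> where "\<W> = (\<lambda>v. cluster E {v} X) ` W"
  have WX: "W \<subseteq> X" using W by auto
  have finW: "finite W" using WX assms(3) finite_V by (meson finite_subset)
  have fin\<W>: "finite \<W>" using finW by (simp add: \<W>_def)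
  have ZV: "Z \<subseteq> V" "Z \<subseteq> X" "finite Z" "M \<le> real (card Z)" if "Z \<in> \<W>" for Z
  proof -
    obtain v where v: "v \<in> W" "Z = cluster E {v} X" using \<open>Z \<in> \<W>\<close> by (auto simp: \<W>_def)
    show "Z \<subseteq> X" using v WX cluster_subset[of E "{v}" X] by auto
    then show "Z \<subseteq> V" using assms(3) by auto
    then show "finite Z" using finite_V finite_subset by blast
    show "M \<le> real (card Z)" using v W by auto
  qed
  have Zeq: "Z = cluster E {z} X" if "Z \<in> \<W>" "z \<in> Z" for Z z
  proof -
    obtain v where v: "v \<in> W" "Z = cluster E {v} X" using \<open>Z \<in> \<W>\<close> by (auto simp: \<W>_def)
    then show ?thesis using cluster_eq[of v X z E] that(2) WX by auto
  qed
  have disj: "pairwise disjnt \<W>"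
    unfolding pairwise_def disjnt_def using Zeq by blast
  have W_UN: "\<Union>\<W> = W"
  proof
    show "\<Union>\<W> \<subseteq> W"
    proof
      fix z assume "z \<in> \<Union>\<W>"
      then obtain Z where Z: "Z \<in> \<W>" "z \<in> Z" by auto
      then show "z \<in> W" using Zeq[OF Z] ZV[OF Z(1)] W by auto
    qed
    show "W \<subseteq> \<Union>\<W>" using cluster_source[of _ E X] by (force simp: \<W>_def)
  qed
  have card_Union_ge: "M * real (card \<A>) \<le> real (card (\<Union>\<A>))" if "\<A> \<subseteq> \<W>" for \<A>
  proof -
    have "real (card (\<Union>\<A>)) = (\<Sum>Z\<in>\<A>. real (card Z))"
      using that ZV disj by (subst card_Union_disjoint) (auto intro: pairwise_subset)
    also have "\<dots> \<ge> real (card \<A>) * M"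
      using that ZV by (intro sum_bounded_below) auto
    finally show ?thesis by (simp add: mult.commute)
  qed
  have pw: "prob_weights (\<lambda>_. p) V" using assms(4,5) by (simp add: prob_weights_def)
  let ?J = "Pow \<W> - {{}, \<W>}"
  let ?unc = "\<lambda>\<A> Y. \<forall>a\<in>\<Union>\<A>. \<forall>b\<in>\<Union>(\<W> - \<A>). b \<notin> cluster E {a} (X \<union> Y)"
  have split_prob: "subset_prob (\<lambda>_. p) V (?unc \<A>) \<le> ?y ^ card \<A> + ?y ^ card (\<W> - \<A>)" if \<A>: "\<A> \<in> ?J" for \<A>
  proof -
    let ?A = "\<Union>\<A>" and ?B = "\<Union>(\<W> - \<A>)"
    have A\<W>: "\<A> \<subseteq> \<W>" using \<A> by simp
    have AB: "?A \<inter> ?B = {}"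
    proof (rule equals0I)
      fix z assume "z \<in> ?A \<inter> ?B"
      then obtain Z Z' where Z: "Z \<in> \<A>" "z \<in> Z" "Z' \<in> \<W> - \<A>" "z \<in> Z'" by blast
      then have "Z = cluster E {z} X" "Z' = cluster E {z} X" using Zeq A\<W> by blast+
      then show False using Z by simp
    qed
    have "\<A> \<union> (\<W> - \<A>) = \<W>" using A\<W> by blast
    then have "?A \<union> ?B = W" using W_UN Union_Un_distrib[of \<A> "\<W> - \<A>"] by simp
    then have near': "graph_ball E R v \<inter> (?A \<union> ?B) \<noteq> {}" if "v \<in> V" for v using near[OF that] by simp
    have WV: "W \<subseteq> V" using WX assms(3) by blast
    have AV: "?A \<subseteq> V" and BV: "?B \<subseteq> V" using \<open>?A \<union> ?B = W\<close> WV by blast+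
    have "\<exists>\<Q>. finite \<Q> \<and> disjoint \<Q> \<and> (\<forall>Q\<in>\<Q>. Q \<subseteq> V \<and> card Q \<le> 2 * R + 2 \<and> connects ?A ?B Q) \<and>
        b * min (real (card ?A)) (real (card ?B)) \<le> real (card \<Q>) * ?K"
      by (rule disjoint_connecting_paths[OF assms(1,2) AV BV AB near'])
    then obtain \<Q> where "finite \<Q> \<and> disjoint \<Q> \<and> (\<forall>Q\<in>\<Q>. Q \<subseteq> V \<and> card Q \<le> 2 * R + 2 \<and> connects ?A ?B Q) \<and>
        b * min (real (card ?A)) (real (card ?B)) \<le> real (card \<Q>) * ?K" by (elim exE)
    then have \<Q>: "finite \<Q>" "disjoint \<Q>"
        "\<And>Q. Q \<in> \<Q> \<Longrightarrow> Q \<subseteq> V \<and> card Q \<le> 2 * R + 2 \<and> connects ?A ?B Q"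
        "b * min (real (card ?A)) (real (card ?B)) \<le> real (card \<Q>) * ?K"
      by simp_all
    have "subset_prob (\<lambda>_. p) V (?unc \<A>) \<le> subset_prob (\<lambda>_. p) V (\<lambda>U. \<forall>Q\<in>\<Q>. \<not> Q \<subseteq> U)"
    proof (rule subset_prob_mono[OF pw], intro ballI notI)
      fix Y Q assume Y: "?unc \<A> Y" and Q: "Q \<in> \<Q>" "Q \<subseteq> Y"
      then obtain a b where ab: "a \<in> ?A" "b \<in> ?B" "b \<in> cluster E {a} Q"
        using \<Q>(3)[OF Q(1)] unfolding connects_def by blast
      have "b \<in> cluster E {a} (X \<union> Y)"
        using ab(3) Q(2) cluster_mono[of "{a}" "{a}" Q "X \<union> Y" E] by auto
      then show False using Y ab(1,2) by blast
    qed
    also have "\<dots> \<le> (1 - p ^ (2 * R + 2)) ^ card \<Q>"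
      by (rule subset_prob_no_member[OF finite_V assms(4,5) \<Q>(1,2)]) (use \<Q>(3) in auto)
    also have "\<dots> \<le> exp (- (p ^ (2 * R + 2))) ^ card \<Q>"
    proof (rule power_mono)
      show "1 - p ^ (2 * R + 2) \<le> exp (- (p ^ (2 * R + 2)))"
        using exp_ge_add_one_self[of "- (p ^ (2 * R + 2))"] by simp
      show "0 \<le> 1 - p ^ (2 * R + 2)" using assms(4,5) power_le_one[of p "2 * R + 2"] by simp
    qed
    also have "\<dots> = exp (- (p ^ (2 * R + 2) * real (card \<Q>)))"
      by (simp add: exp_of_nat_mult[symmetric] mult.commute)
    also have "\<dots> \<le> exp (- (\<theta> * (M * min (real (card \<A>)) (real (card (\<W> - \<A>))))))"
    proof -
      let ?m = "min (real (card ?A)) (real (card ?B))"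
      have K: "?K > 0" using assms(8) by (simp only: of_nat_0_less_iff) simp
      have "M * real (card \<A>) \<le> real (card ?A)" "M * real (card (\<W> - \<A>)) \<le> real (card ?B)"
        using \<A> by (auto intro!: card_Union_ge)
      moreover have "M * min (real (card \<A>)) (real (card (\<W> - \<A>))) \<le> M * real (card \<A>)"
          "M * min (real (card \<A>)) (real (card (\<W> - \<A>))) \<le> M * real (card (\<W> - \<A>))"
        using assms(7) by (intro mult_left_mono; simp)+
      ultimately have "M * min (real (card \<A>)) (real (card (\<W> - \<A>))) \<le> ?m"
        by linarith
      then have "\<theta> * (M * min (real (card \<A>)) (real (card (\<W> - \<A>)))) \<le> \<theta> * ?m"
        using assms(6) by (rule mult_left_mono)
      moreover have "\<theta> * ?m \<le> p ^ (2 * R + 2) * real (card \<Q>)"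
      proof -
        have "(\<theta> * ?m) * ?K = (\<theta> * ?K) * ?m" by (simp only: mult_ac)
        also have "\<dots> \<le> (b * p ^ (2 * R + 2)) * ?m"
          by (rule mult_right_mono[OF \<theta>]) simp
        also have "\<dots> = p ^ (2 * R + 2) * (b * ?m)" by (simp only: mult_ac)
        also have "\<dots> \<le> p ^ (2 * R + 2) * (real (card \<Q>) * ?K)"
          using \<Q>(4) assms(4) by (intro mult_left_mono) auto
        finally have "(\<theta> * ?m) * ?K \<le> (p ^ (2 * R + 2) * real (card \<Q>)) * ?K" by (simp only: mult_ac)
        then show ?thesis using K by (rule mult_right_le_imp_le)
      qed
      ultimately show ?thesis by simp
    qed
    \<comment> \<open>Replacing the minimum in the exponent by a sum of two terms makes the bound
      symmetric under complements and summable over all families.\<close>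
    also have "\<dots> \<le> ?y ^ card \<A> + ?y ^ card (\<W> - \<A>)"
    proof -
      have y: "?y ^ k = exp (- (\<theta> * (M * real k)))" for k
        by (simp add: exp_of_nat_mult[symmetric] mult_ac)
      show ?thesis
      proof (cases "card \<A> \<le> card (\<W> - \<A>)")
        case True
        then show ?thesis unfolding y by (simp add: min_def)
      next
        case False
        then show ?thesis unfolding y by (simp add: min_def)
      qed
    qed
    finally show ?thesis .
  qed
  have "subset_prob (\<lambda>_. p) V (\<lambda>Y. \<exists>v\<in>W. \<exists>w\<in>W. w \<notin> cluster E {v} (X \<union> Y))
      \<le> subset_prob (\<lambda>_. p) V (\<lambda>Y. \<exists>\<A>\<in>?J. ?unc \<A> Y)"
  proof (rule subset_prob_mono[OF pw])
    fix Y assume "\<exists>v\<in>W. \<exists>w\<in>W. w \<notin> cluster E {v} (X \<union> Y)"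
    then obtain v w where vw: "v \<in> W" "w \<in> W" "w \<notin> cluster E {v} (X \<union> Y)" by auto
    \<comment> \<open>The separating bipartition: clusters of \<open>X\<close> absorbed by the
      cluster of \<open>v\<close>, against the others.\<close>
    define \<A> where "\<A> = {Z \<in> \<W>. Z \<subseteq> cluster E {v} (X \<union> Y)}"
    have "cluster E {v} X \<in> \<A>" using vw(1) cluster_mono[of "{v}" "{v}" X "X \<union> Y" E] by (auto simp: \<A>_def \<W>_def)
    moreover have "cluster E {w} X \<in> \<W> - \<A>"
      using vw(2,3) cluster_source[of "{w}" E X] by (auto simp: \<A>_def \<W>_def)
    ultimately have "\<A> \<in> ?J" by (auto simp: \<A>_def)
    moreover have "?unc \<A> Y"
    proof (intro ballI notI)
      fix a z assume a: "a \<in> \<Union>\<A>" and z: "z \<in> \<Union>(\<W> - \<A>)" and az: "z \<in> cluster E {a} (X \<union> Y)"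
      have "a \<in> cluster E {v} (X \<union> Y)" using a by (auto simp: \<A>_def)
      then have 1: "z \<in> cluster E {v} (X \<union> Y)" using cluster_trans[of a E "{v}" "X \<union> Y"] az by auto
      obtain Z where Z: "Z \<in> \<W>" "Z \<notin> \<A>" "z \<in> Z" using z by auto
      have "Z = cluster E {z} X" using Zeq Z by auto
      also have "\<dots> \<subseteq> cluster E {z} (X \<union> Y)" by (rule cluster_mono) auto
      also have "\<dots> \<subseteq> cluster E {v} (X \<union> Y)" by (rule cluster_trans[OF 1])
      finally show False using Z by (simp add: \<A>_def)
    qed
    ultimately show "\<exists>\<A>\<in>?J. ?unc \<A> Y" by blast
  qed
  also have "\<dots> \<le> (\<Sum>\<A>\<in>?J. subset_prob (\<lambda>_. p) V (?unc \<A>))"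
    by (rule subset_prob_Ex[OF pw]) (use fin\<W> in auto)
  also have "\<dots> \<le> (\<Sum>\<A>\<in>?J. ?y ^ card \<A> + ?y ^ card (\<W> - \<A>))"
    by (rule sum_mono) (rule split_prob)
  also have "\<dots> = (\<Sum>\<A>\<in>?J. ?y ^ card \<A>) + (\<Sum>\<A>\<in>?J. ?y ^ card (\<W> - \<A>))"
    by (rule sum.distrib)
  also have "(\<Sum>\<A>\<in>?J. ?y ^ card (\<W> - \<A>)) = (\<Sum>\<A>\<in>?J. ?y ^ card \<A>)"
    by (rule sum.reindex_bij_witness[of _ "\<lambda>\<A>. \<W> - \<A>" "\<lambda>\<A>. \<W> - \<A>"]) auto
  also have "(\<Sum>\<A>\<in>?J. ?y ^ card \<A>) \<le> (\<Sum>\<A>\<in>Pow \<W> - {{}}. ?y ^ card \<A>)"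
    by (rule sum_mono2) (use fin\<W> in auto)
  \<comment> \<open>Leaving out the empty family produces the \<open>- 1\<close>, without which the
    bound could not be small.\<close>
  also have "(\<Sum>\<A>\<in>Pow \<W> - {{}}. ?y ^ card \<A>) = (1 + ?y) ^ card \<W> - 1"
    using sum_Pow_power_card[OF fin\<W>, of ?y] fin\<W> by (simp add: sum_diff1)
  also have "\<dots> \<le> (1 + ?y) ^ card V - 1"
  proof -
    have "card \<W> \<le> card W" unfolding \<W>_def by (rule card_image_le[OF finW])
    also have "\<dots> \<le> card V" using WX assms(3) finite_V by (intro card_mono) auto
    finally show ?thesis by (simp add: power_increasing)
  qed
  finally show ?thesis by simp
qed

end

subsection \<open>The number of vertices in large clusters\<close>

context finite_regular_graph
begin

definition large_vertices :: "real \<Rightarrow> 'a set \<Rightarrow> 'a set" where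
  "large_vertices M U = {v \<in> U. M \<le> real (card (cluster E {v} U))}"

lemma large_vertices_mono:
  assumes "U \<subseteq> U'" "U' \<subseteq> V"
  shows "large_vertices M U \<subseteq> large_vertices M U'"
proof
  fix v assume v: "v \<in> large_vertices M U"
  then have vV: "{v} \<subseteq> V" using assms by (auto simp: large_vertices_def)
  have "card (cluster E {v} U) \<le> card (cluster E {v} U')"
    by (rule card_mono[OF finite_cluster[OF vV] cluster_mono[OF order_refl assms(1)]])
  then show "v \<in> large_vertices M U'" using v assms by (auto simp: large_vertices_def)
qed

lemma finite_large_vertices: "U \<subseteq> V \<Longrightarrow> finite (large_vertices M U)"
  by (rule finite_subset[OF _ finite_V]) (auto simp: large_vertices_def)

text \<open>A vertex other than \<open>z\<close> that becomes large lay in a small cluster adjacent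
  to \<open>z\<close>. There are at most \<open>d\<close> such clusters, each with fewer than
  \<open>M\<close> vertices.\<close>

lemma card_large_vertices_insert:
  assumes "z \<in> V" "U \<subseteq> V" "0 \<le> M"
  shows "\<bar>real (card (large_vertices M (insert z U))) - real (card (large_vertices M U))\<bar> \<le> 1 + real d * M"
proof -
  let ?L = "large_vertices M U" and ?L' = "large_vertices M (insert z U)"
  let ?B = "{w \<in> outer_boundary E {z} \<inter> U. real (card (cluster E {w} U)) < M}"
  have zU: "insert z U \<subseteq> V" using assms by auto
  have fB: "finite ?B" using finite_outer_boundary by simp
  have sub: "?L \<subseteq> ?L'" by (rule large_vertices_mono[OF _ zU]) auto
  have "?L' - ?L \<subseteq> insert z (\<Union>w\<in>?B. cluster E {w} U)"
  proof
    fix v assume v: "v \<in> ?L' - ?L"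
    then have vz: "v \<in> insert z U" by (auto simp: large_vertices_def)
    show "v \<in> insert z (\<Union>w\<in>?B. cluster E {w} U)"
    proof (cases "v = z")
      case False
      then have vU: "v \<in> U" using vz by simp
      have small: "real (card (cluster E {v} U)) < M" and big: "M \<le> real (card (cluster E {v} (insert z U)))"
        using v vU by (auto simp: large_vertices_def)
      then have "z \<in> cluster E {v} (insert z U)"
        using cluster_insert_unreached[of z v U] by fastforce
      then have "cluster E {v} (insert z U) = cluster E {z} U"
        using cluster_eq[OF vz] cluster_insert_self[of z U] by metis
      then have "v \<in> cluster E {z} U" using cluster_source[of "{v}" E "insert z U"] by auto
      then obtain w where w: "w \<in> outer_boundary E {z} \<inter> U" "v \<in> cluster E {w} U"
        using equalityD1[OF cluster_decomp[of E "{z}" U]] False by blast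
      have "cluster E {v} U = cluster E {w} U" by (rule cluster_eq[of w U v E]) (use w in auto)
      then have "w \<in> ?B" using small w(1) by simp
      then show ?thesis using w by auto
    qed simp
  qed
  then have "card (?L' - ?L) \<le> card (insert z (\<Union>w\<in>?B. cluster E {w} U))"
  proof (rule card_mono[rotated])
    have "finite (cluster E {w} U)" if "w \<in> ?B" for w
      using that assms(2) by (intro finite_cluster) auto
    then show "finite (insert z (\<Union>w\<in>?B. cluster E {w} U))" using fB by simp
  qed
  also have "\<dots> \<le> 1 + card (\<Union>w\<in>?B. cluster E {w} U)"
    using card_Un_le[of "{z}" "\<Union>w\<in>?B. cluster E {w} U"] by simp
  also have "\<dots> \<le> 1 + (\<Sum>w\<in>?B. card (cluster E {w} U))"
    using card_UN_le[OF fB] by simp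
  finally have "real (card (?L' - ?L)) \<le> real (1 + (\<Sum>w\<in>?B. card (cluster E {w} U)))" by (rule of_nat_mono)
  then have "real (card (?L' - ?L)) \<le> 1 + (\<Sum>w\<in>?B. real (card (cluster E {w} U)))" by simp
  also have "(\<Sum>w\<in>?B. real (card (cluster E {w} U))) \<le> real (card ?B) * M"
    by (rule sum_bounded_above) auto
  also have "\<dots> \<le> real d * M"
  proof (rule mult_right_mono[OF _ assms(3)])
    have "card ?B \<le> card (outer_boundary E {z})" by (rule card_mono[OF finite_outer_boundary]) auto
    also have "\<dots> \<le> d" using card_boundary_le[of "{z}"] assms(1) by simp
    finally show "real (card ?B) \<le> real d" by simp
  qed
  finally have diff: "real (card (?L' - ?L)) \<le> 1 + real d * M" by simp
  have "card ?L \<le> card ?L'" using sub finite_large_vertices[OF zU] by (rule card_mono[rotated])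
  moreover have "card (?L' - ?L) = card ?L' - card ?L"
    by (rule card_Diff_subset[OF finite_large_vertices[OF assms(2)] sub])
  ultimately show ?thesis using diff by simp
qed

text \<open>The cluster of \<open>v\<close> ignores whether \<open>v\<close> itself is chosen, so
  the two events are independent.\<close>

lemma prob_mem_and_cluster:
  assumes "v \<in> V"
  shows "subset_prob \<pi> V (\<lambda>U. v \<in> U \<and> P (cluster E {v} U)) = \<pi> v * subset_prob \<pi> V (\<lambda>U. P (cluster E {v} U))"
proof -
  have "subset_prob \<pi> V (\<lambda>U. v \<in> U \<and> P (cluster E {v} U)) =
      subset_exp \<pi> V (\<lambda>U. of_bool (v \<in> U) * of_bool (P (cluster E {v} U)))"
    unfolding subset_prob_def by (rule subset_exp_cong) auto
  also have "\<dots> = subset_exp \<pi> V (\<lambda>U. of_bool (v \<in> U)) * subset_exp \<pi> V (\<lambda>U. of_bool (P (cluster E {v} U)))"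
    by (rule subset_exp_indep[OF finite_V, of "{v}"]) (use assms in \<open>auto simp: cluster_diff_source\<close>)
  also have "subset_exp \<pi> V (\<lambda>U. of_bool (v \<in> U)) = \<pi> v"
    using subset_prob_cylinder[OF finite_V, of "{v}" "{}" \<pi>] assms by (simp add: subset_prob_def)
  finally show ?thesis by (simp add: subset_prob_def)
qed

lemma expected_large_vertices:
  "subset_exp \<pi> V (\<lambda>U. real (card (large_vertices M U))) =
    (\<Sum>v\<in>V. \<pi> v * (1 - subset_prob \<pi> V (\<lambda>U. real (card (cluster E {v} U)) < M)))"
proof -
  have "subset_exp \<pi> V (\<lambda>U. real (card (large_vertices M U))) =
      subset_exp \<pi> V (\<lambda>U. \<Sum>v\<in>V. of_bool (v \<in> U \<and> \<not> real (card (cluster E {v} U)) < M))"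
  proof (rule subset_exp_cong)
    fix U assume "U \<subseteq> V"
    then have "large_vertices M U = {v \<in> V. v \<in> U \<and> \<not> real (card (cluster E {v} U)) < M}"
      by (auto simp: large_vertices_def)
    then have "card (large_vertices M U) = (\<Sum>v\<in>V. of_bool (v \<in> U \<and> \<not> real (card (cluster E {v} U)) < M))"
      by (simp only: sum_of_bool_eq_card[OF finite_V])
    then show "real (card (large_vertices M U)) = (\<Sum>v\<in>V. of_bool (v \<in> U \<and> \<not> real (card (cluster E {v} U)) < M))"
      by (simp only: of_nat_sum of_nat_of_bool)
  qed
  also have "\<dots> = (\<Sum>v\<in>V. subset_prob \<pi> V (\<lambda>U. v \<in> U \<and> \<not> real (card (cluster E {v} U)) < M))"
    unfolding subset_exp_sum subset_prob_def ..
  also have "\<dots> = (\<Sum>v\<in>V. \<pi> v * (1 - subset_prob \<pi> V (\<lambda>U. real (card (cluster E {v} U)) < M)))"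
  proof (rule sum.cong)
    fix v assume "v \<in> V"
    note mem = prob_mem_and_cluster[OF this, of \<pi> "\<lambda>T. \<not> real (card T) < M"]
    show "subset_prob \<pi> V (\<lambda>U. v \<in> U \<and> \<not> real (card (cluster E {v} U)) < M) =
        \<pi> v * (1 - subset_prob \<pi> V (\<lambda>U. real (card (cluster E {v} U)) < M))"
      by (rule trans[OF mem]) (simp only: subset_prob_not[OF finite_V])
  qed simp
  finally show ?thesis .
qed

text \<open>For a connected set, fewer edges than vertices means acyclic. The bound is
  \<open>h + 1\<close> rather than \<open>h\<close> because a cluster of size \<open>h\<close> has
  to stay acyclic after one boundary vertex is added.\<close>

definition tree_like :: "nat \<Rightarrow> 'a \<Rightarrow> bool" where
  "tree_like h v \<longleftrightarrow> (\<forall>T\<subseteq>V. cluster E {v} (T - {v}) = T \<longrightarrow> card T \<le> h + 1 \<longrightarrow> edges_in E T < card T)"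

lemma cut_size_eq_sum:
  assumes "T \<subseteq> V"
  shows "cut_size E T = (\<Sum>z\<in>outer_boundary E T. card {t \<in> T. {t, z} \<in> E})"
proof -
  have fT: "finite T" using assms finite_V finite_subset by blast
  let ?S = "SIGMA z:outer_boundary E T. {t \<in> T. {t, z} \<in> E}"
  have "card ?S = card {e \<in> E. card (e \<inter> T) = 1}"
  proof (rule bij_betw_same_card, rule bij_betwI')
    show "(\<lambda>(z, t). {t, z}) x = (\<lambda>(z, t). {t, z}) y \<longleftrightarrow> x = y" if "x \<in> ?S" "y \<in> ?S" for x y
      using that by (auto simp: outer_boundary_def doubleton_eq_iff)
    show "(\<lambda>(z, t). {t, z}) x \<in> {e \<in> E. card (e \<inter> T) = 1}" if "x \<in> ?S" for x
      using that by (auto simp: outer_boundary_def Int_insert_left)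
    show "\<exists>x\<in>?S. e = (\<lambda>(z, t). {t, z}) x" if "e \<in> {e \<in> E. card (e \<inter> T) = 1}" for e
    proof -
      have e: "e \<in> E" "card (e \<inter> T) = 1" using that by auto
      then obtain u where u: "e \<inter> T = {u}" by (auto simp: card_1_singleton_iff)
      have "card (e - {u}) = 1" using edgeD[OF e(1)] u by (subst card_Diff_singleton) auto
      then obtain w where w: "e - {u} = {w}" by (auto simp: card_1_singleton_iff)
      have eq: "e = {u, w}" using u w by auto
      have "u \<in> T" "w \<notin> T" using u w by auto
      then have "(w, u) \<in> ?S" using e(1) eq by (auto simp: outer_boundary_def)
      then show ?thesis using eq by (intro bexI[of _ "(w, u)"]) auto
    qed
  qed
  then show ?thesis
    unfolding cut_size_def using fT finite_outer_boundary by simp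
qed

text \<open>A boundary vertex with two neighbours in \<open>T\<close> would close a cycle.\<close>

lemma card_boundary_tree_like:
  assumes "tree_like h v" "T \<subseteq> V" "cluster E {v} (T - {v}) = T" "card T \<le> h"
  shows "card (outer_boundary E T) + 2 * card T = d * card T + 2"
proof -
  have fT: "finite T" using assms finite_V finite_subset by blast
  have eT: "edges_in E T + 1 = card T"
  proof -
    have "card T \<le> h + 1" using assms(4) by simp
    then have "edges_in E T < card T" using assms(1-3) unfolding tree_like_def by blast
    then show ?thesis using edges_in_connected_ge[OF assms(2,3)] by linarith
  qed
  have "card {t \<in> T. {t, z} \<in> E} = 1" if z: "z \<in> outer_boundary E T" for z
  proof -
    have zT: "z \<notin> T" "z \<in> V"
      using z subsetD[OF outer_boundary_subset z] unfolding outer_boundary_def by simp_all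
    obtain t where t: "t \<in> T" "{t, z} \<in> E" using z by (auto simp: outer_boundary_def)
    then have "{t \<in> T. {t, z} \<in> E} \<noteq> {}" by auto
    then have ge: "1 \<le> card {t \<in> T. {t, z} \<in> E}" using fT by (simp add: Suc_le_eq card_gt_0_iff)
    have "v \<in> T" using cluster_source[of "{v}" E "T - {v}"] assms(3) by auto
    then have vz: "v \<noteq> z" using zT by auto
    have "cluster E {v} (insert z T - {v}) = insert z T"
    proof
      show "cluster E {v} (insert z T - {v}) \<subseteq> insert z T"
        using cluster_subset[of E "{v}" "insert z T - {v}"] \<open>v \<in> T\<close> by auto
      have "T \<subseteq> cluster E {v} (insert z T - {v})"
        using cluster_mono[of "{v}" "{v}" "T - {v}" "insert z T - {v}" E] assms(3) by auto
      moreover from this have "z \<in> cluster E {v} (insert z T - {v})"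
        using cluster_step[of t E "{v}" "insert z T - {v}" z] t vz by auto
      ultimately show "insert z T \<subseteq> cluster E {v} (insert z T - {v})" by auto
    qed
    moreover have "insert z T \<subseteq> V" "card (insert z T) \<le> h + 1"
      using assms(2,4) zT fT by simp_all
    ultimately have "edges_in E (insert z T) < card (insert z T)"
      using assms(1) unfolding tree_like_def by blast
    then show ?thesis using edges_in_insert[OF zT(1)] eT zT fT ge by simp
  qed
  then have "cut_size E T = card (outer_boundary E T)" by (simp add: cut_size_eq_sum[OF assms(2)])
  then show ?thesis using degree_sum[OF assms(2)] eT by simp
qed

text \<open>The two densities \<open>p\<close> and \<open>r\<close> are dual: trees of equal size have proportional weights.\<close>

lemma small_cluster_prob_dual:
  assumes "v \<in> V" "tree_like h v" "0 < p" "p < 1" "0 < r" "r < 1" "2 \<le> d"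
    and dual: "p * (1 - p) ^ (d - 2) = r * (1 - r) ^ (d - 2)"
  shows "p * subset_prob (\<lambda>_. p) V (\<lambda>U. card (cluster E {v} U) \<le> h) =
    ((1 - p) / (1 - r))\<^sup>2 * r * subset_prob (\<lambda>_. r) V (\<lambda>U. card (cluster E {v} U) \<le> h)"
proof -
  have vV: "{v} \<subseteq> V" using assms(1) by simp
  show ?thesis
    unfolding cluster_prob_eq_sum[OF vV, where P = "\<lambda>T. card T \<le> h"] sum_distrib_left
  proof (rule sum.cong[OF refl])
    fix T assume "T \<in> {T \<in> Pow V. cluster E {v} (T - {v}) = T \<and> card T \<le> h}"
    then have T: "T \<subseteq> V" "cluster E {v} (T - {v}) = T" "card T \<le> h" by auto
    have fT: "finite T" using T finite_V finite_subset by blast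
    have "v \<in> T" using cluster_source[of "{v}" E "T - {v}"] T(2) by auto
    then have c: "card T = Suc (card (T - {v}))" using fT by (metis card_Suc_Diff1)
    have "card (outer_boundary E T) + 2 * card T = d * card T + 2"
      by (rule card_boundary_tree_like[OF assms(2) T])
    then have m: "card (outer_boundary E T) = (d - 2) * card T + 2"
    proof -
      obtain k where "d = k + 2" using assms(7) by (metis le_add_diff_inverse2)
      then show ?thesis using \<open>card (outer_boundary E T) + 2 * card T = d * card T + 2\<close>
        by (simp add: algebra_simps)
    qed
    have w: "x * (x ^ card (T - {v}) * (1 - x) ^ card (outer_boundary E T)) =
        (x * (1 - x) ^ (d - 2)) ^ card T * (1 - x)\<^sup>2" for x :: real
      unfolding m power_add power_mult power_mult_distrib c by simp
    have "p * (p ^ card (T - {v}) * (1 - p) ^ card (outer_boundary E T)) =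
        ((1 - p) / (1 - r))\<^sup>2 * (r * (r ^ card (T - {v}) * (1 - r) ^ card (outer_boundary E T)))"
      unfolding w dual using assms(6) by (simp add: power_divide)
    then show "p * ((\<Prod>v\<in>T - {v}. p) * (\<Prod>v\<in>outer_boundary E T. 1 - p)) =
        ((1 - p) / (1 - r))\<^sup>2 * r * ((\<Prod>v\<in>T - {v}. r) * (\<Prod>v\<in>outer_boundary E T. 1 - r))"
      by (simp add: mult.assoc)
  qed
qed

text \<open>Comparison with a larger density \<open>q\<close>, which will be the critical one. Each
  vertex contributes the ratio \<rho> of \<open>t * (1 - t) ^ (d - 2)\<close> at the two densities.
  The upper bound on the boundary of connected sets points in the right direction because
  \<open>(1 - r) / (1 - q)\<close> is at least one.\<close>

lemma subcritical_cluster_prob: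
  assumes "v \<in> V" "0 < r" "r \<le> q" "q < 1" "2 \<le> d"
    and \<rho>: "\<rho> = r * (1 - r) ^ (d - 2) / (q * (1 - q) ^ (d - 2))" "\<rho> \<le> 1"
  shows "r * subset_prob (\<lambda>_. r) V (\<lambda>U. h < card (cluster E {v} U)) \<le> q * ((1 - r) / (1 - q))\<^sup>2 * \<rho> ^ h"
proof -
  have vV: "{v} \<subseteq> V" using assms(1) by simp
  have q0: "0 < q" using assms by simp
  have \<rho>0: "0 \<le> \<rho>" unfolding \<rho>(1) using assms q0 by simp
  have "subset_prob (\<lambda>_. r) V (\<lambda>U. h < card (cluster E {v} U)) \<le>
      (q / r * ((1 - r) / (1 - q))\<^sup>2 * \<rho> ^ h) * subset_prob (\<lambda>_. q) V (\<lambda>U. h < card (cluster E {v} U))"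
  proof (rule cluster_prob_compare[OF vV])
    fix T assume T: "{v} \<subseteq> T" "T \<subseteq> V" "cluster E {v} (T - {v}) = T" "h < card T"
    have fT: "finite T" using T finite_V finite_subset by blast
    then have c: "card T = Suc (card (T - {v}))" using T(1) by (metis card_Suc_Diff1 insert_subset)
    define m where "m = card (outer_boundary E T)"
    have "card (outer_boundary E T) + 2 * card T \<le> d * card T + 2"
      by (rule card_boundary_connected_le[OF T(2,3)])
    then have m: "m \<le> (d - 2) * card T + 2"
      unfolding m_def using assms(5) by (simp add: diff_mult_distrib)
    define s where "s = (1 - r) / (1 - q)"
    have s1: "1 \<le> s" unfolding s_def using assms by simp
    have \<rho>s: "\<rho> = (r / q) * s ^ (d - 2)" unfolding \<rho>(1) s_def by (simp add: power_divide)
    have "r ^ card (T - {v}) * (1 - r) ^ m = ((r / q) ^ card (T - {v}) * s ^ m) * (q ^ card (T - {v}) * (1 - q) ^ m)"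
      unfolding s_def using assms q0 by (simp add: power_divide)
    also have "\<dots> \<le> ((r / q) ^ card (T - {v}) * s ^ ((d - 2) * card T + 2)) * (q ^ card (T - {v}) * (1 - q) ^ m)"
      using assms q0 power_increasing[OF m s1] by (intro mult_right_mono mult_left_mono) auto
    also have "(r / q) ^ card (T - {v}) * s ^ ((d - 2) * card T + 2) = (q / r) * s\<^sup>2 * \<rho> ^ card T"
      unfolding \<rho>s power_add power_mult power_mult_distrib c using assms q0 by simp
    also have "(q / r) * s\<^sup>2 * \<rho> ^ card T \<le> (q / r) * s\<^sup>2 * \<rho> ^ h"
      using T(4) assms q0 \<rho>0 \<rho>(2) by (intro mult_left_mono power_decreasing) auto
    finally show "(\<Prod>v\<in>T - {v}. r) * (\<Prod>v\<in>outer_boundary E T. 1 - r)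
        \<le> (q / r * ((1 - r) / (1 - q))\<^sup>2 * \<rho> ^ h) * ((\<Prod>v\<in>T - {v}. q) * (\<Prod>v\<in>outer_boundary E T. 1 - q))"
      using assms q0 by (simp add: m_def s_def mult_right_mono)
  qed
  also have "\<dots> \<le> (q / r * ((1 - r) / (1 - q))\<^sup>2 * \<rho> ^ h) * 1"
    using assms q0 \<rho>0 by (intro mult_left_mono subset_prob_le_1 finite_V) (auto simp: prob_weights_def)
  finally have "r * subset_prob (\<lambda>_. r) V (\<lambda>U. h < card (cluster E {v} U))
      \<le> r * (q / r * ((1 - r) / (1 - q))\<^sup>2 * \<rho> ^ h)"
    using assms(2) by (intro mult_left_mono) auto
  then show ?thesis using assms(2) by simp
qed

section \<open>Rarity of short cycles and the expected number of large vertices\<close>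

lemma edges_in_Un_ge:
  assumes "A \<inter> B = {}" "s \<in> A" "z \<in> B" "{s, z} \<in> E"
  shows "edges_in E A + edges_in E B + 1 \<le> edges_in E (A \<union> B)"
proof -
  have fin: "finite (induced_edges E X)" for X using finite_E by (simp add: induced_edges_def)
  have "e \<noteq> {}" if "e \<in> induced_edges E A" for e using that edgeD[of e] by (auto simp: induced_edges_def)
  then have 1: "induced_edges E A \<inter> induced_edges E B = {}"
    using assms(1) unfolding induced_edges_def by blast
  have 2: "{s, z} \<notin> induced_edges E A \<union> induced_edges E B"
    using assms(1-3) by (auto simp: induced_edges_def)
  have "edges_in E A + edges_in E B + 1 = card (insert {s, z} (induced_edges E A \<union> induced_edges E B))"
    unfolding edges_in_def using fin 1 2 by (simp add: card_Un_disjoint)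
  also have "\<dots> \<le> edges_in E (A \<union> B)"
    unfolding edges_in_def using assms(2-4) by (intro card_mono fin) (auto simp: induced_edges_def)
  finally show ?thesis .
qed

text \<open>Following the walk from \<open>A\<close>, each new vertex is absorbed together with at
  least one edge. The step that enters \<open>B\<close> adds an edge but no vertex, which gives more
  edges than vertices.\<close>

lemma joined_cycles:
  assumes "A \<subseteq> V" "B \<subseteq> V" "A \<inter> B = {}" "card A \<le> edges_in E A" "card B \<le> edges_in E B"
    and "s \<in> A" "t \<in> B" "(s, t) \<in> {(x, y). {x, y} \<in> E} ^^ k"
  shows "\<exists>U\<subseteq>V. card U \<le> card A + card B + k \<and> card U < edges_in E U"
  using assms
proof (induction k arbitrary: s A)
  case 0
  then show ?case by auto
next
  case (Suc k)
  obtain z where z: "{s, z} \<in> E" "(z, t) \<in> {(x, y). {x, y} \<in> E} ^^ k"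
    using relpow_Suc_D2[OF Suc.prems(8)] by auto
  have fA: "finite A" using Suc.prems(1) finite_V finite_subset by blast
  consider "z \<in> B" | "z \<in> A" | "z \<notin> A" "z \<notin> B" by blast
  then show ?case
  proof cases
    case 1
    have "edges_in E A + edges_in E B + 1 \<le> edges_in E (A \<union> B)"
      by (rule edges_in_Un_ge[OF Suc.prems(3,6) 1 z(1)])
    then show ?thesis using Suc.prems(1,2,4,5) card_Un_le[of A B] by (intro exI[of _ "A \<union> B"]) auto
  next
    case 2
    then obtain U where "U \<subseteq> V" "card U \<le> card A + card B + k" "card U < edges_in E U"
      using Suc.IH[OF Suc.prems(1-5) 2 Suc.prems(7) z(2)] by blast
    then show ?thesis by (intro exI[of _ U]) auto
  next
    case 3
    have "{t \<in> A. {t, z} \<in> E} \<noteq> {}" using Suc.prems(6) z(1) by auto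
    then have "1 \<le> card {t \<in> A. {t, z} \<in> E}" using fA by (simp add: Suc_le_eq card_gt_0_iff)
    then have e: "card (insert z A) \<le> edges_in E (insert z A)"
      using edges_in_insert[OF 3(1)] Suc.prems(4) fA 3 by simp
    have "insert z A \<subseteq> V" using edge_pairD[OF z(1)] Suc.prems(1) by simp
    moreover have "insert z A \<inter> B = {}" using 3 Suc.prems(3) by simp
    ultimately obtain U where "U \<subseteq> V" "card U \<le> card (insert z A) + card B + k" "card U < edges_in E U"
      using Suc.IH[OF _ Suc.prems(2) _ e Suc.prems(5) _ Suc.prems(7) z(2)] by blast
    moreover have "card (insert z A) = card A + 1" using 3 fA by simp
    ultimately show ?thesis by (intro exI[of _ U]) auto
  qed
qed

text \<open>As long as a ball misses part of \<open>T\<close>, the next one contains a further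
  vertex of \<open>T\<close>.\<close>

lemma connected_subset_ball:
  assumes "T \<subseteq> V" "cluster E {v} (T - {v}) = T"
  shows "T \<subseteq> graph_ball E (card T) v"
proof -
  have fT: "finite T" using assms finite_V finite_subset by blast
  have vT: "v \<in> T" using cluster_source[of "{v}" E "T - {v}"] assms by auto
  have "T \<subseteq> graph_ball E j v \<or> j + 1 \<le> card (T \<inter> graph_ball E j v)" for j
  proof (induction j)
    case 0
    have "T \<inter> {v} = {v}" using vT by auto
    then show ?case by (simp add: graph_ball_0)
  next
    case (Suc j)
    show ?case
    proof (cases "T \<subseteq> graph_ball E j v")
      case True
      then show ?thesis using graph_ball_mono[of j "Suc j" E v] by auto
    next
      case False
      then have "T \<inter> graph_ball E j v \<noteq> T" by auto
      then obtain a z where az: "a \<in> T \<inter> graph_ball E j v" "z \<in> T - (T \<inter> graph_ball E j v)" "{a, z} \<in> E"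
        using connected_edge_leaving[of v "T \<inter> graph_ball E j v" T] assms(2) vT graph_ball_self[of v E j] by blast
      then have "insert z (T \<inter> graph_ball E j v) \<subseteq> T \<inter> graph_ball E (Suc j) v"
        unfolding graph_ball_Suc outer_boundary_def by blast
      then have "card (insert z (T \<inter> graph_ball E j v)) \<le> card (T \<inter> graph_ball E (Suc j) v)"
        using fT by (intro card_mono) auto
      moreover have "card (insert z (T \<inter> graph_ball E j v)) = card (T \<inter> graph_ball E j v) + 1"
        using az fT by simp
      ultimately show ?thesis using Suc False by simp
    qed
  qed
  from this[of "card T"] show ?thesis
    using card_mono[OF fT, of "T \<inter> graph_ball E (card T) v"] by auto
qed

text \<open>Short cycles are far apart by local sparsity, so the balls of radius \<open>m\<close> around the exceptional
  vertices overlap boundedly often.\<close>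

lemma card_not_tree_like:
  assumes sparse: "\<And>U. U \<subseteq> V \<Longrightarrow> card U \<le> 2 * (h + 1) + 2 * m \<Longrightarrow> edges_in E U \<le> card U"
    and grow: "\<And>T. T \<subseteq> V \<Longrightarrow> T \<noteq> {} \<Longrightarrow> card T \<le> m \<Longrightarrow> outer_boundary E T \<noteq> {}"
  shows "card {v \<in> V. \<not> tree_like h v} * (m + 1) \<le> card V * (d + 1) ^ (2 * (h + 1))"
proof -
  define N where "N = {v \<in> V. \<not> tree_like h v}"
  have fN: "finite N" using finite_V by (simp add: N_def)
  \<comment> \<open>If the sets witnessing the cycles at \<open>v\<close> and \<open>w\<close> were
    disjoint, joining them would violate sparsity. So they intersect, and \<open>v\<close> and
    \<open>w\<close> are within \<open>2 * (h + 1)\<close>, a bound that does not involve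
    \<open>m\<close>.\<close>
  have near: "w \<in> graph_ball E (2 * (h + 1)) v" if v: "v \<in> N" and w: "w \<in> N" and vw: "w \<in> graph_ball E (2 * m) v" for v w
  proof -
    obtain A where A: "A \<subseteq> V" "cluster E {v} (A - {v}) = A" "card A \<le> h + 1" "card A \<le> edges_in E A"
      using v unfolding N_def tree_like_def by (auto simp: not_less)
    obtain B where B: "B \<subseteq> V" "cluster E {w} (B - {w}) = B" "card B \<le> h + 1" "card B \<le> edges_in E B"
      using w unfolding N_def tree_like_def by (auto simp: not_less)
    have vA: "v \<in> A" using cluster_source[of "{v}" E "A - {v}"] A(2) by auto
    have wB: "w \<in> B" using cluster_source[of "{w}" E "B - {w}"] B(2) by auto
    have "A \<inter> B \<noteq> {}"
    proof
      assume AB: "A \<inter> B = {}"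
      obtain k where k: "k \<le> 2 * m" "(v, w) \<in> {(x, y). {x, y} \<in> E} ^^ k"
        using vw by (auto simp: graph_ball_def)
      obtain U where U: "U \<subseteq> V" "card U \<le> card A + card B + k" "card U < edges_in E U"
        using joined_cycles[OF A(1) B(1) AB A(4) B(4) vA wB k(2)] by blast
      have "card A + card B + k \<le> (h + 1) + (h + 1) + 2 * m"
        by (intro add_mono A(3) B(3) k(1))
      then have "card U \<le> 2 * (h + 1) + 2 * m" using U(2) by simp
      then show False using sparse[OF U(1)] U(3) by simp
    qed
    then obtain z where z: "z \<in> A" "z \<in> B" by auto
    have "z \<in> graph_ball E (h + 1) v"
      using connected_subset_ball[OF A(1,2)] graph_ball_mono[OF A(3), of E v] z by blast
    moreover have "z \<in> graph_ball E (h + 1) w"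
      using connected_subset_ball[OF B(1,2)] graph_ball_mono[OF B(3), of E w] z by blast
    ultimately have "w \<in> graph_ball E ((h + 1) + (h + 1)) v"
      using graph_ball_trans[of z E "h + 1" v w "h + 1"] graph_ball_sym by metis
    then show ?thesis by (simp only: mult_2)
  qed
  have ball_ge: "m + 1 \<le> card (graph_ball E m v)" if v: "v \<in> V" for v
  proof -
    have "j \<le> m \<Longrightarrow> j + 1 \<le> card (graph_ball E j v)" for j
    proof (induction j)
      case 0
      then show ?case by (simp add: graph_ball_0)
    next
      case (Suc j)
      show ?case
      proof (cases "card (graph_ball E j v) \<le> m")
        case True
        have "outer_boundary E (graph_ball E j v) \<noteq> {}"
          using grow[OF graph_ball_subset[OF v] _ True] graph_ball_self[of v E j] by blast
        then have "1 \<le> card (outer_boundary E (graph_ball E j v))"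
          using finite_outer_boundary by (simp add: Suc_le_eq card_gt_0_iff)
        then show ?thesis using Suc card_graph_ball_Suc[OF v, of j] by simp
      next
        case False
        then show ?thesis using Suc card_graph_ball_Suc[OF v, of j] by simp
      qed
    qed
    then show ?thesis by simp
  qed
  \<comment> \<open>Double count of the pairs of an exceptional vertex and a member of its ball of
    radius \<open>m\<close>. Exceptional vertices whose balls share a point all lie in one ball of
    radius \<open>2 * (h + 1)\<close>.\<close>
  have "card N * (m + 1) \<le> (\<Sum>v\<in>N. card (graph_ball E m v))"
    using sum_bounded_below[of N "m + 1" "\<lambda>v. card (graph_ball E m v)"] ball_ge by (simp add: N_def)
  also have "\<dots> = (\<Sum>v\<in>N. \<Sum>z\<in>V. of_bool (z \<in> graph_ball E m v))"
  proof (rule sum.cong[OF refl])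
    fix v assume "v \<in> N"
    then have "graph_ball E m v = {z \<in> V. z \<in> graph_ball E m v}"
      using graph_ball_subset[of v m] by (auto simp: N_def)
    then show "card (graph_ball E m v) = (\<Sum>z\<in>V. of_bool (z \<in> graph_ball E m v))"
      by (simp only: sum_of_bool_eq_card[OF finite_V])
  qed
  also have "\<dots> = (\<Sum>z\<in>V. \<Sum>v\<in>N. of_bool (z \<in> graph_ball E m v))"
    by (rule sum.swap)
  also have "\<dots> \<le> (\<Sum>z\<in>V. (d + 1) ^ (2 * (h + 1)))"
  proof (rule sum_mono)
    fix z assume "z \<in> V"
    have "card {v \<in> N. z \<in> graph_ball E m v} \<le> (d + 1) ^ (2 * (h + 1))"
    proof (cases "{v \<in> N. z \<in> graph_ball E m v} = {}")
      case True
      then show ?thesis by (simp only: card.empty)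
    next
      case False
      then obtain u where u: "u \<in> N" "z \<in> graph_ball E m u" by blast
      then have uV: "u \<in> V" by (simp add: N_def)
      have "{v \<in> N. z \<in> graph_ball E m v} \<subseteq> graph_ball E (2 * (h + 1)) u"
      proof
        fix w assume w: "w \<in> {v \<in> N. z \<in> graph_ball E m v}"
        then have "z \<in> graph_ball E m w" by simp
        then have "w \<in> graph_ball E m z" by (rule graph_ball_sym)
        then have "w \<in> graph_ball E (m + m) u" by (rule graph_ball_trans[OF u(2)])
        then show "w \<in> graph_ball E (2 * (h + 1)) u" using near[OF u(1)] w by (simp add: mult_2)
      qed
      then have "card {v \<in> N. z \<in> graph_ball E m v} \<le> card (graph_ball E (2 * (h + 1)) u)"
        by (rule card_mono[OF finite_graph_ball[OF uV]])
      also have "\<dots> \<le> (d + 1) ^ (2 * (h + 1))" by (rule card_graph_ball_le[OF uV])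
      finally show ?thesis .
    qed
    then show "(\<Sum>v\<in>N. of_bool (z \<in> graph_ball E m v)) \<le> (d + 1) ^ (2 * (h + 1))"
      by (simp only: sum_of_bool_eq_card[OF fN])
  qed
  finally show ?thesis by (simp only: N_def sum_constant of_nat_id)
qed

text \<open>For \<open>k = 0\<close> the cluster bound says that a cluster stays below
  \<open>M\<close> with probability at most \<open>1 / (\<beta> * p)\<close>. This cruder estimate
  supplies the linear threshold \<open>c\<close>, uniformly in \<delta>.\<close>

lemma expected_large_vertices_ge:
  assumes "1 < \<beta>" "1 / \<beta> \<le> p" "p \<le> 1" "ln (\<beta> * p) \<le> \<beta> * p - 1"
    and growth: "\<And>T. T \<subseteq> V \<Longrightarrow> real (card T) < M \<Longrightarrow> (\<beta> - 1) * real (card T) \<le> real (card (outer_boundary E T))"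
  shows "(p - 1 / \<beta>) * real (card V) \<le> subset_exp (\<lambda>_. p) V (\<lambda>U. real (card (large_vertices M U)))"
proof -
  have p0: "0 < p" using assms(1,2) by (smt (verit) divide_pos_pos)
  have "p - 1 / \<beta> \<le> p * (1 - subset_prob (\<lambda>_. p) V (\<lambda>U. real (card (cluster E {v} U)) < M))" if v: "v \<in> V" for v
  proof -
    have "subset_prob (\<lambda>_. p) V (\<lambda>U. 0 \<le> real (card (cluster E {v} U)) \<and> real (card (cluster E {v} U)) < M)
      \<le> exp (- ((\<beta> * p - 1 - ln (\<beta> * p)) * 0)) / (\<beta> * p)"
      by (rule midsize_cluster_prob[OF v assms(1,2) order_refl assms(3) _ _ growth]) (use assms(4) in auto)
    then have "p * subset_prob (\<lambda>_. p) V (\<lambda>U. real (card (cluster E {v} U)) < M) \<le> p * (1 / (\<beta> * p))"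
      using p0 by (intro mult_left_mono) auto
    then show ?thesis using p0 by (simp add: algebra_simps)
  qed
  then have "(\<Sum>v\<in>V. p - 1 / \<beta>) \<le> (\<Sum>v\<in>V. p * (1 - subset_prob (\<lambda>_. p) V (\<lambda>U. real (card (cluster E {v} U)) < M)))"
    by (rule sum_mono)
  then show ?thesis unfolding expected_large_vertices by (simp add: mult.commute)
qed

text \<open>Clusters below \<open>M\<close> are split at size \<open>h\<close>. Those of at most
  \<open>h\<close> vertices are computed at the dual density \<open>r\<close>, where small clusters
  have probability close to one, so they contribute about \<open>\<kappa> * r\<close>; those between
  \<open>h\<close> and \<open>M\<close> are exponentially rare. A vertex that is not tree-like
  contributes an error of at most one.\<close>

lemma expected_large_vertices_approx:
  assumes "1 < \<beta>" "1 / \<beta> \<le> p" "p < 1" "ln (\<beta> * p) \<le> \<beta> * p - 1" "real h < M"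
    and growth: "\<And>T. T \<subseteq> V \<Longrightarrow> real (card T) < M \<Longrightarrow> (\<beta> - 1) * real (card T) \<le> real (card (outer_boundary E T))"
    and "0 < r" "r \<le> q" "q < 1" "2 \<le> d"
    and dual: "p * (1 - p) ^ (d - 2) = r * (1 - r) ^ (d - 2)"
    and \<rho>: "\<rho> = r * (1 - r) ^ (d - 2) / (q * (1 - q) ^ (d - 2))" "\<rho> \<le> 1"
    and \<kappa>: "\<kappa> = ((1 - p) / (1 - r))\<^sup>2"
    and x: "x = p - \<kappa> * r" "0 \<le> x" "x \<le> 1"
  shows "\<bar>subset_exp (\<lambda>_. p) V (\<lambda>U. real (card (large_vertices M U))) - x * real (card V)\<bar> \<le>
    (\<kappa> * (q * ((1 - r) / (1 - q))\<^sup>2) * \<rho> ^ h + exp (- ((\<beta> * p - 1 - ln (\<beta> * p)) * real h))) * real (card V)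
    + real (card {v \<in> V. \<not> tree_like h v})"
proof -
  let ?P = "subset_prob (\<lambda>_. p) V" and ?R = "subset_prob (\<lambda>_. r) V"
  let ?t = "\<lambda>v. p * (1 - ?P (\<lambda>U. real (card (cluster E {v} U)) < M))"
  let ?e1 = "\<kappa> * (q * ((1 - r) / (1 - q))\<^sup>2) * \<rho> ^ h"
  let ?e2 = "exp (- ((\<beta> * p - 1 - ln (\<beta> * p)) * real h))"
  have p0: "0 < p" using assms(1,2) by (smt (verit) divide_pos_pos)
  have \<beta>p: "1 \<le> \<beta> * p" using assms(1,2) by (simp add: field_simps)
  have \<kappa>0: "0 \<le> \<kappa>" unfolding \<kappa> by simp
  have q0: "0 < q" using assms by simp
  have \<rho>0: "0 \<le> \<rho>" unfolding \<rho>(1) using assms q0 by simp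
  have pw: "prob_weights (\<lambda>_. p) V" "prob_weights (\<lambda>_. r) V" using p0 assms by (auto simp: prob_weights_def)
  have e: "0 \<le> ?e1" "0 \<le> ?e2" using \<kappa>0 q0 \<rho>0 by auto
  have t: "\<bar>?t v - x\<bar> \<le> ?e1 + ?e2 + of_bool (\<not> tree_like h v)" if v: "v \<in> V" for v
  proof (cases "tree_like h v")
    case False
    have "0 \<le> ?P (\<lambda>U. real (card (cluster E {v} U)) < M)" by (rule subset_prob_nonneg[OF pw(1)])
    moreover have "?P (\<lambda>U. real (card (cluster E {v} U)) < M) \<le> 1" by (rule subset_prob_le_1[OF finite_V pw(1)])
    ultimately have "0 \<le> ?t v" "?t v \<le> 1" using p0 assms(3) by (auto intro: mult_le_one)
    moreover have ob: "of_bool (\<not> tree_like h v) = (1 :: real)" using False by simp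
    ultimately show ?thesis unfolding ob using x(2,3) e by linarith
  next
    case True
    define A where "A = ?P (\<lambda>U. card (cluster E {v} U) \<le> h)"
    define B where "B = ?P (\<lambda>U. h < card (cluster E {v} U) \<and> real (card (cluster E {v} U)) < M)"
    define C where "C = ?R (\<lambda>U. h < card (cluster E {v} U))"
    have "?P (\<lambda>U. real (card (cluster E {v} U)) < M) = A + B"
      unfolding A_def B_def subset_prob_def subset_exp_add[symmetric]
      by (rule subset_exp_cong) (use assms(5) in \<open>auto simp: of_bool_def\<close>)
    then have tv: "?t v = p - p * A - p * B" by (simp add: algebra_simps)
    have "?R (\<lambda>U. card (cluster E {v} U) \<le> h) = 1 - C"
      unfolding C_def using subset_prob_not[OF finite_V, of "\<lambda>_. r" "\<lambda>U. h < card (cluster E {v} U)"]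
      by (simp add: not_less)
    then have "p * A = \<kappa> * r * (1 - C)"
      unfolding A_def \<kappa> using small_cluster_prob_dual[OF v True p0 assms(3,7) _ assms(10) dual] assms(8,9) by simp
    then have eq: "?t v - x = \<kappa> * (r * C) - p * B" unfolding tv x(1) by (simp add: algebra_simps)
    have "r * C \<le> (q * ((1 - r) / (1 - q))\<^sup>2) * \<rho> ^ h"
      unfolding C_def by (rule subcritical_cluster_prob[OF v assms(7-10) \<rho>])
    then have C1: "\<kappa> * (r * C) \<le> ?e1" using mult_left_mono[OF _ \<kappa>0] by (simp add: mult.assoc)
    have C0: "0 \<le> \<kappa> * (r * C)" using \<kappa>0 assms(7) subset_prob_nonneg[OF pw(2)] by (simp add: C_def)
    have B0: "0 \<le> B" unfolding B_def by (rule subset_prob_nonneg[OF pw(1)])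
    have "B \<le> ?P (\<lambda>U. real h \<le> real (card (cluster E {v} U)) \<and> real (card (cluster E {v} U)) < M)"
      unfolding B_def by (rule subset_prob_mono[OF pw(1)]) auto
    also have "\<dots> \<le> ?e2 / (\<beta> * p)"
      by (rule midsize_cluster_prob[OF v assms(1,2) order_refl _ _ _ growth]) (use assms(3,4) in auto)
    also have "\<dots> \<le> ?e2 / 1" using \<beta>p by (intro divide_left_mono) auto
    finally have B1: "B \<le> ?e2" by simp
    have "p * B \<le> 1 * ?e2" by (rule mult_mono[OF _ B1]) (use assms(3) B0 in auto)
    moreover have "0 \<le> p * B" using p0 B0 by simp
    moreover have ob: "of_bool (\<not> tree_like h v) = (0 :: real)" using True by simp
    ultimately show ?thesis unfolding ob using eq C0 C1 e by linarith
  qed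
  have "subset_exp (\<lambda>_. p) V (\<lambda>U. real (card (large_vertices M U))) - x * real (card V) = (\<Sum>v\<in>V. ?t v - x)"
    unfolding expected_large_vertices by (simp add: sum_subtractf mult.commute)
  also have "\<bar>\<dots>\<bar> \<le> (\<Sum>v\<in>V. \<bar>?t v - x\<bar>)" by (rule sum_abs)
  also have "\<dots> \<le> (\<Sum>v\<in>V. ?e1 + ?e2 + of_bool (\<not> tree_like h v))" by (rule sum_mono) (rule t)
  also have "\<dots> = (?e1 + ?e2) * real (card V) + (\<Sum>v\<in>V. of_bool (\<not> tree_like h v))"
    by (simp add: sum.distrib mult.commute del: sum_of_bool_eq)
  also have "(\<Sum>v\<in>V. of_bool (\<not> tree_like h v)) = real (card {v \<in> V. \<not> tree_like h v})"
    using arg_cong[OF sum_of_bool_eq_card[OF finite_V, of "\<lambda>v. \<not> tree_like h v"], of real]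
    by (simp only: of_nat_sum of_nat_of_bool)
  finally show ?thesis .
qed

end

subsection \<open>Two-round exposure\<close>

context finite_regular_graph
begin

text \<open>Two cutoffs cooperate: a component above \<open>K * ln n\<close> has at least
  \<open>M\<close> vertices by the gap, and clusters of size at least \<open>k0\<close> coincide. As
  \<open>k0 \<le> M\<close>, the large vertices form a single component.\<close>

lemma unique_giantI:
  assumes "U \<subseteq> V" "k0 \<le> M" "K * ln (real (card V)) < c * real (card V)" "0 < c * real (card V)"
    and merged: "\<And>v w. v \<in> large_vertices k0 U \<Longrightarrow> w \<in> large_vertices k0 U \<Longrightarrow> w \<in> cluster E {v} U"
    and mid: "\<And>v. v \<in> U \<Longrightarrow> \<not> (K * ln (real (card V)) \<le> real (card (cluster E {v} U)) \<and> real (card (cluster E {v} U)) < M)"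
    and size: "c * real (card V) \<le> real (card (large_vertices M U))"
      "\<bar>real (card (large_vertices M U)) - x * real (card V)\<bar> \<le> \<epsilon> * (x * real (card V))"
  shows "unique_giant c x \<epsilon> K V E U"
proof -
  let ?L = "large_vertices M U"
  have "?L \<noteq> {}" using size(1) assms(4) by auto
  then obtain v where v: "v \<in> ?L" by blast
  then have vU: "v \<in> U" and cv: "M \<le> real (card (cluster E {v} U))" by (auto simp: large_vertices_def)
  have sub: "?L \<subseteq> large_vertices k0 U" using assms(2) by (auto simp: large_vertices_def)
  have L: "cluster E {v} U = ?L"
  proof
    show "?L \<subseteq> cluster E {v} U" using merged v sub by blast
    show "cluster E {v} U \<subseteq> ?L"
    proof
      fix w assume w: "w \<in> cluster E {v} U"
      have "cluster E {w} U = cluster E {v} U" by (rule cluster_eq[OF vU w])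
      moreover have "w \<in> U" using cluster_subset[of E "{v}" U] w vU by auto
      ultimately show "w \<in> ?L" using cv by (auto simp: large_vertices_def)
    qed
  qed
  have comps: "components U (induced_edges E U) = (\<lambda>v. cluster E {v} U) ` U"
    by (rule components_eq_clusters)
  have Lc: "?L \<in> components U (induced_edges E U)" unfolding comps using vU L by blast
  have others: "real (card L') \<le> K * ln (real (card V))"
    if L': "L' \<in> components U (induced_edges E U)" "L' \<noteq> ?L" for L'
  proof -
    obtain w where w: "w \<in> U" "L' = cluster E {w} U" using L'(1) unfolding comps by blast
    have "\<not> M \<le> real (card L')"
    proof
      assume "M \<le> real (card L')"
      then have "w \<in> ?L" using w by (simp add: large_vertices_def)
      then have "w \<in> cluster E {v} U" using L by simp
      then have "cluster E {w} U = cluster E {v} U" by (rule cluster_eq[OF vU])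
      then show False using L'(2) L w by simp
    qed
    then show ?thesis using mid[OF w(1)] w(2) by auto
  qed
  have "{L' \<in> components U (induced_edges E U). real (card L') \<ge> c * real (card V)} = {?L}"
  proof
    show "{L' \<in> components U (induced_edges E U). real (card L') \<ge> c * real (card V)} \<subseteq> {?L}"
      using others assms(3) by force
    show "{?L} \<subseteq> {L' \<in> components U (induced_edges E U). real (card L') \<ge> c * real (card V)}"
      using Lc size(1) by simp
  qed
  then show ?thesis unfolding unique_giant_def using size(2) others by blast
qed

text \<open>The law of an intermediate set of the sprinkling: density \<open>p\<close> where the
  second set has been revealed, \<open>p1\<close> elsewhere.\<close>

lemma subset_exp_partial_union:
  assumes "1 - p = (1 - p1) * (1 - p2)"
  shows "subset_exp (\<lambda>_. p1) V (\<lambda>X. subset_exp (\<lambda>_. p2) V (\<lambda>Y. f (X \<union> (Y \<inter> A)))) =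
    subset_exp (\<lambda>v. if v \<in> A then p else p1) V f"
proof -
  have "subset_exp (\<lambda>_. p2) V (\<lambda>Y. f (X \<union> (Y \<inter> A))) = subset_exp (\<lambda>v. if v \<in> A then p2 else 0) V (\<lambda>Y. f (X \<union> Y))" for X
    using subset_exp_restrict[OF finite_V, of "\<lambda>_. p2" "\<lambda>Y. f (X \<union> Y)" A] by simp
  then show ?thesis
    using subset_exp_coupling[OF finite_V, of "\<lambda>v. if v \<in> A then p else p1" "\<lambda>_. p1" "\<lambda>v. if v \<in> A then p2 else 0" f] assms
    by simp
qed

text \<open>Sprinkling: the density \<open>p\<close> is reached from \<open>p1\<close> by adding the vertices of an independent second
  set one at a time. As no intermediate set has clusters of size between \<open>k\<close> and \<open>M\<close>, every cluster of
  size at least \<open>k\<close> contains a large cluster of the first round, and those are merged by the second.\<close>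

lemma unmerged_clusters_prob:
  assumes "1 - p = (1 - p1) * (1 - p2)" "0 \<le> p2" "p2 \<le> 1" "p1 \<le> p" "p \<le> 1"
    and "1 < \<beta>" "1 / \<beta> \<le> p1" "0 \<le> \<beta> * p1 - 1 - ln (\<beta> * p)"
    and "0 \<le> k" "1 + real d * k < M" "0 \<le> s" "s \<le> \<beta> ^ R" "0 < d"
    and M2: "(real d + 1) * (s + 1) * (1 + real d * M) + 1 \<le> M2"
    and growth: "\<And>T. T \<subseteq> V \<Longrightarrow> real (card T) < M2 \<Longrightarrow> (\<beta> - 1) * real (card T) \<le> real (card (outer_boundary E T))"
    and "edge_expanding b V E" "0 \<le> b" "0 \<le> \<theta>"
    and \<theta>: "\<theta> * real ((2 * (R + 1) + 2) * (d * (d + 1) ^ (R + 1))) \<le> b * p2 ^ (2 * (R + 1) + 2)"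
  shows "subset_prob (\<lambda>_. p) V (\<lambda>U. \<exists>v\<in>large_vertices k U. \<exists>w\<in>large_vertices k U. w \<notin> cluster E {v} U)
    \<le> real (card V) * exp (- ((\<beta> * p1 - 1) * s))
      + (real (card V) + 1) * (real (card V) * exp (- ((\<beta> * p1 - 1 - ln (\<beta> * p)) * k)))
      + 2 * ((1 + exp (- \<theta> * M)) ^ card V - 1)"
proof -
  define n where "n = card V"
  let ?E1 = "subset_exp (\<lambda>_. p1) V" and ?E2 = "subset_exp (\<lambda>_. p2) V"
  have p1: "0 \<le> p1" "p1 \<le> 1" using assms(4-7) by (smt (verit) divide_nonneg_nonneg)+
  have pw1: "prob_weights (\<lambda>_. p1) V" and pw2: "prob_weights (\<lambda>_. p2) V"
    using p1 assms(2,3) by (auto simp: prob_weights_def)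
  have M0: "0 \<le> M" using assms(9,10) by (smt (verit) mult_nonneg_nonneg of_nat_0_le_iff)
  have MM2: "M \<le> M2"
  proof -
    have "1 * 1 * (real d * M) \<le> (real d + 1) * (s + 1) * (1 + real d * M)"
      using assms(11) M0 by (intro mult_mono) auto
    moreover have "1 * M \<le> real d * M" using assms(13) M0 by (intro mult_right_mono) auto
    ultimately show ?thesis using M2 by simp
  qed
  obtain f where f: "bij_betw f {..<n} V"
    using ex_bij_betw_nat_finite[OF finite_V] unfolding n_def atLeast0LessThan by blast
  \<comment> \<open>Prefixes of an enumeration of \<open>V\<close>, so that
    \<open>X \<union> (Y \<inter> A i)\<close> runs from \<open>X\<close> to
    \<open>X \<union> Y\<close> and gains at most one vertex per step.\<close>
  define A where "A i = f ` {..<i}" for i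
  have A0: "A 0 = {}" and ASuc: "A (Suc i) = insert (f i) (A i)" and An: "A n = V" for i
    using f unfolding A_def bij_betw_def by (auto simp: lessThan_Suc)
  \<comment> \<open>The three failures: a vertex with no large first-round cluster nearby, an
    intermediate set with a cluster in the gap, and two large first-round clusters left apart by the
    second set.\<close>
  define F1 where "F1 X \<longleftrightarrow> (\<exists>v\<in>V. \<forall>w\<in>graph_ball E (R + 1) v \<inter> X. real (card (cluster E {w} X)) < M)" for X
  define mid where "mid U \<longleftrightarrow> (\<exists>v\<in>V. v \<in> U \<and> k \<le> real (card (cluster E {v} U)) \<and> real (card (cluster E {v} U)) < M)" for U
  define F2 where "F2 X Y \<longleftrightarrow> (\<exists>i\<in>{..n}. mid (X \<union> (Y \<inter> A i)))" for X Y
  define F3 where "F3 X Y \<longleftrightarrow> (\<exists>v\<in>large_vertices M X. \<exists>w\<in>large_vertices M X. w \<notin> cluster E {v} (X \<union> Y))" for X Y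
  let ?bad = "\<lambda>U. \<exists>v\<in>large_vertices k U. \<exists>w\<in>large_vertices k U. w \<notin> cluster E {v} U"
  have cover: "F1 X \<or> F2 X Y \<or> \<not> F1 X \<and> F3 X Y" if XY: "X \<subseteq> V" "Y \<subseteq> V" and bad: "?bad (X \<union> Y)" for X Y
  proof (rule ccontr)
    assume neg: "\<not> ?thesis"
    define U where "U i = X \<union> (Y \<inter> A i)" for i
    have U0: "U 0 = X" and Un: "U n = X \<union> Y" using XY by (auto simp: U_def A0 An)
    have UV: "U i \<subseteq> V" for i using XY by (auto simp: U_def)
    have step: "U (Suc i) = U i \<or> (\<exists>z\<in>V. U (Suc i) = insert z (U i))" for i
    proof (cases "f i \<in> Y")
      case True
      then have "U (Suc i) = insert (f i) (U i)" by (auto simp: U_def ASuc)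
      then show ?thesis using True XY by auto
    next
      case False
      then show ?thesis by (auto simp: U_def ASuc)
    qed
    have nomid: "\<not> (k \<le> real (card (cluster E {v} (U i))) \<and> real (card (cluster E {v} (U i))) < M)"
      if "i \<le> n" "v \<in> U i" for i v
    proof -
      have "\<not> mid (U i)" using neg that(1) unfolding F2_def U_def by auto
      then show ?thesis using that(2) UV[of i] unfolding mid_def by blast
    qed
    have desc: "\<exists>w\<in>large_vertices M X. w \<in> X \<and> w \<in> cluster E {v} (X \<union> Y)" if v: "v \<in> large_vertices k (X \<union> Y)" for v
    proof -
      have "v \<in> U n" "k \<le> real (card (cluster E {v} (U n)))"
        using v unfolding Un large_vertices_def by auto
      then have "\<exists>w\<in>U 0 \<inter> cluster E {v} (U n). M \<le> real (card (cluster E {w} (U 0)))"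
        using large_cluster_descends[OF assms(9,10), of n U] step nomid by blast
      then show ?thesis unfolding U0 Un large_vertices_def by blast
    qed
    obtain v w where vw: "v \<in> large_vertices k (X \<union> Y)" "w \<in> large_vertices k (X \<union> Y)" "w \<notin> cluster E {v} (X \<union> Y)"
      using bad by blast
    obtain v' where v': "v' \<in> large_vertices M X" "v' \<in> X" "v' \<in> cluster E {v} (X \<union> Y)" using desc[OF vw(1)] by blast
    obtain w' where w': "w' \<in> large_vertices M X" "w' \<in> X" "w' \<in> cluster E {w} (X \<union> Y)" using desc[OF vw(2)] by blast
    have "w' \<in> cluster E {v'} (X \<union> Y)" using neg v'(1) w'(1) unfolding F3_def by blast
    then have 1: "w' \<in> cluster E {v} (X \<union> Y)" using cluster_trans[OF v'(3)] by blast
    have "w \<in> X \<union> Y" using vw(2) by (auto simp: large_vertices_def)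
    then have "w \<in> cluster E {w'} (X \<union> Y)" using w'(3) by (rule cluster_sym)
    then show False using cluster_trans[OF 1] vw(3) by blast
  qed
  have "subset_prob (\<lambda>_. p) V ?bad = ?E1 (\<lambda>X. ?E2 (\<lambda>Y. of_bool (?bad (X \<union> Y))))"
    unfolding subset_prob_def using assms(1) by (intro subset_exp_coupling[symmetric] finite_V)
  \<comment> \<open>The factor for \<open>\<not> F1 X\<close> is kept since the merging bound is
    available only for first-round sets with large clusters near every vertex.\<close>
  also have "\<dots> \<le> ?E1 (\<lambda>X. ?E2 (\<lambda>Y. of_bool (F1 X) + (of_bool (F2 X Y) + of_bool (\<not> F1 X) * of_bool (F3 X Y))))"
  proof (intro subset_exp_mono[OF pw1] subset_exp_mono[OF pw2])
    fix X Y assume "X \<subseteq> V" "Y \<subseteq> V"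
    then show "of_bool (?bad (X \<union> Y)) \<le> (of_bool (F1 X) + (of_bool (F2 X Y) + of_bool (\<not> F1 X) * of_bool (F3 X Y)) :: real)"
      using cover[of X Y] by (cases "?bad (X \<union> Y)") (auto simp del: of_bool_eq_0_iff)
  qed
  also have "\<dots> = subset_prob (\<lambda>_. p1) V F1 + (?E1 (\<lambda>X. ?E2 (\<lambda>Y. of_bool (F2 X Y)))
      + ?E1 (\<lambda>X. of_bool (\<not> F1 X) * subset_prob (\<lambda>_. p2) V (F3 X)))"
    unfolding subset_exp_add subset_exp_cmult subset_exp_const[OF finite_V] subset_prob_def ..
  also have "\<dots> \<le> real n * exp (- ((\<beta> * p1 - 1) * s))
      + ((real n + 1) * (real n * exp (- ((\<beta> * p1 - 1 - ln (\<beta> * p)) * k)))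
      + 2 * ((1 + exp (- \<theta> * M)) ^ n - 1))"
  proof (intro add_mono)
    have "subset_prob (\<lambda>_. p1) V F1 \<le>
        (\<Sum>v\<in>V. subset_prob (\<lambda>_. p1) V (\<lambda>X. \<forall>w\<in>graph_ball E (R + 1) v \<inter> X. real (card (cluster E {w} X)) < M))"
      unfolding F1_def by (rule subset_prob_Ex[OF pw1 finite_V])
    also have "\<dots> \<le> (\<Sum>v\<in>V. exp (- ((\<beta> * p1 - 1) * s)))"
      by (rule sum_mono) (rule near_large_cluster_prob[OF _ assms(6,7) p1(2) M0 assms(11,12) M2 growth])
    finally show "subset_prob (\<lambda>_. p1) V F1 \<le> real n * exp (- ((\<beta> * p1 - 1) * s))" by (simp add: n_def)
    have mid_prob: "subset_prob (\<lambda>v. if v \<in> A i then p else p1) V mid \<le> real n * exp (- ((\<beta> * p1 - 1 - ln (\<beta> * p)) * k))" for i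
    proof -
      let ?\<pi> = "\<lambda>v. if v \<in> A i then p else p1"
      have \<pi>: "p1 \<le> ?\<pi> v \<and> ?\<pi> v \<le> p" for v using assms(4) by simp
      have pw: "prob_weights ?\<pi> V" using \<pi> p1 assms(5) by (auto simp: prob_weights_def intro: order_trans)
      have \<beta>p: "1 \<le> \<beta> * p"
      proof -
        have "1 \<le> \<beta> * p1" using assms(6,7) by (simp add: field_simps)
        also have "\<dots> \<le> \<beta> * p" using assms(4,6) by simp
        finally show ?thesis .
      qed
      have "subset_prob ?\<pi> V mid \<le> (\<Sum>v\<in>V. subset_prob ?\<pi> V (\<lambda>U. v \<in> U \<and> k \<le> real (card (cluster E {v} U)) \<and> real (card (cluster E {v} U)) < M))"
        unfolding mid_def by (rule subset_prob_Ex[OF pw finite_V])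
      also have "\<dots> \<le> (\<Sum>v\<in>V. exp (- ((\<beta> * p1 - 1 - ln (\<beta> * p)) * k)))"
      proof (rule sum_mono)
        fix v assume v: "v \<in> V"
        have "subset_prob ?\<pi> V (\<lambda>U. v \<in> U \<and> k \<le> real (card (cluster E {v} U)) \<and> real (card (cluster E {v} U)) < M)
          \<le> subset_prob ?\<pi> V (\<lambda>U. k \<le> real (card (cluster E {v} U)) \<and> real (card (cluster E {v} U)) < M)"
          by (rule subset_prob_mono[OF pw]) auto
        also have "\<dots> \<le> exp (- ((\<beta> * p1 - 1 - ln (\<beta> * p)) * k)) / (\<beta> * p)"
          by (rule midsize_cluster_prob[OF v assms(6,7,4,5) \<pi> assms(8)]) (use growth MM2 in auto)
        also have "\<dots> \<le> exp (- ((\<beta> * p1 - 1 - ln (\<beta> * p)) * k)) / 1"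
          using \<beta>p by (intro divide_left_mono) auto
        finally show "subset_prob ?\<pi> V (\<lambda>U. v \<in> U \<and> k \<le> real (card (cluster E {v} U)) \<and> real (card (cluster E {v} U)) < M)
          \<le> exp (- ((\<beta> * p1 - 1 - ln (\<beta> * p)) * k))" by simp
      qed
      finally show ?thesis by (simp add: n_def)
    qed
    have "?E1 (\<lambda>X. ?E2 (\<lambda>Y. of_bool (F2 X Y))) \<le> ?E1 (\<lambda>X. ?E2 (\<lambda>Y. \<Sum>i\<in>{..n}. of_bool (mid (X \<union> (Y \<inter> A i)))))"
    proof (intro subset_exp_mono[OF pw1] subset_exp_mono[OF pw2])
      fix X Y
      show "of_bool (F2 X Y) \<le> (\<Sum>i\<in>{..n}. of_bool (mid (X \<union> (Y \<inter> A i))) :: real)"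
      proof (cases "F2 X Y")
        case True
        then obtain i where i: "i \<in> {..n}" "mid (X \<union> (Y \<inter> A i))" unfolding F2_def by blast
        have "(1 :: real) = of_bool (mid (X \<union> (Y \<inter> A i)))" using i by simp
        also have "\<dots> \<le> (\<Sum>i\<in>{..n}. of_bool (mid (X \<union> (Y \<inter> A i))) :: real)"
          by (rule member_le_sum[OF i(1)]) auto
        finally show ?thesis using True by simp
      qed (simp add: sum_nonneg)
    qed
    also have "\<dots> = (\<Sum>i\<in>{..n}. subset_prob (\<lambda>v. if v \<in> A i then p else p1) V mid)"
      unfolding subset_exp_sum subset_prob_def
      by (intro sum.cong refl subset_exp_partial_union[OF assms(1)])
    also have "\<dots> \<le> (\<Sum>i\<in>{..n}. real n * exp (- ((\<beta> * p1 - 1 - ln (\<beta> * p)) * k)))"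
      by (rule sum_mono) (rule mid_prob)
    finally show "?E1 (\<lambda>X. ?E2 (\<lambda>Y. of_bool (F2 X Y))) \<le> (real n + 1) * (real n * exp (- ((\<beta> * p1 - 1 - ln (\<beta> * p)) * k)))"
      by (simp add: algebra_simps)
    show "?E1 (\<lambda>X. of_bool (\<not> F1 X) * subset_prob (\<lambda>_. p2) V (F3 X)) \<le> 2 * ((1 + exp (- \<theta> * M)) ^ n - 1)"
    proof (rule subset_exp_le_const[OF finite_V pw1])
      fix X assume X: "X \<subseteq> V"
      show "of_bool (\<not> F1 X) * subset_prob (\<lambda>_. p2) V (F3 X) \<le> 2 * ((1 + exp (- \<theta> * M)) ^ n - 1)"
      proof (cases "F1 X")
        case True
        have "1 \<le> (1 + exp (- \<theta> * M)) ^ n" by (rule one_le_power) simp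
        then show ?thesis using True by simp
      next
        case False
        have near: "graph_ball E (R + 1) v \<inter> large_vertices M X \<noteq> {}" if "v \<in> V" for v
        proof -
          obtain w where "w \<in> graph_ball E (R + 1) v \<inter> X" "\<not> real (card (cluster E {w} X)) < M"
            using False \<open>v \<in> V\<close> unfolding F1_def by blast
          then show ?thesis unfolding large_vertices_def by (auto simp: not_less)
        qed
        have "subset_prob (\<lambda>_. p2) V (F3 X) \<le> 2 * ((1 + exp (- \<theta> * M)) ^ n - 1)"
          unfolding F3_def n_def
          by (rule unmerged_prob[OF assms(16,17) X assms(2,3,18) M0 assms(13) large_vertices_def near \<theta>])
        then show ?thesis using False by simp
      qed
    qed
  qed
  finally show ?thesis unfolding n_def by (simp only: add.assoc)
qed

end

subsection \<open>Dual densities and choice of parameters\<close>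

lemma mult_power_has_derivative:
  fixes t :: real
  shows "((\<lambda>t. t * (1 - t) ^ Suc k) has_real_derivative (1 - t) ^ k * (1 - (real k + 2) * t)) (at t)"
proof -
  have "((\<lambda>t. 1 - t) has_real_derivative - 1) (at t)" by (auto intro!: derivative_eq_intros)
  from DERIV_mult[OF DERIV_ident DERIV_power_Suc[OF this, of k]] show ?thesis
    by (simp add: algebra_simps)
qed

text \<open>With \<open>d = k + 3\<close>, the weight \<open>t * (1 - t) ^ (d - 2)\<close> increases
  up to the critical density \<open>1 / (d - 1)\<close> and decreases afterwards, so a supercritical
  density below one has exactly one dual on the left.\<close>

lemma mult_power_less_left:
  fixes s t :: real
  assumes "0 \<le> s" "s < t" "t \<le> 1 / (real k + 2)"
  shows "s * (1 - s) ^ Suc k < t * (1 - t) ^ Suc k"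
proof (rule DERIV_pos_imp_increasing_open[OF assms(2)])
  fix x assume x: "s < x" "x < t"
  have "x < 1 / (real k + 2)" using x assms by simp
  then have 1: "0 < 1 - (real k + 2) * x" by (simp add: field_simps)
  have "1 / (real k + 2) \<le> 1" by simp
  then have "0 < 1 - x" using \<open>x < 1 / (real k + 2)\<close> by linarith
  then have "0 < (1 - x) ^ k * (1 - (real k + 2) * x)" using 1 by simp
  then show "\<exists>y. ((\<lambda>t. t * (1 - t) ^ Suc k) has_real_derivative y) (at x) \<and> 0 < y"
    using mult_power_has_derivative by blast
qed (intro continuous_intros)

lemma mult_power_less_right:
  fixes s t :: real
  assumes "1 / (real k + 2) \<le> s" "s < t" "t \<le> 1"
  shows "t * (1 - t) ^ Suc k < s * (1 - s) ^ Suc k"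
proof (rule DERIV_neg_imp_decreasing_open[OF assms(2)])
  fix x assume x: "s < x" "x < t"
  have "1 / (real k + 2) < x" using x assms by simp
  then have 1: "1 - (real k + 2) * x < 0" by (simp add: field_simps)
  have "0 < 1 - x" using x assms by simp
  then have "(1 - x) ^ k * (1 - (real k + 2) * x) < 0" using 1 by (simp add: mult_pos_neg)
  then show "\<exists>y. ((\<lambda>t. t * (1 - t) ^ Suc k) has_real_derivative y) (at x) \<and> y < 0"
    using mult_power_has_derivative by blast
qed (intro continuous_intros)

text \<open>The extinction probability \<open>q\<close> corresponds to the dual density \<open>r = p q / (1 - p + p q)\<close>, the
  second solution of \<open>r (1 - r)^(d - 2) = p (1 - p)^(d - 2)\<close>.\<close>

lemma dual_density:
  assumes "3 \<le> d" "1 / (real d - 1) < p" "p < 1"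
  obtains r where "0 < r" "r < 1 / (real d - 1)" "p * (1 - p) ^ (d - 2) = r * (1 - r) ^ (d - 2)"
    "giant_density d p = p - ((1 - p) / (1 - r))\<^sup>2 * r" "0 < giant_density d p" "giant_density d p \<le> 1"
proof -
  obtain k where k: "d = k + 3" using assms(1) by (metis add.commute le_Suc_ex)
  define f where "f t = t * (1 - t) ^ Suc k" for t :: real
  have dk: "real d - 1 = real k + 2" "d - 2 = Suc k" "d - 1 = Suc (Suc k)" using k by auto
  let ?m = "1 / (real k + 2)"
  have pm: "?m < p" using assms(2) dk by simp
  have p0: "0 < p" using pm by (smt (verit) divide_nonneg_nonneg of_nat_0_le_iff)
  have fp0: "0 < f p" using p0 assms(3) by (simp add: f_def)
  have fpm: "f p < f ?m" unfolding f_def by (rule mult_power_less_right) (use pm assms(3) in auto)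
  have "\<exists>r\<ge>0. r \<le> ?m \<and> f r = f p"
    by (rule IVT') (use fp0 fpm in \<open>auto simp: f_def intro!: continuous_intros\<close>)
  then obtain r where r: "0 \<le> r" "r \<le> ?m" "f r = f p" by blast
  have r0: "0 < r" using r(1,3) fp0 by (cases "r = 0") (auto simp: f_def)
  have rm: "r < ?m" using r(2,3) fpm by (cases "r = ?m") auto
  have rp: "r < p" using rm pm by simp
  have r1: "r < 1" using rp assms(3) by simp
  \<comment> \<open>The relation \<open>r = p * q / (1 - p + p * q)\<close> solved for
    \<open>q\<close>; the quantity \<open>s\<close> turns out to be
    \<open>1 - p + p * q\<close>.\<close>
  define q where "q = r * (1 - p) / ((1 - r) * p)"
  define s where "s = (1 - p) / (1 - r)"
  have q0: "0 < q" using r0 r1 p0 assms(3) by (simp add: q_def)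
  have q1: "q < 1" using r0 r1 p0 rp assms(3) by (simp add: q_def field_simps)
  have s: "1 - p + p * q = s" using r1 p0 by (simp add: q_def s_def field_simps)
  have s0: "0 < s" using assms(3) r1 by (simp add: s_def)
  have s1: "s < 1" using rp r1 by (simp add: s_def)
  have pq: "p * q = r * s" using r1 p0 by (simp add: q_def s_def field_simps)
  have sk: "s ^ Suc k = r / p"
  proof -
    have "s ^ Suc k = (1 - p) ^ Suc k / (1 - r) ^ Suc k" unfolding s_def by (rule power_divide)
    also have "\<dots> = r / p"
    proof -
      have "(1 - r) ^ Suc k \<noteq> 0" using r1 by simp
      moreover have "p * (1 - p) ^ Suc k = r * (1 - r) ^ Suc k" using r(3) by (simp only: f_def)
      ultimately show ?thesis using p0 by (simp add: frac_eq_eq mult.commute del: power_Suc)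
    qed
    finally show ?thesis .
  qed
  have "s ^ Suc (Suc k) = (r / p) * s" using sk by (simp add: mult.commute)
  also have "\<dots> = q" using pq p0 by (simp add: field_simps)
  finally have qeq: "q = (1 - p + p * q) ^ (d - 1)" unfolding s dk by simp
  \<comment> \<open>Any other fixed point gives in the same way a density \<open>r'\<close> below
    \<open>p\<close> with the same weight. Strict monotonicity on either side of the peak first puts
    \<open>r'\<close> on the left and then forces \<open>r' = r\<close>.\<close>
  have uniq: "q' = q" if q': "0 < q'" "q' < 1" "q' = (1 - p + p * q') ^ (d - 1)" for q'
  proof -
    define s' where "s' = 1 - p + p * q'"
    define r' where "r' = p * q' / s'"
    have s'0: "0 < s'" using q' p0 assms(3) by (simp add: s'_def add_pos_pos)
    have "(1 - p) * (1 - q') > 0" using q' assms(3) by simp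
    then have "q' < s'" by (simp add: s'_def algebra_simps)
    then have r'p: "r' < p" using p0 s'0 by (simp add: r'_def field_simps)
    have r'0: "0 < r'" using q' p0 s'0 by (simp add: r'_def)
    have 1: "1 - r' = (1 - p) / s'" using s'0 by (simp add: r'_def s'_def field_simps)
    have "q' = s' ^ Suc (Suc k)" using q'(3) unfolding s'_def dk .
    then have "q' = s' * s' ^ Suc k" by simp
    have "f r' = (p * q' / s') * ((1 - p) ^ Suc k / s' ^ Suc k)"
      unfolding f_def 1 power_divide unfolding r'_def ..
    also have "\<dots> = p * (1 - p) ^ Suc k * (q' / (s' * s' ^ Suc k))"
    proof -
      have "p * q' / s' * (A / B) = p * A * (q' / (s' * B))" for A B by simp
      then show ?thesis .
    qed
    also have "q' / (s' * s' ^ Suc k) = 1"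
      unfolding \<open>q' = s' * s' ^ Suc k\<close>[symmetric] using q'(1) by simp
    finally have fr': "f r' = f p" by (simp only: f_def mult_1_right)
    have r'm: "r' < ?m"
    proof (rule ccontr)
      assume "\<not> r' < ?m"
      then have "f p < f r'"
        unfolding f_def using r'p assms(3) by (intro mult_power_less_right) auto
      then show False using fr' by simp
    qed
    have "\<not> r' < r"
    proof
      assume "r' < r"
      then have "f r' < f r" unfolding f_def using r'0 rm by (intro mult_power_less_left) auto
      then show False using fr' r(3) by simp
    qed
    moreover have "\<not> r < r'"
    proof
      assume "r < r'"
      then have "f r < f r'" unfolding f_def using r0 r'm by (intro mult_power_less_left) auto
      then show False using fr' r(3) by simp
    qed
    ultimately have "r' = r" by simp
    then have "q = r' * (1 - p) / ((1 - r') * p)" by (simp add: q_def)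
    also have "\<dots> = q'" unfolding 1 using s'0 p0 assms(3) by (simp add: r'_def)
    finally show ?thesis ..
  qed
  have ext: "extinction d p = q"
    unfolding extinction_def
  proof (rule the_equality)
    show "0 < q \<and> q < 1 \<and> q = (1 - p + p * q) ^ (d - 1)" using q0 q1 qeq by (intro conjI)
    show "q' = q" if "0 < q' \<and> q' < 1 \<and> q' = (1 - p + p * q') ^ (d - 1)" for q'
      using that by (elim conjE) (rule uniq)
  qed
  have "giant_density d p = p - p * q * (1 - p + p * q)"
    unfolding giant_density_def ext Let_def by (simp add: algebra_simps power2_eq_square)
  also have "\<dots> = p - r * s * s" unfolding s unfolding pq ..
  finally have gd: "giant_density d p = p - s\<^sup>2 * r" by (simp add: power2_eq_square mult_ac)
  have "s\<^sup>2 * r = p * (q * s)" using pq by (simp add: power2_eq_square mult_ac)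
  moreover have "q * s < 1 * 1" using q0 q1 s0 s1 by (intro mult_strict_mono) auto
  then have "q * s < 1" by simp
  moreover have "0 < q * s" using q0 s0 by simp
  ultimately have "0 < giant_density d p" "giant_density d p \<le> 1"
  proof -
    have "0 < p * (q * s)" "p * (q * s) < p * 1"
      using p0 \<open>0 < q * s\<close> \<open>q * s < 1\<close> by (simp, intro mult_strict_left_mono)
    then show "0 < giant_density d p" "giant_density d p \<le> 1"
      using assms(3) gd \<open>s\<^sup>2 * r = p * (q * s)\<close> by simp_all
  qed
  show ?thesis
  proof (rule that)
    show "r < 1 / (real d - 1)" using rm unfolding dk .
    show "p * (1 - p) ^ (d - 2) = r * (1 - r) ^ (d - 2)" using r(3) unfolding f_def dk by (rule sym)
    show "giant_density d p = p - ((1 - p) / (1 - r))\<^sup>2 * r" using gd unfolding s_def .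
  qed fact+
qed

section \<open>The exponential rate \<open>a - 1 - ln a\<close>\<close>

lemma ln_le_half_diff_inverse:
  fixes a :: real
  assumes "1 \<le> a"
  shows "ln a \<le> (a - 1 / a) / 2"
proof -
  let ?g = "\<lambda>x :: real. (x - 1 / x) / 2 - ln x"
  have "?g 1 \<le> ?g a"
  proof (rule DERIV_nonneg_imp_nondecreasing[OF assms])
    fix x :: real assume x: "1 \<le> x" "x \<le> a"
    have "(?g has_real_derivative (1 + 1 / x\<^sup>2) / 2 - 1 / x) (at x)"
      using x by (auto intro!: derivative_eq_intros simp: power2_eq_square)
    moreover have "(1 + 1 / x\<^sup>2) / 2 - 1 / x = (1 - 1 / x)\<^sup>2 / 2"
      using x by (simp add: power2_eq_square field_simps)
    ultimately show "\<exists>y. (?g has_real_derivative y) (at x) \<and> 0 \<le> y" by auto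
  qed
  then show ?thesis by simp
qed

text \<open>This is the source of the square in the denominator of the bound on the other
  components.\<close>

lemma square_div_le_rate:
  fixes a :: real
  assumes "1 \<le> a"
  shows "(a - 1)\<^sup>2 / (2 * a) \<le> a - 1 - ln a"
proof -
  have "(a - 1)\<^sup>2 / (2 * a) = a - 1 - (a - 1 / a) / 2"
    using assms by (simp add: power2_eq_square field_simps)
  then show ?thesis using ln_le_half_diff_inverse[OF assms] by simp
qed

text \<open>It bounds the rate at \<open>\<beta> * p\<close> from below by the rate at
  \<open>a\<close>, which does not depend on the degree.\<close>

lemma rate_mono:
  fixes a c :: real
  assumes "1 \<le> c" "c \<le> a"
  shows "c - 1 - ln c \<le> a - 1 - ln a"
proof -
  have "ln a - ln c = ln (a / c)" using assms by (simp add: ln_div)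
  also have "\<dots> \<le> a / c - 1" using assms by (intro ln_le_minus_one) auto
  also have "\<dots> = (a - c) / c" using assms by (simp add: field_simps)
  also have "\<dots> \<le> (a - c) / 1" using assms by (intro divide_left_mono) auto
  finally show ?thesis by simp
qed

lemma rate_pos:
  fixes a :: real
  assumes "1 < a"
  shows "0 < a - 1 - ln a"
proof -
  have "0 < (a - 1)\<^sup>2 / (2 * a)" using assms by simp
  then show ?thesis using square_div_le_rate[of a] assms by linarith
qed

text \<open>Here \<open>D\<close> stands for \<open>d - 1\<close>, and \<open>a\<close> bounds
  \<open>\<beta> * p\<close> from below independently of \<open>D\<close>. Giving up the fraction
  \<gamma> of the density costs at most \<open>\<gamma> * \<alpha>\<close> of the rate; \<gamma>
  makes this half of the rate at \<open>a\<close> and so involves only \<alpha> and \<delta>. The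
  bound of \<open>D\<close> by the square of \<beta> will control the radius of balls.\<close>

lemma sprinkling_parameters:
  fixes \<alpha> D \<delta> :: real
  assumes "1 < \<alpha>" "2 \<le> D" "\<alpha> < D" "0 < \<delta>" "\<delta> \<le> 1 / 10" "1 < (1 - \<delta>) / (1 + \<delta>) * \<alpha>"
  defines "a \<equiv> (1 - \<delta>) / (1 + \<delta>) * \<alpha>" and "\<beta> \<equiv> (D - \<delta>) / (1 + \<delta>)" and "p \<equiv> \<alpha> / D"
  defines "\<gamma> \<equiv> (a - 1 - ln a) / (2 * \<alpha>)"
  defines "p1 \<equiv> (1 - \<gamma>) * p"
  defines "p2 \<equiv> \<gamma> * p / (1 - p1)"
  shows "1 < \<beta>" "D \<le> \<beta>\<^sup>2" "a \<le> \<beta> * p" "\<beta> * p \<le> \<alpha>" "0 < p" "p < 1" "0 < \<gamma>" "\<gamma> < 1"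
    "(a - 1 - ln a) / 2 \<le> \<beta> * p1 - 1 - ln (\<beta> * p)" "1 / \<beta> \<le> p1" "p1 \<le> p" "0 < p1"
    "1 - p = (1 - p1) * (1 - p2)" "0 \<le> p2" "p2 \<le> 1" "\<gamma> / D \<le> p2"
proof -
  have a1: "1 < a" using assms(6) by (simp add: a_def)
  have a\<alpha>: "a \<le> \<alpha>"
  proof -
    have "(1 - \<delta>) / (1 + \<delta>) \<le> 1" using assms by simp
    then show ?thesis unfolding a_def using mult_right_mono[of "(1 - \<delta>) / (1 + \<delta>)" 1 \<alpha>] assms(1) by simp
  qed
  have m0: "0 < a - 1 - ln a" by (rule rate_pos[OF a1])
  show \<beta>1: "1 < \<beta>" using assms by (simp add: \<beta>_def field_simps)
  show "D \<le> \<beta>\<^sup>2"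
  proof -
    have "(D - 1 / 10) / (11 / 10) \<le> \<beta>"
      unfolding \<beta>_def using assms by (intro frac_le) auto
    then have "((D - 1 / 10) / (11 / 10))\<^sup>2 \<le> \<beta>\<^sup>2" using assms(2) by (intro power_mono) auto
    moreover have "D \<le> ((D - 1 / 10) / (11 / 10))\<^sup>2"
    proof -
      \<comment> \<open>Clearing denominators leaves
        \<open>100 * D * D - 141 * D + 1 \<ge> 0\<close>, whose left side exceeds this product by
        119.\<close>
      have "0 \<le> (D - 2) * (100 * D + 59)" using assms(2) by simp
      then show ?thesis by (simp add: power2_eq_square field_simps)
    qed
    ultimately show ?thesis by simp
  qed
  show p0: "0 < p" and p1': "p < 1" using assms by (auto simp: p_def)
  show a\<beta>: "a \<le> \<beta> * p"
  proof -
    have "(1 - \<delta>) * D \<le> D - \<delta>" using assms by (simp add: algebra_simps)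
    then have "(1 - \<delta>) * D * (\<alpha> / (D * (1 + \<delta>))) \<le> (D - \<delta>) * (\<alpha> / (D * (1 + \<delta>)))"
      using assms by (intro mult_right_mono) auto
    moreover have "a = (1 - \<delta>) * D * (\<alpha> / (D * (1 + \<delta>)))" using assms(2) by (simp add: a_def)
    moreover have "\<beta> * p = (D - \<delta>) * (\<alpha> / (D * (1 + \<delta>)))" by (simp add: \<beta>_def p_def mult.commute)
    ultimately show ?thesis by simp
  qed
  show \<beta>\<alpha>: "\<beta> * p \<le> \<alpha>"
  proof -
    have "\<beta> \<le> D / 1" unfolding \<beta>_def using assms by (intro frac_le) auto
    then have "\<beta> * p \<le> D * p" using p0 by simp
    then show ?thesis using assms(2) by (simp add: p_def)
  qed
  show \<gamma>0: "0 < \<gamma>" using m0 assms(1) by (simp add: \<gamma>_def)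
  show \<gamma>1: "\<gamma> < 1"
  proof -
    have "0 < ln a" using a1 by simp
    then have "a - 1 - ln a < 2 * \<alpha>" using a\<alpha> a1 by linarith
    then show ?thesis using assms(1) by (simp add: \<gamma>_def)
  qed
  have \<gamma>\<beta>: "\<gamma> * (\<beta> * p) \<le> (a - 1 - ln a) / 2"
  proof -
    have "\<gamma> * (\<beta> * p) \<le> \<gamma> * \<alpha>" using \<gamma>0 \<beta>\<alpha> by simp
    then show ?thesis using assms(1) by (simp add: \<gamma>_def)
  qed
  have "a - 1 - ln a \<le> \<beta> * p - 1 - ln (\<beta> * p)" using rate_mono[of a "\<beta> * p"] a1 a\<beta> by simp
  moreover have "\<beta> * p1 = \<beta> * p - \<gamma> * (\<beta> * p)" by (simp add: p1_def algebra_simps)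
  ultimately show \<mu>: "(a - 1 - ln a) / 2 \<le> \<beta> * p1 - 1 - ln (\<beta> * p)" using \<gamma>\<beta> by simp
  have "0 \<le> ln (\<beta> * p)" using a1 a\<beta> by (intro ln_ge_zero) auto
  then have "1 \<le> \<beta> * p1" using \<mu> m0 by simp
  then show "1 / \<beta> \<le> p1" using \<beta>1 by (simp add: field_simps)
  show p1p: "p1 \<le> p" using p0 \<gamma>0 by (simp add: p1_def algebra_simps)
  show p10: "0 < p1" using p0 \<gamma>1 by (simp add: p1_def)
  have p11: "p1 < 1" using p1p p1' by simp
  have "\<gamma> * p = p - p1" by (simp add: p1_def algebra_simps)
  then have p2: "p2 = (p - p1) / (1 - p1)" by (simp add: p2_def)
  show "1 - p = (1 - p1) * (1 - p2)" unfolding p2 using p11 by (simp add: field_simps)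
  show "0 \<le> p2" unfolding p2 using p1p p11 by simp
  show "p2 \<le> 1" unfolding p2 using p1' p11 by simp
  show "\<gamma> / D \<le> p2"
  proof -
    have "\<gamma> / D \<le> \<gamma> * p" using \<gamma>0 assms(1,2) by (simp add: p_def divide_right_mono)
    also have "\<dots> = \<gamma> * p / 1" by simp
    also have "\<dots> \<le> p2" unfolding p2_def using \<gamma>0 p0 p10 p11 by (intro divide_left_mono) auto
    finally show ?thesis .
  qed
qed

text \<open>\<open>R\<close> is the logarithm of \<open>l ^ 4\<close> to base \<open>D\<close>,
  rounded up. Since \<beta> is at least the square root of \<open>D\<close>, this suffices for a
  growth factor of \<open>l\<^sup>2\<close>; rounding costs one factor \<open>D\<close>.\<close>

lemma radius_bounds:
  fixes l D \<beta> :: real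
  assumes "1 \<le> l" "2 \<le> D" "D \<le> \<beta>\<^sup>2" "1 < \<beta>"
  defines "R \<equiv> nat \<lceil>4 * ln l / ln D\<rceil>"
  shows "l\<^sup>2 \<le> \<beta> ^ R" "D ^ R \<le> D * l ^ 4"
proof -
  have lD: "0 < ln D" using assms(2) by simp
  have x: "0 \<le> 4 * ln l / ln D" using assms(1) lD by simp
  have R: "4 * ln l / ln D \<le> real R" "real R \<le> 4 * ln l / ln D + 1"
    unfolding R_def using x by linarith+
  have l4: "l ^ 4 = exp (4 * ln l)" using assms(1) by (simp add: exp_of_nat_mult[of 4, simplified])
  have DR: "D ^ R = exp (real R * ln D)" using assms(2) by (simp add: exp_of_nat_mult)
  have "4 * ln l \<le> real R * ln D" using R(1) lD by (simp add: field_simps)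
  then have "l ^ 4 \<le> D ^ R" unfolding l4 DR by simp
  also have "\<dots> \<le> (\<beta>\<^sup>2) ^ R" using assms(2,3) by (intro power_mono) auto
  finally have "(l\<^sup>2)\<^sup>2 \<le> (\<beta> ^ R)\<^sup>2" by (simp add: power_mult[symmetric] mult.commute)
  then show "l\<^sup>2 \<le> \<beta> ^ R" by (rule power2_le_imp_le) (use assms(4) in simp)
  have "real R * ln D \<le> 4 * ln l + ln D" using R(2) lD by (simp add: field_simps)
  then have "D ^ R \<le> exp (4 * ln l + ln D)" unfolding DR by simp
  also have "\<dots> = D * l ^ 4" unfolding exp_add l4 using assms(2) by simp
  finally show "D ^ R \<le> D * l ^ 4" .
qed

text \<open>Origin of the exponents: path length contributes one factor \<open>D * l ^ 4\<close> and
  ball size two, hence \<open>l ^ 12\<close>. Since \<open>p2\<close> is at least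
  \<open>(1 / D) ^ Suc k\<close>, a set of \<open>2 * R + 4\<close> vertices is chosen with
  probability at least the \<open>Suc k\<close>-th power of
  \<open>1 / (D ^ 6 * l ^ 8)\<close>.\<close>

lemma sprinkling_rate:
  fixes l D b p2 \<gamma> :: real
  assumes "1 \<le> l" "real d = D + 1" "2 \<le> D" "D ^ R \<le> D * l ^ 4" "0 \<le> b"
    and "0 < \<gamma>" "1 / \<gamma> \<le> 2 ^ k" "\<gamma> / D \<le> p2" "p2 \<le> 1"
  defines "\<theta> \<equiv> b / (4 * real d * D ^ (5 + 6 * Suc k) * l ^ (12 + 8 * Suc k))"
  shows "\<theta> * real ((2 * (R + 1) + 2) * (d * (d + 1) ^ (R + 1))) \<le> b * p2 ^ (2 * (R + 1) + 2)"
proof -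
  have l4: "1 \<le> l ^ 4" using assms(1) by (rule one_le_power)
  have D0: "0 < D" using assms(3) by simp
  have K: "real ((2 * (R + 1) + 2) * (d * (d + 1) ^ (R + 1))) \<le> 4 * D ^ 5 * real d * l ^ 12"
  proof -
    have "real R \<le> 2 ^ R" using of_nat_less_two_power[of R, where 'a = real] by simp
    also have "\<dots> \<le> D ^ R" using assms(3) by (intro power_mono) auto
    finally have R: "real R \<le> D * l ^ 4" using assms(4) by simp
    have "4 \<le> 2 * (D * l ^ 4)" using mult_mono[of 2 D 1 "l ^ 4"] assms(3) l4 by simp
    then have 1: "real (2 * (R + 1) + 2) \<le> 4 * (D * l ^ 4)" using R by simp
    have "real (d + 1) \<le> D\<^sup>2"
    proof -
      have "0 \<le> (D - 2) * (D + 1)" using assms(3) by simp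
      then show ?thesis using assms(2) by (simp add: power2_eq_square algebra_simps)
    qed
    then have "real (d + 1) ^ (R + 1) \<le> (D\<^sup>2) ^ (R + 1)" by (intro power_mono) auto
    also have "\<dots> = (D ^ R)\<^sup>2 * D\<^sup>2" by (simp add: power_mult[symmetric] power_add[symmetric] algebra_simps)
    also have "\<dots> \<le> (D * l ^ 4)\<^sup>2 * D\<^sup>2" using assms(4) D0 by (intro mult_right_mono power_mono) auto
    finally have 2: "real (d + 1) ^ (R + 1) \<le> (D * l ^ 4)\<^sup>2 * D\<^sup>2" .
    have "real ((2 * (R + 1) + 2) * (d * (d + 1) ^ (R + 1))) = real (2 * (R + 1) + 2) * (real d * real (d + 1) ^ (R + 1))"
      by (simp only: of_nat_mult of_nat_power)
    also have "\<dots> \<le> 4 * (D * l ^ 4) * (real d * ((D * l ^ 4)\<^sup>2 * D\<^sup>2))"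
      using 1 2 by (intro mult_mono) auto
    also have "\<dots> = 4 * D ^ 5 * real d * l ^ 12" by (simp add: power_mult_distrib power_mult[symmetric] eval_nat_numeral)
    finally show ?thesis .
  qed
  have p2: "(1 / D) ^ Suc k \<le> p2"
  proof -
    have "1 / \<gamma> \<le> D ^ k" using assms(7) power_mono[of 2 D k] assms(3) by simp
    then have "(1 / D) ^ k \<le> \<gamma>" using assms(6) D0 by (simp add: power_one_over field_simps)
    then have "(1 / D) ^ Suc k \<le> \<gamma> / D" using D0 by (simp add: field_simps)
    then show ?thesis using assms(8) by simp
  qed
  have "1 / (D ^ (6 * Suc k) * l ^ (8 * Suc k)) = (1 / ((D * l ^ 4)\<^sup>2 * D ^ 4)) ^ Suc k"
    by (simp add: power_one_over power_mult_distrib power_mult[symmetric] power_add[symmetric] algebra_simps del: power_Suc)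
  also have "\<dots> \<le> (1 / ((D ^ R)\<^sup>2 * D ^ 4)) ^ Suc k"
    using assms(1,4) D0 by (intro power_mono divide_left_mono mult_right_mono) auto
  also have "\<dots> = ((1 / D) ^ Suc k) ^ (2 * (R + 1) + 2)"
  proof -
    have "2 * (R + 1) + 2 = R * 2 + 4" by simp
    then have "D ^ (2 * (R + 1) + 2) = (D ^ R)\<^sup>2 * D ^ 4" by (simp only: power_add power_mult)
    then show ?thesis
      unfolding power_one_over power_mult[symmetric] by (simp only: power_mult mult.commute[of "Suc k"])
  qed
  also have "\<dots> \<le> p2 ^ (2 * (R + 1) + 2)" using p2 D0 by (intro power_mono) auto
  finally have P: "1 / (D ^ (6 * Suc k) * l ^ (8 * Suc k)) \<le> p2 ^ (2 * (R + 1) + 2)" .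
  have d0: "0 < real d" using assms(2,3) by simp
  have "\<theta> * real ((2 * (R + 1) + 2) * (d * (d + 1) ^ (R + 1))) \<le> \<theta> * (4 * D ^ 5 * real d * l ^ 12)"
    using K assms(1,5) D0 by (intro mult_left_mono) (auto simp: \<theta>_def)
  also have "\<dots> = b * (1 / (D ^ (6 * Suc k) * l ^ (8 * Suc k)))"
    using d0 D0 assms(1) unfolding \<theta>_def power_add by (simp add: field_simps del: power_Suc)
  also have "\<dots> \<le> b * p2 ^ (2 * (R + 1) + 2)" using P assms(5) by (intro mult_left_mono)
  finally show ?thesis .
qed

subsection \<open>The giant component\<close>

context finite_regular_graph
begin

text \<open>The growth constant decreases in the sparsity parameter, so the cap \<delta>' may
  replace \<delta>. The factor \<open>d + 1\<close> makes room for the boundary of a set with fewer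
  than \<open>B\<close> vertices.\<close>

lemma sparse_growth:
  assumes "locally_sparse \<delta> C V E" "0 \<le> \<delta>" "\<delta> \<le> \<delta>'" "(real d + 1) * B \<le> ln (real (card V)) powr C" "1 \<le> d"
    and T: "T \<subseteq> V" "real (card T) < B"
  shows "((real d - 1 - \<delta>') / (1 + \<delta>') - 1) * real (card T) \<le> real (card (outer_boundary E T))"
proof -
  have "(real d - 1 - \<delta>') / (1 + \<delta>') \<le> (real d - 1 - \<delta>) / (1 + \<delta>)"
  proof -
    have "real d * \<delta> \<le> real d * \<delta>'" using assms(3) by (intro mult_left_mono) auto
    then show ?thesis using assms(2,3) by (simp add: field_simps)
  qed
  then have "((real d - 1 - \<delta>') / (1 + \<delta>') - 1) * real (card T) \<le> ((real d - 1 - \<delta>) / (1 + \<delta>) - 1) * real (card T)"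
    by (intro mult_right_mono) auto
  also have "\<dots> \<le> real (card (outer_boundary E T))"
  proof (rule boundary_ge_of_sparse[OF T(1) assms(2)])
    fix U assume U: "U \<subseteq> V" "card U \<le> (d + 1) * card T"
    have "real (card U) \<le> real ((d + 1) * card T)" using U(2) by (rule of_nat_mono)
    also have "\<dots> = (real d + 1) * real (card T)" by (simp add: algebra_simps)
    also have "\<dots> \<le> (real d + 1) * B" using T(2) by (intro mult_left_mono) auto
    also have "\<dots> \<le> ln (real (card V)) powr C" by (rule assms(4))
    finally show "real (edges_in E U) \<le> (1 + \<delta>) * real (card U)"
      using assms(1) U(1) unfolding locally_sparse_def by blast
  qed
  finally show ?thesis .
qed

text \<open>Below \<open>1 / \<delta>\<close> vertices, \<open>(1 + \<delta>) * card U\<close> is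
  less than \<open>card U + 1\<close>, so there are at most as many edges as vertices. A radius
  \<open>m\<close> of order \<open>1 / \<delta>\<close> then leaves a fraction of order \<delta> of
  exceptional vertices; if \<open>h\<close> is too large for such an \<open>m\<close>, the bound is
  at least \<open>card V\<close>.\<close>

lemma card_not_tree_like_le:
  assumes "0 < \<delta>" "1 \<le> d"
    and sparse: "\<And>U. U \<subseteq> V \<Longrightarrow> real (card U) < 1 / \<delta> \<Longrightarrow> real (edges_in E U) \<le> (1 + \<delta>) * real (card U)"
    and grow: "\<And>T. T \<subseteq> V \<Longrightarrow> T \<noteq> {} \<Longrightarrow> real (card T) < 1 / \<delta> \<Longrightarrow> outer_boundary E T \<noteq> {}"
  shows "real (card {v \<in> V. \<not> tree_like h v}) \<le> 4 * real ((d + 1) ^ (2 * (h + 1))) * \<delta> * real (card V)"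
proof -
  let ?N = "{v \<in> V. \<not> tree_like h v}" and ?\<Delta> = "real ((d + 1) ^ (2 * (h + 1)))"
  have NV: "card ?N \<le> card V" using finite_V by (intro card_mono) auto
  show ?thesis
  proof (cases "2 * (real h + 1) \<le> 1 / (2 * \<delta>)")
    case True
    define z where "z = nat \<lceil>1 / (2 * \<delta>)\<rceil>"
    define y where "y = 1 / (2 * \<delta>)"
    \<comment> \<open>Rounded so that \<open>2 * (h + 1) + 2 * m\<close> is below
      \<open>1 / \<delta>\<close> while \<open>m + 1\<close> is at least
      \<open>1 / (4 * \<delta>)\<close>.\<close>
    define m where "m = z - (h + 2)"
    have y: "1 / \<delta> = 2 * y" "1 / (4 * \<delta>) = y / 2" by (simp_all add: y_def)
    have y0: "0 \<le> y" using assms(1) by (simp add: y_def)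
    then have c: "y \<le> real z" "real z < y + 1"
      unfolding z_def y_def[symmetric] by linarith+
    have hy: "2 * (real h + 1) \<le> y" using True by (simp add: y_def)
    have "real h + 2 \<le> 2 * (real h + 1)" by simp
    then have "real h + 2 \<le> real z" using hy c(1) by linarith
    then have m: "real m = real z - (real h + 2)"
      unfolding m_def by (subst of_nat_diff) auto
    have m_up: "2 * (real h + 1) + 2 * real m < 1 / \<delta>" unfolding y m using c(2) by (simp add: algebra_simps)
    have m_low: "1 / (4 * \<delta>) \<le> real m + 1" unfolding y m using c(1) hy by (simp add: algebra_simps)
    have "card ?N * (m + 1) \<le> card V * (d + 1) ^ (2 * (h + 1))"
    proof (rule card_not_tree_like)
      fix U assume U: "U \<subseteq> V" "card U \<le> 2 * (h + 1) + 2 * m"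
      have "real (card U) \<le> real (2 * (h + 1) + 2 * m)" using U(2) by (rule of_nat_mono)
      then have lt: "real (card U) < 1 / \<delta>" using m_up by simp
      then have "\<delta> * real (card U) < 1" using assms(1) by (simp add: field_simps)
      then have "real (edges_in E U) < real (card U) + 1" using sparse[OF U(1) lt] by (simp add: algebra_simps)
      then show "edges_in E U \<le> card U" by linarith
    next
      fix T assume T: "T \<subseteq> V" "T \<noteq> {}" "card T \<le> m"
      have "real (card T) \<le> real m" using T(3) by (rule of_nat_mono)
      also have "\<dots> \<le> 2 * (real h + 1) + 2 * real m" by simp
      also note m_up
      finally have "real (card T) < 1 / \<delta>" .
      then show "outer_boundary E T \<noteq> {}" by (rule grow[OF T(1,2)])
    qed
    then have "real (card ?N * (m + 1)) \<le> real (card V * (d + 1) ^ (2 * (h + 1)))" by (rule of_nat_mono)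
    then have 1: "real (card ?N) * (real m + 1) \<le> real (card V) * ?\<Delta>" by (simp only: of_nat_mult of_nat_add of_nat_1)
    have "real (card ?N) * (1 / (4 * \<delta>)) \<le> real (card ?N) * (real m + 1)" using m_low by (intro mult_left_mono) auto
    then have "real (card ?N) * (1 / (4 * \<delta>)) \<le> real (card V) * ?\<Delta>" using 1 by simp
    then have "real (card ?N) * (1 / (4 * \<delta>)) * (4 * \<delta>) \<le> real (card V) * ?\<Delta> * (4 * \<delta>)"
      using assms(1) by (intro mult_right_mono) auto
    then show ?thesis using assms(1) by (simp add: mult_ac)
  next
    case False
    have "h + 1 < 2 ^ (h + 1)" by (rule less_exp)
    also have "(2::nat) ^ (h + 1) \<le> 2 ^ (2 * (h + 1))" by (rule power_increasing) auto
    also have "\<dots> \<le> (d + 1) ^ (2 * (h + 1))" using assms(2) by (intro power_mono) auto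
    finally have "real (h + 1) \<le> ?\<Delta>" by (intro of_nat_mono) simp
    then have "4 * (real h + 1) * \<delta> \<le> 4 * ?\<Delta> * \<delta>" using assms(1) by simp
    moreover have "1 < 4 * (real h + 1) * \<delta>" using False assms(1) by (simp add: field_simps)
    ultimately have "1 * real (card V) \<le> (4 * ?\<Delta> * \<delta>) * real (card V)" by (intro mult_right_mono) auto
    then show ?thesis using NV by simp
  qed
qed

text \<open>Three bad events are excluded: unmerged clusters, clusters between \<open>K * l\<close>
  and \<open>M\<close>, and a deviation of the number of large vertices. The first is treated with
  \<beta> at the cap \<delta>0, the second at the actual \<delta>, in terms of which
  \<open>K\<close> is given.\<close>

lemma giant_prob:
  fixes \<alpha> \<delta> \<delta>0 b c x \<epsilon> \<xi> :: real and k N :: nat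
  assumes "1 < \<alpha>" "\<alpha> < real d - 1" "3 \<le> d" "0 < b" "0 < \<delta>" "\<delta> \<le> \<delta>0" "\<delta>0 \<le> 1 / 10"
    and a1: "1 < (1 - \<delta>0) / (1 + \<delta>0) * \<alpha>"
    and "edge_expanding b V E" "locally_sparse \<delta> (real (N + 3)) V E"
  defines "D \<equiv> real d - 1" and "a \<equiv> (1 - \<delta>0) / (1 + \<delta>0) * \<alpha>"
  defines "\<gamma> \<equiv> (a - 1 - ln a) / (2 * \<alpha>)" and "\<beta> \<equiv> (D - \<delta>0) / (1 + \<delta>0)" and "p \<equiv> \<alpha> / D"
  defines "l \<equiv> ln (real (card V))"
  defines "c1 \<equiv> (a - 1 - ln a) / 2" and "c3 \<equiv> b / (4 * real d * D ^ (5 + 6 * Suc k))"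
  defines "K \<equiv> 9 * \<alpha> / ((1 - \<delta>) / (1 + \<delta>) * \<alpha> - 1)\<^sup>2"
  defines "B \<equiv> (real d + 1) * (l\<^sup>2 + 1) * (1 + real d * l ^ N) + 1"
  assumes k: "1 / \<gamma> \<le> 2 ^ k" and N: "N = 14 + 8 * Suc k"
    and l: "1 \<le> l" "real d + 1 < l" "(real d + 1) * B \<le> l powr (real (N + 3))"
      "3 / c1 \<le> l" "2 / c3 \<le> l" "K * l < c * real (card V)"
    and c: "c = (p - 1 / \<beta>) / 2" and \<xi>: "0 < \<xi>" "\<xi> \<le> c"
    and approx: "\<bar>subset_exp (\<lambda>_. p) V (\<lambda>U. real (card (large_vertices (l ^ N) U))) - x * real (card V)\<bar>
      \<le> (\<epsilon> * x - \<xi>) * real (card V)"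
  shows "1 - (8 * exp (- l) + (real d + 1)\<^sup>2 * l ^ (2 * N) * exp (- l) / \<xi>\<^sup>2)
    \<le> subset_prob (\<lambda>_. p) V (\<lambda>U. unique_giant c x \<epsilon> K V E U)"
proof -
  define n where "n = real (card V)"
  define M where "M = l ^ N"
  define p1 where "p1 = (1 - \<gamma>) * p"
  define p2 where "p2 = \<gamma> * p / (1 - p1)"
  define R where "R = nat \<lceil>4 * ln l / ln D\<rceil>"
  define \<theta> where "\<theta> = b / (4 * real d * D ^ (5 + 6 * Suc k) * l ^ (12 + 8 * Suc k))"
  have D2: "2 \<le> D" "\<alpha> < D" "real d = D + 1" "0 < \<delta>0" using assms by (auto simp: D_def)
  note par = sprinkling_parameters[OF assms(1) D2(1,2,4) assms(7) a1,
      folded a_def \<beta>_def p_def \<gamma>_def, folded \<gamma>_def, folded p1_def, folded p2_def]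
  have c10: "0 < c1" using rate_pos[of a] a1 by (simp add: c1_def a_def)
  have c30: "0 < c3" using assms(4) D2 assms(3) by (simp add: c3_def)
  have n0: "0 < n"
    using l(1) unfolding l_def n_def by (cases "card V = 0") auto
  have nl: "n = exp l" using n0 by (simp add: l_def n_def)
  have ln0: "ln (real (card V)) = l" by (simp add: l_def)
  have M1: "l \<le> M" unfolding M_def using l(1) N self_le_power[of l N] by simp
  have pw: "prob_weights (\<lambda>_. p) V" using par(5,6) by (simp add: prob_weights_def)
  have MB: "M < B"
  proof -
    have "1 * 1 * (1 + real d * M) \<le> (real d + 1) * (l\<^sup>2 + 1) * (1 + real d * M)"
      using M1 l(1) by (intro mult_mono mult_right_mono) auto
    moreover have "1 * M \<le> real d * M" using M1 l(1) assms(3) by (intro mult_right_mono) auto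
    ultimately show ?thesis unfolding B_def M_def by simp
  qed
  have growth: "(\<beta> - 1) * real (card T) \<le> real (card (outer_boundary E T))" if "T \<subseteq> V" "real (card T) < B" for T
    using sparse_growth[OF assms(10) less_imp_le[OF assms(5)] assms(6) l(3)[unfolded l_def] _ that] assms(3)
    unfolding \<beta>_def D_def by simp
  have ln_pos: "0 \<le> ln (\<beta> * p)" using par(3) a1 by (intro ln_ge_zero) (simp add: a_def)
  have \<mu>1: "c1 \<le> \<beta> * p1 - 1 - ln (\<beta> * p)" using par(9) by (simp add: c1_def)
  have c12: "c1 \<le> \<beta> * p1 - 1" using \<mu>1 ln_pos by linarith
  \<comment> \<open>As \<open>n = exp l\<close>, a union bound costs up to order
    \<open>n ^ 2\<close> for intermediate sets and order \<open>n\<close> for merging; decay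
    \<open>3 * l\<close> and \<open>2 * l\<close> then leave \<open>exp (- l)\<close>.\<close>
  have l2: "l * 3 \<le> c1 * l\<^sup>2" "l * 2 \<le> c3 * l\<^sup>2"
  proof -
    have "3 \<le> c1 * l" using l(4) c10 by (simp add: field_simps)
    then have "3 * l \<le> c1 * l * l" using l(1) by (intro mult_right_mono) auto
    then show "l * 3 \<le> c1 * l\<^sup>2" by (simp add: power2_eq_square mult_ac)
    have "2 \<le> c3 * l" using l(5) c30 by (simp add: field_simps)
    then have "2 * l \<le> c3 * l * l" using l(1) by (intro mult_right_mono) auto
    then show "l * 2 \<le> c3 * l\<^sup>2" by (simp add: power2_eq_square mult_ac)
  qed
  let ?bad1 = "\<lambda>U. \<exists>v\<in>large_vertices (l\<^sup>2) U. \<exists>w\<in>large_vertices (l\<^sup>2) U. w \<notin> cluster E {v} U"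
  have kM: "1 + real d * l\<^sup>2 < M"
  proof -
    have "1 + real d * l\<^sup>2 \<le> (real d + 1) * l\<^sup>2" using l(1) by (simp add: algebra_simps)
    also have "\<dots> < l * l\<^sup>2" using l(1,2) by (intro mult_strict_right_mono) auto
    also have "\<dots> = l ^ 3" by (simp add: power3_eq_cube power2_eq_square)
    also have "\<dots> \<le> M" unfolding M_def using l(1) N by (intro power_increasing) auto
    finally show ?thesis .
  qed
  have rad: "l\<^sup>2 \<le> \<beta> ^ R" "D ^ R \<le> D * l ^ 4"
    unfolding R_def by (rule radius_bounds[OF l(1) D2(1) par(2,1)])+
  \<comment> \<open>\<open>N\<close> exceeds the exponent of \<open>l\<close> in \<theta> by two,
    which makes \<open>\<theta> * M\<close> outgrow \<open>l\<close>.\<close>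
  have \<theta>M: "\<theta> * M = c3 * l\<^sup>2"
  proof -
    have "M = l ^ (12 + 8 * Suc k) * l\<^sup>2" unfolding M_def N power_add[symmetric] by (rule arg_cong) simp
    then show ?thesis using l(1) by (simp add: \<theta>_def c3_def)
  qed
  have F1: "subset_prob (\<lambda>_. p) V ?bad1 \<le> 7 * exp (- l)"
  proof -
    have "subset_prob (\<lambda>_. p) V ?bad1
        \<le> n * exp (- ((\<beta> * p1 - 1) * l\<^sup>2)) + (n + 1) * (n * exp (- ((\<beta> * p1 - 1 - ln (\<beta> * p)) * l\<^sup>2)))
          + 2 * ((1 + exp (- \<theta> * M)) ^ card V - 1)"
      unfolding n_def
    proof (rule unmerged_clusters_prob[OF par(13,14,15,11) _ par(1,10)])
      show "l\<^sup>2 \<le> \<beta> ^ R" by (rule rad)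
      show "(real d + 1) * (l\<^sup>2 + 1) * (1 + real d * M) + 1 \<le> B" by (simp add: B_def M_def)
      show "\<theta> * real ((2 * (R + 1) + 2) * (d * (d + 1) ^ (R + 1))) \<le> b * p2 ^ (2 * (R + 1) + 2)"
        unfolding \<theta>_def using assms(4)
        by (intro sprinkling_rate[OF l(1) D2(3,1) rad(2) _ par(7) k par(16,15)]) simp
      show "0 \<le> \<theta>" using assms(4) D2 l(1) by (simp add: \<theta>_def)
    qed (use par \<mu>1 c10 kM growth assms(3,4,9) in auto)
    also have "n * exp (- ((\<beta> * p1 - 1) * l\<^sup>2)) \<le> exp (- l)"
    proof -
      have "l * 3 \<le> (\<beta> * p1 - 1) * l\<^sup>2"
        by (rule order_trans[OF l2(1) mult_right_mono[OF c12]]) simp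
      then have "l + - ((\<beta> * p1 - 1) * l\<^sup>2) \<le> - l" using l(1) by linarith
      then show ?thesis unfolding nl exp_add[symmetric] by (simp only: exp_le_cancel_iff)
    qed
    also have "(n + 1) * (n * exp (- ((\<beta> * p1 - 1 - ln (\<beta> * p)) * l\<^sup>2))) \<le> 2 * exp (- l)"
    proof -
      have "l * 3 \<le> (\<beta> * p1 - 1 - ln (\<beta> * p)) * l\<^sup>2"
        by (rule order_trans[OF l2(1) mult_right_mono[OF \<mu>1]]) simp
      then have e: "exp (- ((\<beta> * p1 - 1 - ln (\<beta> * p)) * l\<^sup>2)) \<le> exp (- (l * 3))" by simp
      have "1 \<le> n" unfolding nl using l(1) by simp
      then have "(n + 1) * (n * exp (- ((\<beta> * p1 - 1 - ln (\<beta> * p)) * l\<^sup>2))) \<le> (2 * n) * (n * exp (- (l * 3)))"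
        using e by (intro mult_mono) auto
      also have "\<dots> = 2 * (exp l * exp l * exp (- (l * 3)))" unfolding nl by simp
      also have "\<dots> = 2 * exp (- l)" unfolding exp_add[symmetric] by simp
      finally show ?thesis .
    qed
    also have "2 * ((1 + exp (- \<theta> * M)) ^ card V - 1) \<le> 4 * exp (- l)"
    proof -
      define y where "y = exp (- \<theta> * M)"
      have y0: "0 \<le> y" by (simp add: y_def)
      have "n * y = exp (l - c3 * l\<^sup>2)" unfolding y_def nl exp_add[symmetric] using \<theta>M by simp
      also have "\<dots> \<le> exp (- l)" using l2(2) by simp
      finally have ny: "n * y \<le> exp (- l)" .
      have ny1: "n * y \<le> 1" using ny l(1) by (smt (verit) exp_le_one_iff)
      have "(1 + y) ^ card V \<le> exp y ^ card V"
        using exp_ge_add_one_self[of y] y0 by (intro power_mono) auto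
      also have "\<dots> = exp (n * y)" by (simp add: n_def exp_of_nat_mult)
      also have "\<dots> \<le> 1 + n * y + (n * y)\<^sup>2" using ny1 y0 n0 by (intro exp_bound) auto
      also have "(n * y)\<^sup>2 \<le> n * y" using ny1 y0 n0 by (simp add: power2_eq_square mult_left_le)
      finally have "(1 + y) ^ card V - 1 \<le> 2 * exp (- l)" using ny by simp
      then show ?thesis by (simp add: y_def)
    qed
    finally show ?thesis by simp
  qed
  let ?bad2 = "\<lambda>U. \<exists>v\<in>V. K * l \<le> real (card (cluster E {v} U)) \<and> real (card (cluster E {v} U)) < M"
  have F2: "subset_prob (\<lambda>_. p) V ?bad2 \<le> exp (- l)"
  proof -
    define a' where "a' = (1 - \<delta>) / (1 + \<delta>) * \<alpha>"
    define \<beta>' where "\<beta>' = (D - \<delta>) / (1 + \<delta>)"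
    have "(1 - \<delta>0) / (1 + \<delta>0) \<le> (1 - \<delta>) / (1 + \<delta>)"
      using assms(5-7) by (intro frac_le) auto
    then have "a \<le> a'" unfolding a_def a'_def using assms(1) by (intro mult_right_mono) auto
    then have a'1: "1 < a'" using a1 by (simp add: a_def)
    have \<delta>1: "\<delta> \<le> 1 / 10" using assms(6,7) by simp
    note par' = sprinkling_parameters(1,3,4)[OF assms(1) D2(1,2) assms(5) \<delta>1 a'1[unfolded a'_def],
        folded a'_def \<beta>'_def p_def]
    define t where "t = \<beta>' * p"
    have t: "a' \<le> t" "t \<le> \<alpha>" using par' by (auto simp: t_def)
    have \<mu>: "(a' - 1)\<^sup>2 / (2 * \<alpha>) \<le> t - 1 - ln t"
    proof -
      have "(a' - 1)\<^sup>2 / (2 * \<alpha>) \<le> (t - 1)\<^sup>2 / (2 * t)"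
        using t a'1 by (intro frac_le power_mono) auto
      also have "\<dots> \<le> t - 1 - ln t" using t a'1 by (intro square_div_le_rate) auto
      finally show ?thesis .
    qed
    have K: "K = 9 * \<alpha> / (a' - 1)\<^sup>2" by (simp add: K_def a'_def)
    \<comment> \<open>An exponent of \<open>2 * l\<close> is enough, one \<open>l\<close> for the
      union bound over vertices and one for decay; the constant 9 gives \<open>9 / 2\<close> and
      leaves room.\<close>
    have "(a' - 1)\<^sup>2 / (2 * \<alpha>) * K = 9 / 2" unfolding K using a'1 assms(1) by simp
    moreover have "(a' - 1)\<^sup>2 / (2 * \<alpha>) * K \<le> (t - 1 - ln t) * K"
      using \<mu> assms(1) by (intro mult_right_mono) (auto simp: K)
    ultimately have "2 \<le> (t - 1 - ln t) * K" by linarith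
    then have rate: "2 * l \<le> (t - 1 - ln t) * (K * l)"
      using l(1) mult_right_mono[of 2 "(t - 1 - ln t) * K" l] by (simp add: mult.assoc)
    have growth': "(\<beta>' - 1) * real (card T) \<le> real (card (outer_boundary E T))" if "T \<subseteq> V" "real (card T) < M" for T
      using sparse_growth[OF assms(10) less_imp_le[OF assms(5)] order_refl l(3)[unfolded l_def] _ that(1)]
        that(2) MB assms(3) unfolding \<beta>'_def D_def by simp
    have one: "subset_prob (\<lambda>_. p) V (\<lambda>U. K * l \<le> real (card (cluster E {v} U)) \<and> real (card (cluster E {v} U)) < M)
      \<le> exp (- (2 * l))" if v: "v \<in> V" for v
    proof -
      have "subset_prob (\<lambda>_. p) V (\<lambda>U. K * l \<le> real (card (cluster E {v} U)) \<and> real (card (cluster E {v} U)) < M)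
        \<le> exp (- ((\<beta>' * p - 1 - ln (\<beta>' * p)) * (K * l))) / (\<beta>' * p)"
      proof (rule midsize_cluster_prob[OF v par'(1) _ order_refl _ _ _ growth'])
        show "1 / \<beta>' \<le> p" using t a'1 par'(1) by (simp add: t_def field_simps)
        show "0 \<le> \<beta>' * p - 1 - ln (\<beta>' * p)"
          using rate_pos[of t] t a'1 unfolding t_def by simp
      qed (use par(6) in auto)
      also have "\<dots> \<le> exp (- (2 * l)) / 1"
        using rate t a'1 unfolding t_def[symmetric] by (intro frac_le) auto
      finally show ?thesis by simp
    qed
    have "subset_prob (\<lambda>_. p) V ?bad2 \<le> (\<Sum>v\<in>V. subset_prob (\<lambda>_. p) V
        (\<lambda>U. K * l \<le> real (card (cluster E {v} U)) \<and> real (card (cluster E {v} U)) < M))"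
      by (rule subset_prob_Ex[OF pw finite_V])
    also have "\<dots> \<le> (\<Sum>v\<in>V. exp (- (2 * l)))" by (rule sum_mono) (rule one)
    also have "\<dots> = n * exp (- (2 * l))" by (simp add: n_def)
    also have "\<dots> = exp (- l)" unfolding nl exp_add[symmetric] by simp
    finally show ?thesis .
  qed
  define m where "m = subset_exp (\<lambda>_. p) V (\<lambda>U. real (card (large_vertices M U)))"
  let ?bad3 = "\<lambda>U. \<xi> * n < \<bar>real (card (large_vertices M U)) - m\<bar>"
  \<comment> \<open>The standard deviation is at most the square root of \<open>n\<close> times a
    power of \<open>l\<close>, against an allowed deviation of order \<open>n\<close>.\<close>
  have F3: "subset_prob (\<lambda>_. p) V ?bad3 \<le> (real d + 1)\<^sup>2 * l ^ (2 * N) * exp (- l) / \<xi>\<^sup>2"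
  proof -
    have "subset_prob (\<lambda>_. p) V ?bad3 \<le> real (card V) * ((real d + 1) * M)\<^sup>2 / (\<xi> * n)\<^sup>2"
      unfolding m_def
    proof (rule subset_prob_deviation[OF finite_V pw])
      show "0 < \<xi> * n" using \<xi>(1) n0 by simp
      fix v U assume "v \<in> V" "U \<subseteq> V"
      then have "\<bar>real (card (large_vertices M (insert v U))) - real (card (large_vertices M U))\<bar> \<le> 1 + real d * M"
        using M1 l(1) by (intro card_large_vertices_insert) auto
      also have "\<dots> \<le> (real d + 1) * M" using M1 l(1) by (simp add: algebra_simps)
      finally show "\<bar>real (card (large_vertices M (insert v U))) - real (card (large_vertices M U))\<bar> \<le> (real d + 1) * M" .
    qed
    also have "\<dots> = (real d + 1)\<^sup>2 * M\<^sup>2 * (1 / n) / \<xi>\<^sup>2"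
      unfolding n_def[symmetric] using n0 \<xi>(1) by (simp add: power_mult_distrib power2_eq_square field_simps)
    also have "M\<^sup>2 = l ^ (2 * N)" by (simp add: M_def power_mult[symmetric] mult.commute)
    also have "1 / n = exp (- l)" by (simp add: nl exp_minus inverse_eq_divide)
    finally show ?thesis .
  qed
  have m_ge: "2 * c * n \<le> m"
  proof -
    have "(p - 1 / \<beta>) * n \<le> m"
      unfolding m_def n_def
    proof (rule expected_large_vertices_ge[OF par(1)])
      show "1 / \<beta> \<le> p" using par(10,11) by simp
      show "ln (\<beta> * p) \<le> \<beta> * p - 1" using rate_pos[of "\<beta> * p"] par(3) a1 by (simp add: a_def)
    qed (use par(6) growth MB in auto)
    moreover have "2 * c = p - 1 / \<beta>" by (simp add: c)
    ultimately show ?thesis by simp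
  qed
  have c0: "0 < c * n" using \<xi> n0 by simp
  have good: "unique_giant c x \<epsilon> K V E U" if U: "U \<subseteq> V" "\<not> (?bad1 U \<or> ?bad2 U \<or> ?bad3 U)" for U
  proof (rule unique_giantI[where M = M and ?k0.0 = "l\<^sup>2"])
    show "l\<^sup>2 \<le> M"
      unfolding M_def using l(1) N by (intro power_increasing) auto
    have dev: "\<bar>real (card (large_vertices M U)) - m\<bar> \<le> \<xi> * n" using U(2) by auto
    have "\<xi> * n \<le> c * n" using \<xi>(2) n0 by simp
    then show "c * real (card V) \<le> real (card (large_vertices M U))"
      using dev m_ge unfolding n_def[symmetric] by linarith
    have "\<bar>m - x * n\<bar> \<le> \<epsilon> * x * n - \<xi> * n"
      using approx unfolding m_def M_def n_def by (simp add: algebra_simps)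
    then show "\<bar>real (card (large_vertices M U)) - x * real (card V)\<bar> \<le> \<epsilon> * (x * real (card V))"
      using dev unfolding n_def[symmetric] mult.assoc[symmetric] by linarith
    show "w \<in> cluster E {v} U" if "v \<in> large_vertices (l\<^sup>2) U" "w \<in> large_vertices (l\<^sup>2) U" for v w
      using U(2) that by blast
    show "\<not> (K * ln (real (card V)) \<le> real (card (cluster E {v} U)) \<and> real (card (cluster E {v} U)) < M)"
      if "v \<in> U" for v using U that unfolding ln0 by blast
  qed (use U(1) l(6) c0 ln0 in \<open>auto simp: n_def\<close>)
  have "subset_prob (\<lambda>_. p) V (\<lambda>U. \<not> unique_giant c x \<epsilon> K V E U) \<le>
      subset_prob (\<lambda>_. p) V (\<lambda>U. ?bad1 U \<or> ?bad2 U \<or> ?bad3 U)"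
    by (rule subset_prob_mono[OF pw]) (use good in blast)
  also have "\<dots> \<le> subset_prob (\<lambda>_. p) V ?bad1 + subset_prob (\<lambda>_. p) V (\<lambda>U. ?bad2 U \<or> ?bad3 U)"
    by (rule subset_prob_disj[OF pw])
  also have "subset_prob (\<lambda>_. p) V (\<lambda>U. ?bad2 U \<or> ?bad3 U) \<le> subset_prob (\<lambda>_. p) V ?bad2 + subset_prob (\<lambda>_. p) V ?bad3"
    by (rule subset_prob_disj[OF pw])
  finally have "1 - subset_prob (\<lambda>_. p) V (\<lambda>U. unique_giant c x \<epsilon> K V E U) \<le>
      subset_prob (\<lambda>_. p) V ?bad1 + (subset_prob (\<lambda>_. p) V ?bad2 + subset_prob (\<lambda>_. p) V ?bad3)"
    by (simp add: subset_prob_not[OF finite_V])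
  then show ?thesis using F1 F2 F3 by linarith
qed

text \<open>The general estimate of the mean with the critical density \<open>1 / D\<close> as the
  comparison density \<open>q\<close>, and with local sparsity bounding the number of exceptional
  vertices.\<close>

lemma giant_density_approx:
  fixes \<alpha> \<delta> \<delta>0 r :: real and h N :: nat
  assumes "1 < \<alpha>" "\<alpha> < real d - 1" "3 \<le> d" "0 < \<delta>" "\<delta> \<le> \<delta>0" "\<delta>0 \<le> 1 / 10"
    and a1: "1 < (1 - \<delta>0) / (1 + \<delta>0) * \<alpha>"
    and sparse: "locally_sparse \<delta> (real (N + 3)) V E"
  defines "D \<equiv> real d - 1"
  defines "\<beta> \<equiv> (D - \<delta>0) / (1 + \<delta>0)" and "p \<equiv> \<alpha> / D" and "q \<equiv> 1 / D"
  defines "l \<equiv> ln (real (card V))" and "\<rho> \<equiv> r * (1 - r) ^ (d - 2) / (q * (1 - q) ^ (d - 2))"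
  defines "B \<equiv> (real d + 1) * (l\<^sup>2 + 1) * (1 + real d * l ^ N) + 1"
  assumes l: "1 \<le> l" "(real d + 1) * B \<le> l powr (real (N + 3))" "real h < l" "1 / \<delta> < l" "1 \<le> N"
    and r: "0 < r" "r < 1 / D" "p * (1 - p) ^ (d - 2) = r * (1 - r) ^ (d - 2)" "\<rho> \<le> 1"
    and x: "x = p - ((1 - p) / (1 - r))\<^sup>2 * r" "0 \<le> x" "x \<le> 1"
  shows "\<bar>subset_exp (\<lambda>_. p) V (\<lambda>U. real (card (large_vertices (l ^ N) U))) - x * real (card V)\<bar>
    \<le> (((1 - p) / (1 - r))\<^sup>2 * (q * ((1 - r) / (1 - q))\<^sup>2) * \<rho> ^ h + exp (- ((\<beta> * p - 1 - ln (\<beta> * p)) * real h))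
       + 4 * real ((d + 1) ^ (2 * (h + 1))) * \<delta>) * real (card V)"
proof -
  define M where "M = l ^ N"
  have D2: "2 \<le> D" "\<alpha> < D" "0 < \<delta>0" using assms by (auto simp: D_def)
  note par = sprinkling_parameters(1,3,5,6)[OF assms(1) D2 assms(6) a1, folded \<beta>_def p_def]
  have M1: "l \<le> M" unfolding M_def using l(1,5) self_le_power[of l N] by simp
  have MB: "M < B"
  proof -
    have "1 * 1 * (1 + real d * M) \<le> (real d + 1) * (l\<^sup>2 + 1) * (1 + real d * M)"
      using M1 l(1) by (intro mult_mono mult_right_mono) auto
    moreover have "1 * M \<le> real d * M" using M1 l(1) assms(3) by (intro mult_right_mono) auto
    ultimately show ?thesis unfolding B_def M_def by simp
  qed
  have growth: "(\<beta> - 1) * real (card T) \<le> real (card (outer_boundary E T))" if "T \<subseteq> V" "real (card T) < B" for T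
    using sparse_growth[OF sparse less_imp_le[OF assms(4)] assms(5) l(2)[unfolded l_def] _ that] assms(3)
    unfolding \<beta>_def D_def by simp
  have bp: "1 < \<beta> * p" using par(2) a1 by simp
  have main: "\<bar>subset_exp (\<lambda>_. p) V (\<lambda>U. real (card (large_vertices M U))) - x * real (card V)\<bar>
    \<le> (((1 - p) / (1 - r))\<^sup>2 * (q * ((1 - r) / (1 - q))\<^sup>2) * \<rho> ^ h + exp (- ((\<beta> * p - 1 - ln (\<beta> * p)) * real h))) * real (card V)
       + real (card {v \<in> V. \<not> tree_like h v})"
  proof (rule expected_large_vertices_approx[OF par(1) _ par(4) _ _ _ r(1) _ _ _ r(3) \<rho>_def[THEN meta_eq_to_obj_eq] r(4) refl x])
    show "1 / \<beta> \<le> p" using bp par(1) by (simp add: field_simps)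
    show "ln (\<beta> * p) \<le> \<beta> * p - 1" using rate_pos[OF bp] by simp
    show "real h < M" using l(3) M1 by simp
    show "r \<le> q" using r(2) by (simp add: q_def)
    show "q < 1" using D2(1) by (simp add: q_def)
    show "2 \<le> d" using assms(3) by simp
    show "(\<beta> - 1) * real (card T) \<le> real (card (outer_boundary E T))" if "T \<subseteq> V" "real (card T) < M" for T
      using growth[OF that(1)] that(2) MB by simp
  qed
  have "real (card {v \<in> V. \<not> tree_like h v}) \<le> 4 * real ((d + 1) ^ (2 * (h + 1))) * \<delta> * real (card V)"
  proof (rule card_not_tree_like_le[OF assms(4)])
    show "1 \<le> d" using assms(3) by simp
    fix U assume U: "U \<subseteq> V" "real (card U) < 1 / \<delta>"
    have "l powr 1 \<le> l powr (real (N + 3))" using l(1) by (intro powr_mono) auto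
    then have "real (card U) \<le> ln (real (card V)) powr (real (N + 3))"
      using U(2) l(1,4) unfolding l_def[symmetric] by simp
    then show "real (edges_in E U) \<le> (1 + \<delta>) * real (card U)"
      using sparse U(1) unfolding locally_sparse_def by blast
  next
    fix T assume T: "T \<subseteq> V" "T \<noteq> {}" "real (card T) < 1 / \<delta>"
    have "finite T" using T(1) finite_V finite_subset by blast
    then have "0 < card T" using T(2) by (simp add: card_gt_0_iff)
    then have "0 < (\<beta> - 1) * real (card T)" using par(1) by simp
    also have "\<dots> \<le> real (card (outer_boundary E T))"
      using T(3) l(4) M1 MB by (intro growth[OF T(1)]) linarith
    finally show "outer_boundary E T \<noteq> {}" by auto
  qed
  then show ?thesis using main unfolding M_def by (simp only: distrib_right)
qed

end

text \<open>The left side has degree \<open>N + 2\<close> in \<open>l\<close>; one more power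
  absorbs the constants in \<open>D\<close> once \<open>l\<close> is large. This explains the
  sparsity exponent \<open>N + 3\<close>.\<close>

lemma polylog_bound:
  fixes l D :: real
  assumes "1 \<le> l" "0 \<le> D" "(D + 1) * (2 * (D + 1) * (D + 1) + 1) \<le> l"
  shows "(D + 1) * ((D + 1) * (l\<^sup>2 + 1) * (1 + D * l ^ N) + 1) \<le> l powr real (N + 3)"
proof -
  have l2: "1 \<le> l\<^sup>2" and lN: "1 \<le> l ^ N" and lN2: "1 \<le> l ^ (N + 2)" using assms(1) by (auto intro: one_le_power simp del: power_Suc)
  have "(D + 1) * (l\<^sup>2 + 1) * (1 + D * l ^ N) \<le> (D + 1) * (2 * l\<^sup>2) * ((D + 1) * l ^ N)"
  proof (intro mult_mono)
    show "1 + D * l ^ N \<le> (D + 1) * l ^ N" using lN by (simp add: algebra_simps)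
  qed (use l2 lN assms in auto)
  also have "\<dots> = 2 * (D + 1) * (D + 1) * l ^ (N + 2)" by (simp only: power_add mult_ac)
  finally have "(D + 1) * (l\<^sup>2 + 1) * (1 + D * l ^ N) + 1 \<le> 2 * (D + 1) * (D + 1) * l ^ (N + 2) + l ^ (N + 2)"
    using lN2 by linarith
  also have "\<dots> = (2 * (D + 1) * (D + 1) + 1) * l ^ (N + 2)" by (simp only: distrib_right mult_1)
  finally have "(D + 1) * ((D + 1) * (l\<^sup>2 + 1) * (1 + D * l ^ N) + 1) \<le> (D + 1) * ((2 * (D + 1) * (D + 1) + 1) * l ^ (N + 2))"
    using assms(2) by (intro mult_left_mono) auto
  also have "\<dots> \<le> l * l ^ (N + 2)"
    unfolding mult.assoc[symmetric] using assms(3) lN2 by (intro mult_right_mono) (auto simp: mult.assoc)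
  also have "\<dots> = l ^ (N + 3)" by (simp add: eval_nat_numeral)
  also have "\<dots> = l powr real (N + 3)" by (rule powr_realpow[symmetric]) (use assms(1) in simp)
  finally show ?thesis .
qed

section \<open>Asymptotics of the error terms\<close>

lemma eventually_mult_less_exp:
  fixes c K :: real
  assumes "0 < c"
  shows "eventually (\<lambda>l. K * l < c * exp l) at_top"
proof -
  have "((\<lambda>l. K * (l ^ 1 / exp l)) \<longlongrightarrow> K * 0) at_top"
    by (intro tendsto_mult tendsto_const tendsto_power_div_exp_0)
  then have "eventually (\<lambda>l. K * (l ^ 1 / exp l) < c) at_top" using assms by (intro order_tendstoD(2)) auto
  then show ?thesis by (rule eventually_mono) (simp add: field_simps)
qed

lemma eventually_error_le:
  fixes A \<eta> :: real
  assumes "0 < \<eta>"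
  shows "eventually (\<lambda>l. 8 * exp (- l) + A * l ^ m * exp (- l) / B \<le> \<eta>) at_top"
proof -
  have "((\<lambda>l. 8 * (l ^ 0 / exp l) + A / B * (l ^ m / exp l)) \<longlongrightarrow> 8 * 0 + A / B * 0) at_top"
    by (intro tendsto_add tendsto_mult tendsto_const tendsto_power_div_exp_0)
  then have "eventually (\<lambda>l. 8 * (l ^ 0 / exp l) + A / B * (l ^ m / exp l) < \<eta>) at_top"
    using assms by (intro order_tendstoD(2)) auto
  then show ?thesis by (rule eventually_mono) (simp add: exp_minus field_simps)
qed

text \<open>First \<open>h\<close> is fixed with \<open>A h\<close> small, then \<delta> tends to
  zero. The infimum makes the choice of \<open>h\<close> for each \<delta>, and the added \<delta>
  leaves room because the infimum need not be attained.\<close>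

lemma inf_error_tendsto_0:
  fixes A :: "nat \<Rightarrow> real" and k :: "nat \<Rightarrow> real"
  assumes "A \<longlonglongrightarrow> 0" "\<And>h. 0 \<le> A h" "\<And>h. 0 \<le> k h"
  shows "((\<lambda>\<delta>. (INF h. A h + k h * \<delta>) + \<delta>) \<longlongrightarrow> 0) (at_right 0)"
proof (rule tendstoI)
  fix e :: real assume e: "0 < e"
  have "eventually (\<lambda>h. A h < e / 2) sequentially" using assms(1) e by (intro order_tendstoD(2)) auto
  then obtain h where h: "A h < e / 2" by (auto simp: eventually_sequentially)
  define b where "b = e / (2 * (k h + 1))"
  have b: "0 < b" using e assms(3)[of h] by (simp add: b_def)
  have "dist ((INF h. A h + k h * \<delta>) + \<delta>) 0 < e" if \<delta>: "0 < \<delta>" "\<delta> < b" for \<delta>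
  proof -
    have nn: "0 \<le> A i + k i * \<delta>" for i using assms(2,3) \<delta>(1) by simp
    have "0 \<le> (INF h. A h + k h * \<delta>)" by (rule cINF_greatest) (use nn in auto)
    moreover have "(INF h. A h + k h * \<delta>) \<le> A h + k h * \<delta>"
      by (rule cINF_lower) (use nn in \<open>auto intro!: bdd_belowI[of _ 0]\<close>)
    moreover have "(k h + 1) * \<delta> < e / 2"
    proof -
      have "(k h + 1) * \<delta> < (k h + 1) * b" using \<delta>(2) assms(3)[of h] by (intro mult_strict_left_mono) auto
      also have "\<dots> = e / 2"
      proof -
        have "k h + 1 \<noteq> 0" using assms(3)[of h] by simp
        then show ?thesis unfolding b_def by (simp add: field_simps)
      qed
      finally show ?thesis .
    qed
    ultimately show ?thesis using h \<delta>(1) by (simp add: dist_real_def algebra_simps)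
  qed
  then show "eventually (\<lambda>\<delta>. dist ((INF h. A h + k h * \<delta>) + \<delta>) 0 < e) (at_right 0)"
    unfolding eventually_at_right_field using b by blast
qed

text \<open>The order of the quantifiers records the dependence of the constants: the cap and
  \<open>C\<close> come before \<open>d\<close> and \<open>b\<close>, and the error function before
  \<delta>, as the notation for a term vanishing with \<delta> demands. High probability is uniform
  over all graphs on \<open>n\<close> vertices.\<close>

theorem theorem1p4:
  fixes \<alpha> :: real
  assumes "1 < \<alpha>"
  shows "\<exists>\<delta>\<^sub>0>0. \<exists>C>0. \<forall>(d::nat) (b::real). d \<ge> 3 \<and> \<alpha> < real d - 1 \<and> b > 0 \<longrightarrow>
    (\<exists>(\<epsilon>::real \<Rightarrow> real) (c::real). (\<epsilon> \<longlongrightarrow> 0) (at_right 0) \<and> c > 0 \<and>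
      (\<forall>\<delta>. 0 < \<delta> \<and> \<delta> \<le> \<delta>\<^sub>0 \<longrightarrow>
        (\<forall>\<eta>>0. eventually (\<lambda>n. \<forall>(V::nat set) E.
           card V = n \<and> regular_graph d V E \<and> edge_expanding b V E \<and> locally_sparse \<delta> C V E \<longrightarrow>
           (let p = \<alpha> / (real d - 1) in
             measure_pmf.prob (random_subset p V)
               {U. unique_giant c (giant_density d p) (\<epsilon> \<delta>)
                     (9 * \<alpha> / ((1 - \<delta>) / (1 + \<delta>) * \<alpha> - 1)\<^sup>2) V E U} \<ge> 1 - \<eta>)) sequentially)))"
proof -
  \<comment> \<open>The bound \<open>1 / 10\<close> serves the inequalities for \<beta>; the other
    is half of \<open>(\<alpha> - 1) / (\<alpha> + 1)\<close>, below which \<open>a\<close> exceeds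
    one.\<close>
  define \<delta>0 where "\<delta>0 = min (1 / 10) ((\<alpha> - 1) / (2 * (\<alpha> + 1)))"
  have \<delta>0: "0 < \<delta>0" "\<delta>0 \<le> 1 / 10" using assms unfolding \<delta>0_def by (simp, intro min.cobounded1)
  define a where "a = (1 - \<delta>0) / (1 + \<delta>0) * \<alpha>"
  have a1: "1 < a"
  proof -
    have "\<delta>0 \<le> (\<alpha> - 1) / (2 * (\<alpha> + 1))" by (simp add: \<delta>0_def)
    then have "\<delta>0 * (2 * (\<alpha> + 1)) \<le> \<alpha> - 1" using assms by (simp add: field_simps)
    then have "1 + \<delta>0 < (1 - \<delta>0) * \<alpha>" using assms by (simp add: algebra_simps)
    then show ?thesis using \<delta>0 by (simp add: a_def field_simps)
  qed
  define \<gamma> where "\<gamma> = (a - 1 - ln a) / (2 * \<alpha>)"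
  \<comment> \<open>Like \<gamma>, the number \<open>k\<close> depends on \<alpha> only, and so does
    the exponent \<open>N\<close>.\<close>
  obtain k where "1 / \<gamma> < 2 ^ k" using real_arch_pow[of 2 "1 / \<gamma>"] by auto
  then have k: "1 / \<gamma> \<le> 2 ^ k" by simp
  define N where "N = 14 + 8 * Suc k"
  have main: "\<exists>(\<epsilon>::real \<Rightarrow> real) (c::real). (\<epsilon> \<longlongrightarrow> 0) (at_right 0) \<and> c > 0 \<and>
      (\<forall>\<delta>. 0 < \<delta> \<and> \<delta> \<le> \<delta>0 \<longrightarrow>
        (\<forall>\<eta>>0. eventually (\<lambda>n. \<forall>(V::nat set) E.
           card V = n \<and> regular_graph d V E \<and> edge_expanding b V E \<and> locally_sparse \<delta> (real (N + 3)) V E \<longrightarrow>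
           (let p = \<alpha> / (real d - 1) in
             measure_pmf.prob (random_subset p V)
               {U. unique_giant c (giant_density d p) (\<epsilon> \<delta>)
                     (9 * \<alpha> / ((1 - \<delta>) / (1 + \<delta>) * \<alpha> - 1)\<^sup>2) V E U} \<ge> 1 - \<eta>)) sequentially))"
    if d: "3 \<le> d" "\<alpha> < real d - 1" and b: "0 < b" for d :: nat and b :: real
  proof -
    define D where "D = real d - 1"
    define \<beta> where "\<beta> = (D - \<delta>0) / (1 + \<delta>0)"
    define p where "p = \<alpha> / D"
    define q where "q = 1 / D"
    have D2: "2 \<le> D" "\<alpha> < D" using d by (auto simp: D_def)
    note par = sprinkling_parameters(1,3,5,6)[OF assms D2 \<delta>0 a1[unfolded a_def],
        folded a_def \<beta>_def p_def]
    have qp: "1 / (real d - 1) < p" unfolding p_def D_def[symmetric] using assms D2 by (simp add: divide_strict_right_mono)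
    obtain r where r: "0 < r" "r < 1 / D" "p * (1 - p) ^ (d - 2) = r * (1 - r) ^ (d - 2)"
      and x: "giant_density d p = p - ((1 - p) / (1 - r))\<^sup>2 * r" "0 < giant_density d p" "giant_density d p \<le> 1"
      by (rule dual_density[OF d(1) qp par(4), folded D_def])
    define x where "x = giant_density d p"
    define \<rho> where "\<rho> = r * (1 - r) ^ (d - 2) / (q * (1 - q) ^ (d - 2))"
    have q01: "0 < q" "q < 1" using D2 by (auto simp: q_def)
    have \<rho>: "0 \<le> \<rho>" "\<rho> < 1"
    proof -
      have dk: "d - 2 = Suc (d - 3)" "real (d - 3) + 2 = D" using d(1) by (auto simp: D_def)
      have "r * (1 - r) ^ (d - 2) < q * (1 - q) ^ (d - 2)"
        unfolding dk(1) using r(1,2) dk(2) by (intro mult_power_less_left) (auto simp: q_def)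
      moreover have "0 < q * (1 - q) ^ (d - 2)" using q01 by simp
      ultimately show "\<rho> < 1" by (simp add: \<rho>_def)
      show "0 \<le> \<rho>" using q01 r(1,2) by (simp add: \<rho>_def q_def[symmetric])
    qed
    define \<mu> where "\<mu> = \<beta> * p - 1 - ln (\<beta> * p)"
    have bp: "1 < \<beta> * p" using par(2) a1 by simp
    have \<mu>0: "0 < \<mu>" unfolding \<mu>_def by (rule rate_pos[OF bp])
    define A where "A h = ((1 - p) / (1 - r))\<^sup>2 * (q * ((1 - r) / (1 - q))\<^sup>2) * \<rho> ^ h + exp (- (\<mu> * real h))" for h
    define \<Delta> where "\<Delta> h = 4 * real ((d + 1) ^ (2 * (h + 1)))" for h
    have A0: "0 \<le> A h" for h using q01 \<rho>(1) by (simp add: A_def)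
    have \<Delta>0: "0 \<le> \<Delta> h" for h by (simp add: \<Delta>_def)
    have A_lim: "A \<longlonglongrightarrow> 0"
    proof -
      have "(\<lambda>h. \<rho> ^ h) \<longlonglongrightarrow> 0" using \<rho> by (intro LIMSEQ_realpow_zero) auto
      moreover have "(\<lambda>h. exp (- \<mu>) ^ h) \<longlonglongrightarrow> 0" using \<mu>0 by (intro LIMSEQ_realpow_zero) auto
      then have "(\<lambda>h. exp (- (\<mu> * real h))) \<longlonglongrightarrow> 0" by (simp add: exp_of_nat_mult[symmetric] mult.commute)
      ultimately have "A \<longlonglongrightarrow> ((1 - p) / (1 - r))\<^sup>2 * (q * ((1 - r) / (1 - q))\<^sup>2) * 0 + 0"
        unfolding A_def by (intro tendsto_add tendsto_mult tendsto_const)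
      then show ?thesis by simp
    qed
    define err where "err \<delta> = (INF h. A h + \<Delta> h * \<delta>) + \<delta>" for \<delta>
    define \<epsilon> where "\<epsilon> \<delta> = err \<delta> / x" for \<delta>
    have x0: "0 < x" using x by (simp add: x_def)
    have "(err \<longlongrightarrow> 0) (at_right 0)"
      unfolding err_def by (rule inf_error_tendsto_0[OF A_lim A0 \<Delta>0])
    then have \<epsilon>: "(\<epsilon> \<longlongrightarrow> 0) (at_right 0)"
      unfolding \<epsilon>_def using tendsto_divide[OF _ tendsto_const[of x], of err 0] x0 by simp
    define c where "c = (p - 1 / \<beta>) / 2"
    have c0: "0 < c" using bp par(1) by (simp add: c_def field_simps)
    have "eventually (\<lambda>n. \<forall>(V::nat set) E.
           card V = n \<and> regular_graph d V E \<and> edge_expanding b V E \<and> locally_sparse \<delta> (real (N + 3)) V E \<longrightarrow>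
             measure_pmf.prob (random_subset p V)
               {U. unique_giant c x (\<epsilon> \<delta>) (9 * \<alpha> / ((1 - \<delta>) / (1 + \<delta>) * \<alpha> - 1)\<^sup>2) V E U} \<ge> 1 - \<eta>) sequentially"
      if \<delta>: "0 < \<delta>" "\<delta> \<le> \<delta>0" and \<eta>: "0 < \<eta>" for \<delta> \<eta>
    proof -
      define K where "K = 9 * \<alpha> / ((1 - \<delta>) / (1 + \<delta>) * \<alpha> - 1)\<^sup>2"
      define c1 where "c1 = (a - 1 - ln a) / 2"
      define c3 where "c3 = b / (4 * real d * D ^ (5 + 6 * Suc k))"
      \<comment> \<open>The spare \<delta> in \<open>err\<close> is divided: one half pays for an
        \<open>h\<close> close to the infimum, the other for the random deviation.\<close>
      define \<xi> where "\<xi> = min c (\<delta> / 2)"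
      have \<xi>: "0 < \<xi>" "\<xi> \<le> c" "\<xi> \<le> \<delta> / 2" using c0 \<delta>(1) by (auto simp: \<xi>_def)
      have "bdd_below (range (\<lambda>h. A h + \<Delta> h * \<delta>))"
        using A0 \<Delta>0 \<delta>(1) by (intro bdd_belowI[of _ 0]) auto
      then have "\<exists>h. A h + \<Delta> h * \<delta> < (INF h. A h + \<Delta> h * \<delta>) + \<delta> / 2"
        using cINF_less_iff[of UNIV "\<lambda>h. A h + \<Delta> h * \<delta>" "(INF h. A h + \<Delta> h * \<delta>) + \<delta> / 2"] \<delta>(1) by auto
      then obtain h where "A h + \<Delta> h * \<delta> < (INF h. A h + \<Delta> h * \<delta>) + \<delta> / 2" by blast
      moreover have "\<epsilon> \<delta> * x = (INF h. A h + \<Delta> h * \<delta>) + \<delta>" using x0 by (simp add: \<epsilon>_def err_def)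
      ultimately have h: "A h + \<Delta> h * \<delta> \<le> \<epsilon> \<delta> * x - \<xi>" using \<xi>(3) by linarith
      \<comment> \<open>All largeness conditions are expressed through \<open>l = ln n\<close> and
        none refers to the graph, so the threshold for \<open>n\<close> is uniform.\<close>
      let ?P = "\<lambda>l. 1 \<le> l \<and> real d + 1 < l \<and> (real d + 1) * (2 * (real d + 1) * (real d + 1) + 1) \<le> l \<and>
        3 / c1 \<le> l \<and> 2 / c3 \<le> l \<and> K * l < c * exp l \<and> real h < l \<and> 1 / \<delta> < l \<and>
        8 * exp (- l) + (real d + 1)\<^sup>2 * l ^ (2 * N) * exp (- l) / \<xi>\<^sup>2 \<le> \<eta>"
      have "eventually ?P at_top"
        by (intro eventually_conj eventually_ge_at_top eventually_gt_at_top
            eventually_mult_less_exp[OF c0] eventually_error_le[OF \<eta>])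
      moreover have "filterlim (\<lambda>n. ln (real n)) at_top sequentially"
        by (rule filterlim_compose[OF ln_at_top filterlim_real_sequentially])
      ultimately have "eventually (\<lambda>n. ?P (ln (real n))) sequentially"
        by (rule eventually_compose_filterlim)
      then show ?thesis
        using eventually_gt_at_top[of 0]
      proof eventually_elim
        case (elim n)
        show ?case
        proof (intro allI impI)
          fix V :: "nat set" and E
          assume *: "card V = n \<and> regular_graph d V E \<and> edge_expanding b V E \<and> locally_sparse \<delta> (real (N + 3)) V E"
          interpret finite_regular_graph d V E by unfold_locales (use * in blast)
          define l where "l = ln (real (card V))"
          have P: "?P l" using elim(1) * unfolding l_def by blast
          have el: "exp l = real (card V)" using elim(2) * by (simp add: l_def)
          have poly: "(real d + 1) * ((real d + 1) * (l\<^sup>2 + 1) * (1 + real d * l ^ N) + 1) \<le> l powr real (N + 3)"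
            using P by (intro polylog_bound) auto
          have sp: "locally_sparse \<delta> (real (N + 3)) V E" and ex: "edge_expanding b V E" using * by blast+
          have approx: "\<bar>subset_exp (\<lambda>_. p) V (\<lambda>U. real (card (large_vertices (l ^ N) U))) - x * real (card V)\<bar>
              \<le> (A h + \<Delta> h * \<delta>) * real (card V)"
            unfolding A_def \<Delta>_def \<mu>_def \<rho>_def \<beta>_def p_def q_def D_def l_def x_def
            by (rule giant_density_approx[OF assms d(2,1) \<delta> \<delta>0(2) a1[unfolded a_def] sp])
              (use P poly r x \<rho> in \<open>auto simp: N_def l_def \<rho>_def \<beta>_def p_def q_def D_def\<close>)
          also have "\<dots> \<le> (\<epsilon> \<delta> * x - \<xi>) * real (card V)" using h by (rule mult_right_mono) simp
          finally have approx': "\<bar>subset_exp (\<lambda>_. p) V (\<lambda>U. real (card (large_vertices (l ^ N) U))) - x * real (card V)\<bar>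
              \<le> (\<epsilon> \<delta> * x - \<xi>) * real (card V)" .
          have "1 - (8 * exp (- l) + (real d + 1)\<^sup>2 * l ^ (2 * N) * exp (- l) / \<xi>\<^sup>2)
              \<le> subset_prob (\<lambda>_. p) V (\<lambda>U. unique_giant c x (\<epsilon> \<delta>) K V E U)"
          proof (rule giant_prob[where k = k, OF assms d(2,1) b \<delta> \<delta>0(2) a1[unfolded a_def] ex sp,
                folded D_def a_def l_def, folded \<gamma>_def \<beta>_def p_def c1_def c3_def K_def,
                OF k N_def _ _ poly _ _ _ c_def \<xi>(1,2) approx'])
            show "1 \<le> l" "real d + 1 < l" "3 / c1 \<le> l" "2 / c3 \<le> l" using P by blast+
            show "K * l < c * real (card V)" using P unfolding el by blast
          qed
          moreover have "measure_pmf.prob (random_subset p V) {U. unique_giant c x (\<epsilon> \<delta>) K V E U} =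
              subset_prob (\<lambda>_. p) V (\<lambda>U. unique_giant c x (\<epsilon> \<delta>) K V E U)"
            by (rule prob_random_subset[OF finite_V]) (use par in auto)
          moreover have "8 * exp (- l) + (real d + 1)\<^sup>2 * l ^ (2 * N) * exp (- l) / \<xi>\<^sup>2 \<le> \<eta>" using P by blast
          ultimately show "1 - \<eta> \<le> measure_pmf.prob (random_subset p V)
               {U. unique_giant c x (\<epsilon> \<delta>) (9 * \<alpha> / ((1 - \<delta>) / (1 + \<delta>) * \<alpha> - 1)\<^sup>2) V E U}"
            unfolding K_def[symmetric] by linarith
        qed
      qed
    qed
    then show ?thesis
      using \<epsilon> c0 unfolding x_def p_def D_def Let_def by blast
  qed
  show ?thesis
    by (intro exI[of _ \<delta>0] exI[of _ "real (N + 3)"] conjI allI impI main) (use \<delta>0 in auto)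
qed

end
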